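(* Let $\mathbb{F}$ be a finite field and let $P(y) \in (\mathbb{F}[t])[y]$ be a nonconstant polynomial. The following are equivalent: (i) $\sup_{\|f\|_{L^2(\mathbb{F}[t]_Q)}=1} \| \mathbb{E}_{y\in\mathbb{F}[t]_Q} f(x+P(y)) - \mathbb{E}_{z\in\mathbb{F}[t]_Q} f(z)\|_{L^2(\mathbb{F}[t]_Q)} \to 0$ as $\mathrm{lpf}(Q)\to\infty$ over monic $Q\in\mathbb{F}[t]$ (i.e., for every $\varepsilon>0$ there is $N$ such that this supremum is at most $\varepsilon$ for all monic $Q$ with $\mathrm{lpf}(Q)\ge N$); (ii) there exist $C_1, C_2, \gamma > 0$ such that for every monic $Q$ with $\mathrm{lpf}(Q) \ge C_1$, that supremum is at most $C_2\,\mathrm{lpf}(Q)^{-\gamma}$; (iii) there exists $C > 0$ such that for every monic $Q$ with $\mathrm{lpf}(Q)\ge C$ one has $H + Q\mathbb{F}[t] = \mathbb{F}[t]$, where $H \le (\mathbb{F}[t],+)$ is the subgroup generated by $\{P(y)-P(0) : y \in \mathbb{F}[t]\}$; (iv) for every $\delta > 0$ there exists $N>0$ such that if $Q$ is monic with $\mathrm{lpf}(Q)\ge N$ and $A, B \subseteq \mathbb{F}[t]_Q$ satisfy $|A||B| \ge \delta |Q|^2$, then there exist $x, y \in \mathbb{F}[t]_Q$ with $x\in A$ and $x+P(y)\in B$; (v) there exist $C_1, C_2, \gamma > 0$ such that for every monic $Q$ with $\mathrm{lpf}(Q)\ge C_1$ and all $A,B\subseteq\mathbb{F}[t]_Q$,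 \[ \Big| |\{(x,y)\in\mathbb{F}[t]_Q^2 : x\in A,\ x+P(y)\in B\}| - |A||B| \Big| \le C_2 |A|^{1/2}|B|^{1/2}|Q|\,\mathrm{lpf}(Q)^{-\gamma}. \] Moreover, if $P$ is good for irrational equidistribution, then each of (i)–(v) holds.
   Context: $\mathbb{F}[t]_Q=\mathbb{F}[t]/Q\mathbb{F}[t]$; $P$ is evaluated on it after reducing coefficients mod $Q$; $L^2$ norms are in the variable $x$, with $\|f\|_{L^2(S)}=(\mathbb{E}_{x\in S}|f(x)|^2)^{1/2}$ and $\mathbb{E}$ the average. $|Q|=|\mathbb{F}|^{\deg Q}$; for $Q=Q_1^{s_1}\cdots Q_r^{s_r}$ (distinct monic irreducibles), $\mathrm{lpf}(Q)=\min_i|Q_i|$. $\mathbb{F}((t^{-1}))$ is the field of formal Laurent series in $t^{-1}$ over $\mathbb{F}$; $\mathbb{F}((t^{-1}))/\mathbb{F}[t]$ is compact with Haar probability $m$. A Følner sequence in $\mathbb{F}[t]$ is a sequence of finite nonempty $\Phi_N\subseteq\mathbb{F}[t]$ with $|(\Phi_N+n)\triangle\Phi_N|/|\Phi_N|\to0$ for all $n$. $a:\mathbb{F}[t]\to\mathbb{F}((t^{-1}))$ is well-distributed mod $\mathbb{F}[t]$ if $\lim_N\mathbb{E}_{n\in\Phi_N}g(a(n))=\int g\,dm$ for every continuous $g$ on $\mathbb{F}((t^{-1}))/\mathbb{F}[t]$ and every Følner sequence. $P$ is good for irrational equidistribution if $(P(n)\alpha)_{n\in\mathbb{F}[t]}$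 is well-distributed mod $\mathbb{F}[t]$ for every $\alpha\in\mathbb{F}((t^{-1}))\setminus\mathbb{F}(t)$. *)

theory Defs
  imports
    "HOL-Probability.Probability_Measure"
    "HOL-Computational_Algebra.Formal_Laurent_Series"
    "HOL-Computational_Algebra.Group_Closure"
begin

section \<open>The residue rings of a polynomial ring over a finite field\<close>

definition poly_norm :: "'a::{field,finite} poly \<Rightarrow> nat" where
  "poly_norm Q = CARD('a) ^ degree Q"

text \<open>Only meaningful for \<open>Q\<close> of positive degree; a constant has no irreducible factors, so the
  minimum would be taken over the empty set.\<close>
definition lpf :: "'a::{field,finite} poly \<Rightarrow> nat" where
  "lpf Q = Min {poly_norm R |R. lead_coeff R = 1 \<and> irreducible R \<and> R dvd Q}"

text \<open>The quotient ring modulo \<open>Q\<close> is represented by the canonical representatives modulo \<open>Q\<close>, with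
  sums reduced by \<open>mod Q\<close>.  Since \<open>mod Q\<close> is a ring homomorphism onto this quotient, evaluating
  \<open>P\<close> in the polynomial ring and then reducing agrees with evaluating the reduction of \<open>P\<close>.\<close>
definition residues :: "'a::field poly \<Rightarrow> 'a poly set" where
  "residues Q = {x. x mod Q = x}"

definition average :: "'b set \<Rightarrow> ('b \<Rightarrow> 'c::field) \<Rightarrow> 'c" where
  "average S f = (\<Sum>x\<in>S. f x) / of_nat (card S)"

definition l2_norm :: "'b set \<Rightarrow> ('b \<Rightarrow> complex) \<Rightarrow> real" where
  "l2_norm S f = sqrt (average S (\<lambda>x. (cmod (f x))\<^sup>2))"

definition deviation :: "'a::field poly poly \<Rightarrow> 'a poly \<Rightarrow> real" where
  "deviation P Q =
     Sup {l2_norm (residues Q)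
            (\<lambda>x. average (residues Q) (\<lambda>y. f ((x + poly P y) mod Q)) - average (residues Q) f)
          |f. l2_norm (residues Q) f = 1}"

section \<open>The equivalent conditions\<close>

definition deviation_vanishes :: "'a::{field,finite} poly poly \<Rightarrow> bool" where
  "deviation_vanishes P \<longleftrightarrow>
     (\<forall>\<epsilon>>0. \<exists>N::real. \<forall>Q. lead_coeff Q = 1 \<and> 0 < degree Q \<and> N \<le> real (lpf Q) \<longrightarrow>
        deviation P Q \<le> \<epsilon>)"

definition deviation_power_saving :: "'a::{field,finite} poly poly \<Rightarrow> bool" where
  "deviation_power_saving P \<longleftrightarrow>
     (\<exists>C\<^sub>1 C\<^sub>2 \<gamma> :: real. 0 < C\<^sub>1 \<and> 0 < C\<^sub>2 \<and> 0 < \<gamma> \<and>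
        (\<forall>Q. lead_coeff Q = 1 \<and> 0 < degree Q \<and> C\<^sub>1 \<le> real (lpf Q) \<longrightarrow>
           deviation P Q \<le> C\<^sub>2 * real (lpf Q) powr (- \<gamma>)))"

definition value_subgroup :: "'a::field poly poly \<Rightarrow> 'a poly set" where
  "value_subgroup P = group_closure {poly P y - poly P 0 |y. True}"

definition value_subgroup_covers :: "'a::{field,finite} poly poly \<Rightarrow> bool" where
  "value_subgroup_covers P \<longleftrightarrow>
     (\<exists>C::real. 0 < C \<and>
        (\<forall>Q. lead_coeff Q = 1 \<and> 0 < degree Q \<and> C \<le> real (lpf Q) \<longrightarrow>
           {h + Q * r |h r. h \<in> value_subgroup P} = UNIV))"

definition dense_pairs_connected :: "'a::{field,finite} poly poly \<Rightarrow> bool" where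
  "dense_pairs_connected P \<longleftrightarrow>
     (\<forall>\<delta>::real. 0 < \<delta> \<longrightarrow> (\<exists>N::real. 0 < N \<and>
        (\<forall>Q A B. lead_coeff Q = 1 \<and> 0 < degree Q \<and> N \<le> real (lpf Q) \<and>
           A \<subseteq> residues Q \<and> B \<subseteq> residues Q \<and>
           real (card A) * real (card B) \<ge> \<delta> * (real (poly_norm Q))\<^sup>2 \<longrightarrow>
           (\<exists>x\<in>residues Q. \<exists>y\<in>residues Q. x \<in> A \<and> (x + poly P y) mod Q \<in> B))))"

definition pair_count_power_saving :: "'a::{field,finite} poly poly \<Rightarrow> bool" where
  "pair_count_power_saving P \<longleftrightarrow>
     (\<exists>C\<^sub>1 C\<^sub>2 \<gamma> :: real. 0 < C\<^sub>1 \<and> 0 < C\<^sub>2 \<and> 0 < \<gamma> \<and>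
        (\<forall>Q A B. lead_coeff Q = 1 \<and> 0 < degree Q \<and> C\<^sub>1 \<le> real (lpf Q) \<and>
           A \<subseteq> residues Q \<and> B \<subseteq> residues Q \<longrightarrow>
           \<bar>real (card {(x, y). x \<in> residues Q \<and> y \<in> residues Q \<and> x \<in> A \<and> (x + poly P y) mod Q \<in> B})
              - real (card A) * real (card B)\<bar>
           \<le> C\<^sub>2 * sqrt (real (card A)) * sqrt (real (card B)) * real (poly_norm Q)
               * real (lpf Q) powr (- \<gamma>)))"

section \<open>Laurent series in the inverse variable modulo polynomials\<close>

text \<open>In the type of formal Laurent series over \<open>'a\<close> the formal variable \<open>fls_X\<close> plays the
  role of \<open>1/t\<close>, so a polynomial in \<open>t\<close> is embedded by substituting \<open>fls_X_inv\<close> for \<open>t\<close>.\<close>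
definition fls_of_poly_inv :: "'a::field poly \<Rightarrow> 'a fls" where
  "fls_of_poly_inv p = poly (map_poly fls_const p) fls_X_inv"

lemma fls_of_poly_inv_add: "fls_of_poly_inv (p + q) = fls_of_poly_inv p + fls_of_poly_inv q"
proof -
  have "map_poly fls_const (p + q) = map_poly fls_const p + map_poly fls_const q"
    by (rule poly_eqI) (simp add: coeff_map_poly fls_plus_const)
  then show ?thesis by (simp add: fls_of_poly_inv_def)
qed

lemma fls_of_poly_inv_0: "fls_of_poly_inv 0 = 0"
  by (simp add: fls_of_poly_inv_def)

lemma fls_of_poly_inv_minus: "fls_of_poly_inv (- p) = - fls_of_poly_inv p"
  using fls_of_poly_inv_add[of p "- p"] by (simp add: fls_of_poly_inv_0 add_eq_0_iff)

definition rational_fls :: "'a::field fls set" where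
  "rational_fls = {fls_of_poly_inv p / fls_of_poly_inv q |p q. q \<noteq> 0}"

definition cong_mod_poly :: "'a::field fls \<Rightarrow> 'a fls \<Rightarrow> bool" where
  "cong_mod_poly x y \<longleftrightarrow> (\<exists>p. y - x = fls_of_poly_inv p)"

lemma equivp_cong_mod_poly: "equivp (cong_mod_poly :: 'a::field fls \<Rightarrow> 'a fls \<Rightarrow> bool)"
proof (rule equivpI)
  show "reflp (cong_mod_poly :: 'a fls \<Rightarrow> 'a fls \<Rightarrow> bool)"
    by (rule reflpI) (metis cong_mod_poly_def diff_self fls_of_poly_inv_0)
  show "symp (cong_mod_poly :: 'a fls \<Rightarrow> 'a fls \<Rightarrow> bool)"
    by (rule sympI) (metis cong_mod_poly_def fls_of_poly_inv_minus minus_diff_eq)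
  show "transp (cong_mod_poly :: 'a fls \<Rightarrow> 'a fls \<Rightarrow> bool)"
  proof (rule transpI)
    fix x y z :: "'a fls"
    assume "cong_mod_poly x y" "cong_mod_poly y z"
    then obtain p q where "y - x = fls_of_poly_inv p" "z - y = fls_of_poly_inv q"
      by (auto simp: cong_mod_poly_def)
    then have "z - x = fls_of_poly_inv (q + p)"
      by (simp add: fls_of_poly_inv_add algebra_simps)
    then show "cong_mod_poly x z"
      by (auto simp: cong_mod_poly_def)
  qed
qed

text \<open>Keep lifting at the level of Laurent series, not of their coefficient sequences.\<close>
lifting_forget fls.lifting

quotient_type (overloaded) 'a fls_torus = "'a::field fls" / cong_mod_poly
  by (rule equivp_cong_mod_poly)

definition torus_proj :: "'a::field fls \<Rightarrow> 'a fls_torus" where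
  "torus_proj = abs_fls_torus"

instantiation fls_torus :: (field) ab_group_add
begin

lift_definition zero_fls_torus :: "'a fls_torus" is 0 .

lift_definition plus_fls_torus :: "'a fls_torus \<Rightarrow> 'a fls_torus \<Rightarrow> 'a fls_torus" is "(+)"
  by (metis (no_types) cong_mod_poly_def fls_of_poly_inv_add add_diff_add)

lift_definition uminus_fls_torus :: "'a fls_torus \<Rightarrow> 'a fls_torus" is uminus
  by (metis (no_types) cong_mod_poly_def fls_of_poly_inv_minus minus_diff_minus)

definition minus_fls_torus :: "'a fls_torus \<Rightarrow> 'a fls_torus \<Rightarrow> 'a fls_torus" where
  "minus_fls_torus x y = x + - y"

instance
proof
  have refl: "cong_mod_poly x x" for x :: "'a fls"
    by (rule equivp_reflp[OF equivp_cong_mod_poly])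
  fix a b c :: "'a fls_torus"
  show "a + b + c = a + (b + c)"
    by transfer (simp add: refl add.assoc)
  show "a + b = b + a"
    by transfer (simp add: refl add.commute)
  show "0 + a = a"
    by transfer (simp add: refl)
  show "- a + a = 0"
    by transfer (simp add: refl)
  show "a - b = a + - b"
    by (rule minus_fls_torus_def)
qed

end

text \<open>The quotient topology; Laurent series carry the library's valuation topology.\<close>
instantiation fls_torus :: (field) topological_space
begin

definition open_fls_torus :: "'a fls_torus set \<Rightarrow> bool" where
  "open_fls_torus U \<longleftrightarrow> open (torus_proj -` U)"

instance
proof
  show "open (UNIV :: 'a fls_torus set)"
    by (simp add: open_fls_torus_def)
  show "open (S \<inter> T)" if "open S" "open T" for S T :: "'a fls_torus set"
    using that by (simp add: open_fls_torus_def open_Int)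
  show "open (\<Union>K)" if "\<forall>S\<in>K. open S" for K :: "'a fls_torus set set"
    using that by (simp add: open_fls_torus_def vimage_Union open_UN)
qed

end

text \<open>The torus is a compact metrizable group, so there is exactly one such measure.\<close>
definition haar_probability :: "'a::{field,finite} fls_torus measure \<Rightarrow> bool" where
  "haar_probability m \<longleftrightarrow>
     prob_space m \<and> sets m = sets borel \<and> (\<forall>h. distr m borel (\<lambda>x. h + x) = m)"

definition folner :: "(nat \<Rightarrow> 'a::{field,finite} poly set) \<Rightarrow> bool" where
  "folner \<Phi> \<longleftrightarrow>
     (\<forall>N. finite (\<Phi> N) \<and> \<Phi> N \<noteq> {}) \<and>
     (\<forall>n. (\<lambda>N. real (card (sym_diff ((\<lambda>x. x + n) ` \<Phi> N) (\<Phi> N))) / real (card (\<Phi> N)))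
            \<longlonglongrightarrow> 0)"

definition well_distributed :: "('a::{field,finite} poly \<Rightarrow> 'a fls) \<Rightarrow> bool" where
  "well_distributed a \<longleftrightarrow>
     (\<exists>m. haar_probability m \<and>
        (\<forall>(g :: 'a fls_torus \<Rightarrow> complex) \<Phi>. continuous_on UNIV g \<and> folner \<Phi> \<longrightarrow>
           (\<lambda>N. average (\<Phi> N) (\<lambda>n. g (torus_proj (a n)))) \<longlonglongrightarrow> integral\<^sup>L m g))"

definition good_for_irrational_equidistribution :: "'a::{field,finite} poly poly \<Rightarrow> bool" where
  "good_for_irrational_equidistribution P \<longleftrightarrow>
     (\<forall>\<alpha>. \<alpha> \<notin> rational_fls \<longrightarrow> well_distributed (\<lambda>n. fls_of_poly_inv (poly P n) * \<alpha>))"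

end

theory Submission
  imports Defs
begin

text \<open>The operator \<open>f \<mapsto> E_y f(x + P(y)) - E f\<close> is diagonal in the characters modulo \<open>Q\<close>, with eigenvalues
  \<open>E_y e(a P(y))\<close>, so all five conditions reduce to bounding these sums. Raising to the power of the
  characteristic is additive, hence \<open>e(a (P(y) - P(0))) = e(G(y))\<close> for some \<open>G\<close> whose exponents are all
  prime to the characteristic; if the values of \<open>P - P(0)\<close> generate everything modulo \<open>Q\<close>, then \<open>G\<close> is
  not zero modulo \<open>Q\<close>. Averaging over a coset of a minimal ideal reduces the sum to an irreducible
  modulus, where Mordell's moment method gives a power saving. Conversely, a character that is trivial
  on the values of \<open>P - P(0)\<close> yields dense sets that are not connected. If such obstructions exist for
  moduli with arbitrarily large prime factors, then they are infinitely many, and a diagonal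
  argument produces a character \<open>n \<mapsto> e(n \<alpha>)\<close> with \<open>\<alpha>\<close> irrational that is constant along \<open>P\<close>.\<close>

text \<open>All bounds must be uniform over every monic \<open>Q\<close>, composite and
  non-squarefree ones included, so the constants may depend on \<open>degree P\<close> only. The
  obstacle is the characteristic p. A nonconstant polynomial can have a constant phase, because
  \<open>e (c * z ^ p)\<close> agrees with some \<open>e (b * z)\<close>; and both Newton's
  identities and differentiation lose the exponents divisible by p. Trading every exponent for one
  prime to p repairs both defects. The replacement \<open>G\<close> depends on \<open>Q\<close>, on
  \<open>e\<close> and on the frequency \<open>a\<close>, but its degree is at most that of
  \<open>P\<close>, which is all that the constants see. With d = \<open>degree P\<close> the saving
  is \<gamma> = 1/(2d), the moment method being run with 2d-th moments. The constant 2 d^(d+1)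
  collects d^d from the arrangements of a tuple with known symmetric functions, d from the
  multipliers that give the same coefficient vector, and 2 from comparing the norm K of an
  irreducible polynomial with K - 1.\<close>

lemma residues_altdef: "residues Q = {x. x = 0 \<or> degree x < degree Q}" if "Q \<noteq> 0" for Q :: "'a::field poly"
proof -
  have "x mod Q = x \<longleftrightarrow> x = 0 \<or> degree x < degree Q" for x
    using that degree_mod_less[of Q x] mod_poly_less[of x Q] by auto
  then show ?thesis by (auto simp: residues_def)
qed

lemma mod_in_residues [simp]: "x mod Q \<in> residues Q"
  by (simp add: residues_def)

text \<open>The disjunct \<open>x = 0\<close> accounts for \<open>degree 0 = 0\<close>: at
  \<open>n = 0\<close> it keeps the single residue modulo a nonzero constant.\<close>

lemma card_polys_degree_less:
  "finite {x :: 'a::{field,finite} poly. x = 0 \<or> degree x < n} \<and>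
   card {x :: 'a poly. x = 0 \<or> degree x < n} = CARD('a) ^ n"
proof (induction n)
  case 0
  have "{x :: 'a poly. x = 0 \<or> degree x < 0} = {0}" by auto
  then show ?case by simp
next
  case (Suc n)
  let ?S = "\<lambda>n. {x :: 'a poly. x = 0 \<or> degree x < n}"
  have "?S (Suc n) = case_prod pCons ` (UNIV \<times> ?S n)"
  proof (intro equalityI subsetI)
    fix x assume x: "x \<in> ?S (Suc n)"
    obtain a y where xy: "x = pCons a y" by (cases x)
    with x have "y \<in> ?S n" by (auto split: if_splits)
    with xy show "x \<in> case_prod pCons ` (UNIV \<times> ?S n)" by auto
  qed (auto split: if_splits)
  moreover have "inj_on (case_prod pCons) (UNIV \<times> ?S n)"
    by (auto simp: inj_on_def)
  ultimately show ?case using Suc by (auto simp: card_image card_cartesian_product)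
qed

lemma finite_residues [simp, intro]: "Q \<noteq> 0 \<Longrightarrow> finite (residues (Q :: 'a::{field,finite} poly))"
  by (simp only: residues_altdef card_polys_degree_less[THEN conjunct1] not_False_eq_True)

lemma card_residues: "Q \<noteq> 0 \<Longrightarrow> card (residues (Q :: 'a::{field,finite} poly)) = poly_norm Q"
  by (simp only: residues_altdef poly_norm_def card_polys_degree_less[THEN conjunct2] not_False_eq_True)

lemma poly_norm_pos [simp]: "0 < poly_norm Q"
  by (simp add: poly_norm_def)

lemma poly_norm_nonzero [simp]: "poly_norm Q \<noteq> 0"
  by (simp add: poly_norm_def)

lemma zero_in_residues [simp]: "0 \<in> residues Q"
  by (simp add: residues_def)

lemma residues_eq_iff_dvd: "x = y \<longleftrightarrow> Q dvd x - y" if "x \<in> residues Q" "y \<in> residues Q"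
  for x y Q :: "'a::field poly"
  using that mod_eq_dvd_iff[of x Q y] by (auto simp: residues_def)

section \<open>Ideals and irreducible polynomials over a field\<close>

text \<open>An element of least degree generates, because remainders by it stay in \<open>J\<close>.
  This supplies Bezout relations, the annihilator of the coefficients of a phase and the period
  ideal of a character.\<close>

lemma poly_ideal_principal:
  fixes J :: "'a::field poly set"
  assumes add: "\<And>x y. x \<in> J \<Longrightarrow> y \<in> J \<Longrightarrow> x + y \<in> J"
    and mult: "\<And>x z. x \<in> J \<Longrightarrow> z * x \<in> J"
    and nz: "q \<in> J" "q \<noteq> 0"
  obtains g where "lead_coeff g = 1" "\<And>x. x \<in> J \<longleftrightarrow> g dvd x"
proof -
  obtain h where h: "h \<in> J" "h \<noteq> 0" "\<And>x. x \<in> J \<Longrightarrow> x \<noteq> 0 \<Longrightarrow> degree h \<le> degree x"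
    using ex_has_least_nat[of "\<lambda>x. x \<in> J \<and> x \<noteq> 0" q degree] nz by blast
  define g where "g = smult (inverse (lead_coeff h)) h"
  have g: "lead_coeff g = 1" "degree g = degree h" using h(2) by (simp_all add: g_def)
  have gJ: "g \<in> J" using mult[OF h(1), of "[:inverse (lead_coeff h):]"] by (simp add: g_def)
  have "g dvd x" if "x \<in> J" for x
  proof (rule ccontr)
    assume "\<not> g dvd x"
    then have "x mod g \<noteq> 0" by (simp add: dvd_eq_mod_eq_0)
    moreover have "x mod g = x + (- (x div g)) * g"
      by (simp add: minus_mult_div_eq_mod[symmetric] algebra_simps)
    then have "x mod g \<in> J" using add[OF that mult[OF gJ]] by metis
    moreover have "g \<noteq> 0" using g(1) by auto
    ultimately show False using h(3)[of "x mod g"] degree_mod_less[of g x] g(2) by auto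
  qed
  moreover have "x \<in> J" if "g dvd x" for x
    using that mult[OF gJ] by (metis dvdE mult.commute)
  ultimately show thesis using that[of g] g(1) by blast
qed

text \<open>The generator of the ideal spanned by \<open>R\<close> and \<open>W\<close> divides the
  irreducible \<open>R\<close> without being divisible by it, hence is a unit.\<close>

lemma irreducible_poly_bezout:
  fixes R W :: "'a::field poly"
  assumes "irreducible R" "\<not> R dvd W"
  obtains u v where "R * u + W * v = 1"
proof -
  define J where "J = {R * u + W * v |u v. True}"
  have "R * u + W * v \<in> J" for u v by (auto simp: J_def)
  note J_I = this
  have "R \<in> J" using J_I[of 1 0] by simp
  have "W \<in> J" using J_I[of 0 1] by simp
  obtain g where g: "lead_coeff g = 1" "\<And>x. x \<in> J \<longleftrightarrow> g dvd x"
  proof (rule poly_ideal_principal[of J R])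
    fix x y assume "x \<in> J" "y \<in> J"
    then obtain u v u' v' where "x = R * u + W * v" "y = R * u' + W * v'" by (auto simp: J_def)
    then have "x + y = R * (u + u') + W * (v + v')" by (simp add: algebra_simps)
    then show "x + y \<in> J" using J_I by simp
  next
    fix x z assume "x \<in> J"
    then obtain u v where "x = R * u + W * v" by (auto simp: J_def)
    then have "z * x = R * (z * u) + W * (z * v)" by (simp add: algebra_simps)
    then show "z * x \<in> J" using J_I by simp
  qed (use assms \<open>R \<in> J\<close> in auto)
  have "g dvd R" using \<open>R \<in> J\<close> g by simp
  have "g dvd W" using \<open>W \<in> J\<close> g by simp
  have "\<not> R dvd g" using \<open>g dvd W\<close> assms(2) dvd_trans by blast
  then have "is_unit g" using \<open>g dvd R\<close> assms(1) unfolding irreducible_altdef by blast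
  then have "1 \<in> J" using g(2) by simp
  then show thesis using that by (auto simp: J_def)
qed

lemma irreducible_poly_dvd_mult:
  fixes R :: "'a::field poly"
  assumes "irreducible R" "\<not> R dvd c" "R dvd c * x"
  shows "R dvd x"
proof -
  obtain u v where uv: "R * u + c * v = 1"
    using irreducible_poly_bezout[OF assms(1,2)] .
  have "x = (R * u + c * v) * x" by (simp add: uv)
  also have "\<dots> = R * (u * x) + c * x * v" by (simp add: algebra_simps)
  finally show ?thesis using assms(3) by (metis dvd_add dvd_mult2 dvd_triv_left)
qed

text \<open>A nonconstant divisor of least degree cannot split into two nonconstant factors;
  rescaling makes it monic.\<close>

lemma poly_irreducible_divisor_exists:
  fixes Q :: "'a::field poly"
  assumes "0 < degree Q"
  obtains R where "lead_coeff R = 1" "irreducible R" "R dvd Q"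
proof -
  have "\<exists>h. (h dvd Q \<and> 0 < degree h) \<and> (\<forall>x. x dvd Q \<and> 0 < degree x \<longrightarrow> degree h \<le> degree x)"
    by (rule ex_has_least_nat[where P = "\<lambda>x. x dvd Q \<and> 0 < degree x" and k = Q]) (use assms in simp)
  then obtain h where h: "h dvd Q" "0 < degree h" "\<And>x. x dvd Q \<Longrightarrow> 0 < degree x \<Longrightarrow> degree h \<le> degree x"
    by blast
  define g where "g = smult (inverse (lead_coeff h)) h"
  have "h \<noteq> 0" using h(2) by auto
  then have g: "lead_coeff g = 1" "degree g = degree h" by (simp_all add: g_def)
  have gQ: "g dvd Q" using h(1) \<open>h \<noteq> 0\<close> by (simp add: g_def smult_dvd_iff)
  have g0: "g \<noteq> 0" using g by auto
  have "irreducible g"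
  proof (rule irreducibleI)
    show "g \<noteq> 0" by fact
    show "\<not> is_unit g" using g h(2) by (auto simp: is_unit_iff_degree g0)
  next
    fix a b assume ab: "g = a * b"
    then have nz: "a \<noteq> 0" "b \<noteq> 0" using g0 by auto
    have dg: "degree g = degree a + degree b" using ab nz by (simp add: degree_mult_eq)
    have "a dvd Q" using ab gQ dvd_mult_left by blast
    then have "degree a = 0 \<or> degree h \<le> degree a" using h(3)[of a] by auto
    then have "degree a = 0 \<or> degree b = 0" using dg g by auto
    then show "is_unit a \<or> is_unit b" using nz by (auto simp: is_unit_iff_degree)
  qed
  then show thesis using that g gQ by blast
qed

section \<open>The least norm of an irreducible factor\<close>

lemma finite_irreducible_divisor_norms:
  fixes Q :: "'a::{field,finite} poly"
  assumes "Q \<noteq> 0"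
  shows "finite {poly_norm R |R. lead_coeff R = 1 \<and> irreducible R \<and> R dvd Q}"
proof -
  have "{poly_norm R |R. lead_coeff R = 1 \<and> irreducible R \<and> R dvd Q} \<subseteq> (\<lambda>n. CARD('a) ^ n) ` {..degree Q}"
    using dvd_imp_degree_le[OF _ assms] by (auto simp: poly_norm_def)
  then show ?thesis by (rule finite_subset) auto
qed

lemma lpf_le:
  fixes Q :: "'a::{field,finite} poly"
  assumes "Q \<noteq> 0" "lead_coeff R = 1" "irreducible R" "R dvd Q"
  shows "lpf Q \<le> poly_norm R"
  unfolding lpf_def by (rule Min_le) (use assms finite_irreducible_divisor_norms in auto)

lemma lpf_attained:
  fixes Q :: "'a::{field,finite} poly"
  assumes "0 < degree Q"
  obtains R where "lead_coeff R = 1" "irreducible R" "R dvd Q" "lpf Q = poly_norm R"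
proof -
  have "Q \<noteq> 0" using assms by auto
  moreover obtain R where "lead_coeff R = 1" "irreducible R" "R dvd Q"
    using poly_irreducible_divisor_exists[OF assms] .
  ultimately have "lpf Q \<in> {poly_norm R |R. lead_coeff R = 1 \<and> irreducible R \<and> R dvd Q}"
    unfolding lpf_def by (intro Min_in finite_irreducible_divisor_norms) auto
  then show thesis using that by auto
qed

lemma lpf_pos: "0 < degree Q \<Longrightarrow> 0 < lpf (Q :: 'a::{field,finite} poly)"
  by (rule lpf_attained[of Q]) auto

section \<open>Periodic functions and averages over residues\<close>

text \<open>Functions on the residue ring are modelled as periodic functions on all polynomials, so
  that arguments can be shifted or multiplied without reducing modulo \<open>Q\<close> each
  time.\<close>

definition periodic_mod :: "'a::field poly \<Rightarrow> ('a poly \<Rightarrow> 'b) \<Rightarrow> bool" where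
  "periodic_mod Q f \<longleftrightarrow> (\<forall>x z. f (x + Q * z) = f x)"

lemma periodic_modD:
  assumes "periodic_mod Q f" "Q dvd x - y"
  shows "f x = f y"
proof -
  obtain z where "x - y = Q * z" using assms(2) by (elim dvdE)
  then have "x = y + Q * z" by (simp add: algebra_simps)
  then show ?thesis using assms(1) by (simp add: periodic_mod_def)
qed

lemma periodic_modI: "(\<And>x y. Q dvd x - y \<Longrightarrow> f x = f y) \<Longrightarrow> periodic_mod Q f"
  unfolding periodic_mod_def by simp

lemma periodic_mod_mod: "periodic_mod Q f \<Longrightarrow> f (x mod Q) = f x"
  by (erule periodic_modD) (simp add: mod_eq_dvd_iff[symmetric])

lemma periodic_mod_mult: "periodic_mod Q f \<Longrightarrow> Q dvd Q' \<Longrightarrow> periodic_mod Q' f"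
  by (rule periodic_modI, erule periodic_modD, erule dvd_trans)

lemma dvd_diff_power: "(a::'a::field poly) dvd x - y \<Longrightarrow> a dvd x ^ n - y ^ n"
  by (simp add: mod_eq_dvd_iff[symmetric] power_mod[symmetric, of x] power_mod[symmetric, of y])

lemma dvd_diff_poly: "(a::'a::field poly) dvd x - y \<Longrightarrow> a dvd poly P x - poly P y"
proof (induction P)
  case (pCons c P)
  have "poly (pCons c P) x - poly (pCons c P) y = x * (poly P x - poly P y) + (x - y) * poly P y"
    by (simp add: algebra_simps)
  then show ?case using pCons by (simp add: dvd_add)
qed simp

lemma sum_residues_translate:
  fixes f :: "'a::{field,finite} poly \<Rightarrow> 'b::comm_monoid_add"
  assumes "Q \<noteq> 0" "periodic_mod Q f"
  shows "(\<Sum>x\<in>residues Q. f (x + c)) = (\<Sum>x\<in>residues Q. f x)"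
proof -
  have "bij_betw (\<lambda>x. (x + c) mod Q) (residues Q) (residues Q)"
  proof (rule bij_betw_byWitness[where f' = "\<lambda>x. (x - c) mod Q"])
    show "\<forall>a\<in>residues Q. ((a + c) mod Q - c) mod Q = a"
      by (auto simp: mod_diff_left_eq residues_def)
    show "\<forall>a\<in>residues Q. ((a - c) mod Q + c) mod Q = a"
      by (auto simp: mod_add_left_eq residues_def)
  qed auto
  from sum.reindex_bij_betw[OF this, of f] show ?thesis
    by (simp add: periodic_mod_mod[OF assms(2)])
qed

lemma average_translate:
  fixes f :: "'a::{field,finite} poly \<Rightarrow> 'b::field"
  assumes "Q \<noteq> 0" "periodic_mod Q f"
  shows "average (residues Q) (\<lambda>x. f (x + c)) = average (residues Q) f"
  by (simp add: average_def sum_residues_translate[OF assms])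

lemma sum_residues_scale:
  fixes f :: "'a::{field,finite} poly \<Rightarrow> 'b::comm_monoid_add"
  assumes "irreducible R" "\<not> R dvd c" "periodic_mod R f"
  shows "(\<Sum>x\<in>residues R. f (c * x)) = (\<Sum>x\<in>residues R. f x)"
proof -
  have R0: "R \<noteq> 0" using assms(1) by auto
  have "inj_on (\<lambda>x. (c * x) mod R) (residues R)"
  proof (rule inj_onI)
    fix x y assume xy: "x \<in> residues R" "y \<in> residues R" "(c * x) mod R = (c * y) mod R"
    then have "R dvd c * (x - y)" by (simp add: mod_eq_dvd_iff right_diff_distrib)
    then have "R dvd x - y" by (rule irreducible_poly_dvd_mult[OF assms(1,2)])
    then show "x = y" using residues_eq_iff_dvd xy by blast
  qed
  then have "bij_betw (\<lambda>x. (c * x) mod R) (residues R) (residues R)"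
    using endo_inj_surj[OF finite_residues[OF R0], of "\<lambda>x. (c * x) mod R"]
    by (simp add: bij_betw_def image_subset_iff)
  from sum.reindex_bij_betw[OF this, of f] show ?thesis
    by (simp add: periodic_mod_mod[OF assms(3)])
qed

lemma average_const: "finite S \<Longrightarrow> S \<noteq> {} \<Longrightarrow> average S (\<lambda>_. c :: 'b::field_char_0) = c"
  by (simp add: average_def)

lemma average_cong: "(\<And>x. x \<in> S \<Longrightarrow> f x = g x) \<Longrightarrow> average S f = average S g"
  by (simp add: average_def)

lemma average_mult_right: "average S (\<lambda>x. c * f x) = c * average S f"
  by (simp add: average_def sum_distrib_left)

lemma average_mult_left: "average S (\<lambda>x. f x * c) = average S f * c"
  by (simp add: average_def sum_distrib_right)

lemma average_swap: "average S (\<lambda>x. average T (\<lambda>y. f x y)) = average T (\<lambda>y. average S (\<lambda>x. f x y))"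
  by (simp add: average_def sum_divide_distrib[symmetric] sum.swap[of _ S T] field_simps)

lemma average_sum: "average S (\<lambda>x. \<Sum>i\<in>I. f x i) = (\<Sum>i\<in>I. average S (\<lambda>x. f x i))"
  by (simp add: average_def sum.swap[of _ S I] sum_divide_distrib)

lemma norm_average_le: "cmod (average S f) \<le> average S (\<lambda>x. cmod (f x))"
proof -
  have "cmod (average S f) = cmod (\<Sum>x\<in>S. f x) / real (card S)"
    by (simp add: average_def norm_divide)
  also have "\<dots> \<le> (\<Sum>x\<in>S. cmod (f x)) / real (card S)"
    by (intro divide_right_mono norm_sum) auto
  finally show ?thesis by (simp add: average_def)
qed

lemma average_mono: "(\<And>x. x \<in> S \<Longrightarrow> f x \<le> g x) \<Longrightarrow> average S f \<le> average S (g :: _ \<Rightarrow> real)"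
  unfolding average_def by (intro divide_right_mono sum_mono) auto

lemma norm_average_le_bound:
  "finite S \<Longrightarrow> S \<noteq> {} \<Longrightarrow> (\<And>x. x \<in> S \<Longrightarrow> cmod (f x) \<le> c) \<Longrightarrow> cmod (average S f) \<le> c"
  using norm_average_le[of S f] average_mono[of S "\<lambda>x. cmod (f x)" "\<lambda>_. c"] average_const[of S c]
  by simp

section \<open>Additive characters\<close>

definition add_char :: "('b::ab_group_add \<Rightarrow> complex) \<Rightarrow> bool" where
  "add_char \<psi> \<longleftrightarrow> (\<forall>x y. \<psi> (x + y) = \<psi> x * \<psi> y) \<and> (\<forall>x. cmod (\<psi> x) = 1)"

lemma add_char_add: "add_char \<psi> \<Longrightarrow> \<psi> (x + y) = \<psi> x * \<psi> y"
  by (simp add: add_char_def)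

lemma add_char_norm: "add_char \<psi> \<Longrightarrow> cmod (\<psi> x) = 1"
  by (simp add: add_char_def)

lemma add_char_nonzero: "add_char \<psi> \<Longrightarrow> \<psi> x \<noteq> 0"
  using add_char_norm[of \<psi> x] by auto

lemma add_char_0: "add_char \<psi> \<Longrightarrow> \<psi> 0 = 1"
  using add_char_add[of \<psi> 0 0] add_char_nonzero[of \<psi> 0] by simp

lemma add_char_uminus: "add_char \<psi> \<Longrightarrow> \<psi> (- x) = cnj (\<psi> x)"
proof -
  assume a: "add_char \<psi>"
  have "\<psi> (- x) * \<psi> x = 1" using add_char_add[OF a, of "-x" x] add_char_0[OF a] by simp
  moreover have "cnj (\<psi> x) * \<psi> x = 1"
    using complex_norm_square[of "\<psi> x"] by (simp add: add_char_norm[OF a] mult.commute)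
  ultimately show ?thesis using add_char_nonzero[OF a, of x] by (metis mult_right_cancel)
qed

lemma add_char_diff: "add_char \<psi> \<Longrightarrow> \<psi> (x - y) = \<psi> x * cnj (\<psi> y)"
  using add_char_add[of \<psi> x "-y"] by (simp add: add_char_uminus)

lemma add_char_eq_iff: "add_char \<psi> \<Longrightarrow> \<psi> x = \<psi> y \<longleftrightarrow> \<psi> (x - y) = 1"
  by (metis add_char_0 add_char_add add_char_nonzero diff_add_cancel mult_cancel_right2)

lemma add_char_sum: "add_char \<psi> \<Longrightarrow> \<psi> (\<Sum>i\<in>I. f i) = (\<Prod>i\<in>I. \<psi> (f i))"
  by (induction I rule: infinite_finite_induct) (simp_all add: add_char_0 add_char_add)

lemma add_char_mult: "add_char \<psi> \<Longrightarrow> add_char \<phi> \<Longrightarrow> add_char (\<lambda>x. \<psi> x * \<phi> x)"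
  by (simp add: add_char_def norm_mult)

lemma add_char_cnj: "add_char \<psi> \<Longrightarrow> add_char (\<lambda>x. cnj (\<psi> x))"
  by (simp add: add_char_def)

lemma add_char_scale: "add_char \<psi> \<Longrightarrow> add_char (\<lambda>x. \<psi> (c * x))"
  for \<psi> :: "'b::comm_ring_1 \<Rightarrow> complex"
  by (simp add: add_char_def distrib_left)

lemma add_char_of_nat_mult: "add_char \<psi> \<Longrightarrow> \<psi> (of_nat n * x) = \<psi> x ^ n"
  for \<psi> :: "'b::comm_ring_1 \<Rightarrow> complex"
  by (induction n) (simp_all add: add_char_0 add_char_add distrib_right)

text \<open>In positive characteristic a character thus takes only finitely many values. This bounds
  level sets from below and allows a pigeonhole argument on restrictions.\<close>

lemma add_char_power_CHAR: "add_char \<psi> \<Longrightarrow> \<psi> x ^ CHAR('b) = 1"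
  for \<psi> :: "'b::comm_ring_1 \<Rightarrow> complex"
  using add_char_of_nat_mult[of \<psi> "CHAR('b)" x] by (simp add: add_char_0)

lemma add_char_periodic: "add_char \<psi> \<Longrightarrow> periodic_mod Q \<psi> \<longleftrightarrow> (\<forall>z. \<psi> (Q * z) = 1)"
  using add_char_0[of \<psi>] add_char_add[of \<psi>]
  unfolding periodic_mod_def by (metis add_0 mult.right_neutral)

text \<open>Translation by \<open>c\<close> fixes the average but also multiplies it by
  \<open>\<psi> c\<close>, which is not 1.\<close>

lemma average_add_char_eq_0:
  fixes \<psi> :: "'a::{field,finite} poly \<Rightarrow> complex"
  assumes "Q \<noteq> 0" "add_char \<psi>" "periodic_mod Q \<psi>" "\<psi> c \<noteq> 1"
  shows "average (residues Q) \<psi> = 0"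
proof -
  have "average (residues Q) \<psi> = average (residues Q) (\<lambda>x. \<psi> (x + c))"
    using average_translate[OF assms(1,3)] by simp
  also have "\<dots> = average (residues Q) \<psi> * \<psi> c"
    by (simp add: add_char_add[OF assms(2)] average_mult_left)
  finally show ?thesis using assms(4) by simp
qed

section \<open>Existence of characters\<close>

text \<open>\<open>x \<noteq> 0\<close> makes the trivial subgroup proper; the maximal one found
  will become the kernel of a character.\<close>

lemma maximal_proper_subgroup_exists:
  fixes x :: "'b::{ab_group_add,finite}"
  assumes "x \<noteq> 0"
  obtains M where "0 \<in> M" "\<And>a b. a \<in> M \<Longrightarrow> b \<in> M \<Longrightarrow> a - b \<in> M" "M \<noteq> (UNIV :: 'b set)"
    "\<And>N. M \<subset> N \<Longrightarrow> 0 \<in> N \<Longrightarrow> (\<And>a b. a \<in> N \<Longrightarrow> b \<in> N \<Longrightarrow> a - b \<in> N) \<Longrightarrow> N = UNIV"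
proof -
  define S where "S = {M :: 'b set. 0 \<in> M \<and> (\<forall>a\<in>M. \<forall>b\<in>M. a - b \<in> M) \<and> M \<noteq> UNIV}"
  have "{0} \<in> S" using assms by (auto simp: S_def)
  then obtain M where M: "M \<in> S" "\<And>N. N \<in> S \<Longrightarrow> M \<subseteq> N \<Longrightarrow> M = N"
    using finite_has_maximal[of S] by auto
  show thesis
  proof (rule that[of M])
    fix N assume N: "M \<subset> N" "0 \<in> N" "\<And>a b. a \<in> N \<Longrightarrow> b \<in> N \<Longrightarrow> a - b \<in> N"
    then show "N = UNIV" using M(2)[of N] unfolding S_def by blast
  qed (use M(1) in \<open>auto simp: S_def\<close>)
qed

text \<open>Modulo a maximal proper subgroup \<open>M\<close>, every element is an integer multiple
  of a fixed \<open>c\<close> outside \<open>M\<close>, and the integer is unique modulo the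
  characteristic \<open>p\<close>. Dividing it by \<open>p\<close> and exponentiating gives the
  character.\<close>

lemma nontrivial_add_char_exists:
  obtains \<psi> :: "'a::{field,finite} \<Rightarrow> complex" and c where "add_char \<psi>" "\<psi> c \<noteq> 1"
proof -
  obtain M :: "'a set" where M: "0 \<in> M" "\<And>a b. a \<in> M \<Longrightarrow> b \<in> M \<Longrightarrow> a - b \<in> M" "M \<noteq> UNIV"
    "\<And>N. M \<subset> N \<Longrightarrow> 0 \<in> N \<Longrightarrow> (\<And>a b. a \<in> N \<Longrightarrow> b \<in> N \<Longrightarrow> a - b \<in> N) \<Longrightarrow> N = UNIV"
    using maximal_proper_subgroup_exists[of "1::'a"] zero_neq_one by metis
  obtain c where c: "c \<notin> M" using M(3) by auto
  define p where "p = CHAR('a)"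
  have p: "prime p" unfolding p_def by (rule prime_CHAR_semidom) (rule finite_imp_CHAR_pos, simp)
  have neg: "- a \<in> M" if "a \<in> M" for a using M(2)[OF M(1) that] by simp
  have add: "a + b \<in> M" if "a \<in> M" "b \<in> M" for a b using M(2)[OF that(1) neg[OF that(2)]] by simp
  have nat_mult: "of_nat n * a \<in> M" if "a \<in> M" for n a
    by (induction n) (use that add M(1) in \<open>auto simp: distrib_right\<close>)
  have int_mult: "of_int k * a \<in> M" if "a \<in> M" for k a
    using nat_mult[OF that, of "nat k"] neg[OF nat_mult[OF that, of "nat (-k)"]]
    by (cases "k \<ge> 0") (auto simp: of_nat_nat)
  \<comment> \<open>Otherwise \<open>k\<close> is invertible modulo \<open>p\<close>, and
    \<open>c\<close> itself would lie in \<open>M\<close>.\<close>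
  have dvd: "int p dvd k" if "of_int k * c \<in> M" for k
  proof (rule ccontr)
    assume "\<not> int p dvd k"
    moreover have "prime (int p)" using p by simp
    ultimately have "coprime (int p) k" by (intro prime_imp_coprime)
    then obtain u v where uv: "u * k + v * int p = 1"
      using bezout_int[of k "int p"] by (auto simp: coprime_iff_gcd_eq_1 gcd.commute)
    have "of_int (u * k + v * int p) * c = of_int u * (of_int k * c)"
      by (simp add: p_def algebra_simps)
    then have "c = of_int u * (of_int k * c)" by (simp only: uv of_int_1 mult_1_left)
    then show False using int_mult[OF that, of u] c by metis
  qed
  \<comment> \<open>The elements that an integer multiple of \<open>c\<close> brings into
    \<open>M\<close> form a subgroup strictly above \<open>M\<close>, hence everything.\<close>
  have ex: "\<exists>k::int. x - of_int k * c \<in> M" for x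
  proof -
    define N where "N = {x. \<exists>k::int. x - of_int k * c \<in> M}"
    have "M \<subseteq> N" unfolding N_def by (auto intro!: exI[of _ 0])
    moreover have "c \<in> N" unfolding N_def using M(1) by (auto intro!: exI[of _ 1])
    ultimately have "M \<subset> N" using c by auto
    moreover have "a - b \<in> N" if ab: "a \<in> N" "b \<in> N" for a b
    proof -
      obtain k l :: int where "a - of_int k * c \<in> M" "b - of_int l * c \<in> M"
        using ab unfolding N_def by blast
      from M(2)[OF this] have "a - b - of_int (k - l) * c \<in> M" by (simp add: algebra_simps)
      then show ?thesis unfolding N_def by blast
    qed
    moreover have "0 \<in> N" using \<open>M \<subseteq> N\<close> M(1) by auto
    ultimately have "N = UNIV" by (intro M(4)) auto
    then show ?thesis by (auto simp: N_def)
  qed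
  \<comment> \<open>The choice is harmless: the integer is determined modulo \<open>p\<close> (see
    \<open>k_eqI\<close>), and \<open>\<psi>\<close> sees no more than that.\<close>
  define k where "k x = (SOME k::int. x - of_int k * c \<in> M)" for x
  have k: "x - of_int (k x) * c \<in> M" for x unfolding k_def using someI_ex[OF ex] .
  have k_eqI: "int p dvd k x - l" if "x - of_int l * c \<in> M" for x l
    using M(2)[OF that k[of x]] by (intro dvd) (simp add: algebra_simps)
  define \<psi> :: "'a \<Rightarrow> complex" where "\<psi> x = cis (2 * pi * of_int (k x) / p)" for x
  have cis_eq: "cis (2 * pi * of_int a / p) = cis (2 * pi * of_int b / p)" if "int p dvd a - b" for a b :: int
  proof -
    obtain m where "a - b = int p * m" using \<open>int p dvd a - b\<close> by (elim dvdE)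
    then have "a = b + int p * m" by simp
    then have "2 * pi * of_int a / p = 2 * pi * of_int b / p + 2 * pi * of_int m"
      using prime_gt_0_nat[OF p] by (simp add: field_simps)
    then show ?thesis by (simp add: cis_mult[symmetric])
  qed
  have "\<psi> (x + y) = \<psi> x * \<psi> y" for x y
  proof -
    have "int p dvd k (x + y) - (k x + k y)"
      using add[OF k[of x] k[of y]] by (intro k_eqI) (simp add: algebra_simps)
    then have "\<psi> (x + y) = cis (2 * pi * of_int (k x + k y) / p)" unfolding \<psi>_def by (rule cis_eq)
    also have "\<dots> = \<psi> x * \<psi> y" by (simp add: \<psi>_def cis_mult add_divide_distrib distrib_left)
    finally show ?thesis .
  qed
  then have "add_char \<psi>" by (simp add: add_char_def \<psi>_def)
  moreover have "\<psi> c \<noteq> 1"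
  proof
    assume eq: "\<psi> c = 1"
    have "int p dvd k c - 1" using M(1) by (intro k_eqI) simp
    then have "\<psi> c = cis (2 * pi * of_int 1 / p)" unfolding \<psi>_def by (rule cis_eq)
    with eq have "cis (2 * pi / p) = 1" by simp
    then have "cos (2 * pi / p) = 1" using cis.sel(1)[of "2 * pi / p"] by simp
    then obtain n :: int where "2 * pi / p = 2 * pi * n" using cos_one_2pi_int by auto
    then have "1 = real_of_int (n * int p)" using prime_gt_0_nat[OF p] by (simp add: field_simps)
    then have "1 = n * int p" using of_int_eq_iff by (metis of_int_1)
    then have "int p dvd 1" by (metis dvd_triv_right)
    then show False using prime_gt_1_nat[OF p] by simp
  qed
  ultimately show thesis using that by blast
qed

section \<open>Primitive characters modulo a polynomial\<close>

text \<open>Such an \<open>e\<close> factors through the residue ring and makes the pairing of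
  \<open>a\<close> and \<open>x\<close> by \<open>e (a * x)\<close> nondegenerate there, so that
  these functions of \<open>x\<close> will exhaust all characters modulo \<open>Q\<close>.\<close>

definition primitive_char :: "'a::field poly \<Rightarrow> ('a poly \<Rightarrow> complex) \<Rightarrow> bool" where
  "primitive_char Q e \<longleftrightarrow> add_char e \<and> (\<forall>b. (\<forall>z. e (b * z) = 1) \<longleftrightarrow> Q dvd b)"

lemma primitive_char_add_char: "primitive_char Q e \<Longrightarrow> add_char e"
  by (simp add: primitive_char_def)

lemma primitive_char_dvd: "primitive_char Q e \<Longrightarrow> Q dvd x \<Longrightarrow> e x = 1"
  unfolding primitive_char_def by (metis mult.right_neutral)

lemma primitive_char_nontrivial: "primitive_char Q e \<Longrightarrow> \<not> Q dvd b \<Longrightarrow> \<exists>z. e (b * z) \<noteq> 1"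
  unfolding primitive_char_def by blast

lemma primitive_char_eq: "primitive_char Q e \<Longrightarrow> Q dvd x - y \<Longrightarrow> e x = e y"
  by (simp add: add_char_eq_iff primitive_char_add_char primitive_char_dvd)

text \<open>A nontrivial character of the field is applied to the coefficient of
  \<open>x mod Q\<close> at \<open>degree Q - 1\<close>, which is up to a constant factor the
  residue of x/Q at infinity.\<close>

lemma primitive_char_exists:
  fixes Q :: "'a::{field,finite} poly"
  assumes "0 < degree Q"
  obtains e where "primitive_char Q e"
proof -
  obtain \<psi> :: "'a \<Rightarrow> complex" and c where \<psi>: "add_char \<psi>" "\<psi> c \<noteq> 1"
    by (rule nontrivial_add_char_exists)
  define n where "n = degree Q - 1"
  define e where "e x = \<psi> (coeff (x mod Q) n)" for x
  have Q0: "Q \<noteq> 0" using assms by auto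
  have add: "add_char e"
    using \<psi>(1) by (auto simp: add_char_def e_def poly_mod_add_left)
  have "Q dvd b" if triv: "\<forall>z. e (b * z) = 1" for b
  proof (rule ccontr)
    assume "\<not> Q dvd b"
    define r where "r = b mod Q"
    have r: "r \<noteq> 0" "degree r < degree Q"
      using \<open>\<not> Q dvd b\<close> degree_mod_less[OF Q0, of b] by (auto simp: r_def dvd_eq_mod_eq_0)
    \<comment> \<open>Multiplied by this monomial, \<open>r\<close> gets degree exactly
      \<open>n\<close> and leading coefficient \<open>c\<close>, so no reduction modulo
      \<open>Q\<close> occurs.\<close>
    define z where "z = monom (c / lead_coeff r) (n - degree r)"
    have c0: "c \<noteq> 0" using \<psi> add_char_0 by metis
    then have cr: "c / lead_coeff r \<noteq> 0" using r by simp
    have z: "degree z = n - degree r" "z \<noteq> 0"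
      using degree_monom_eq[OF cr, of "n - degree r"] cr unfolding z_def monom_eq_0_iff by blast+
    have deg: "degree (r * z) = n" using r z c0 by (simp add: degree_mult_eq n_def)
    have "(b * z) mod Q = (r * z) mod Q" by (simp add: r_def mod_mult_left_eq)
    also have "\<dots> = r * z" using deg assms by (intro mod_poly_less) (simp add: n_def)
    finally have "coeff ((b * z) mod Q) n = lead_coeff (r * z)" using deg by simp
    also have "lead_coeff z = c / lead_coeff r" unfolding z(1) by (simp add: z_def)
    then have "lead_coeff (r * z) = c" using r by (simp add: lead_coeff_mult)
    finally show False using triv \<psi>(2) unfolding e_def by metis
  qed
  moreover have "e (b * z) = 1" if "Q dvd b" for b z
    using that add_char_0[OF \<psi>(1)] by (simp add: e_def mod_eq_0_iff_dvd)
  ultimately have "primitive_char Q e" using add unfolding primitive_char_def by blast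
  then show thesis by (rule that)
qed

text \<open>Dilating the argument by \<open>g\<close> removes \<open>g\<close> from the modulus;
  this is how a single irreducible factor gets isolated.\<close>

lemma primitive_char_cofactor:
  assumes "primitive_char (g * Q) e" "g \<noteq> 0"
  shows "primitive_char Q (\<lambda>x. e (g * x))"
  using assms unfolding primitive_char_def
  by (auto simp: add_char_scale mult.assoc[symmetric])

section \<open>Fourier analysis modulo a polynomial\<close>

locale primitive_char_mod =
  fixes Q :: "'a::{field,finite} poly" and e :: "'a poly \<Rightarrow> complex"
  assumes Q_nonzero [simp]: "Q \<noteq> 0" and primitive: "primitive_char Q e"
begin

lemmas add_char_e = primitive_char_add_char[OF primitive]

lemma finite_res [simp]: "finite (residues Q)" and res_nonempty [simp]: "residues Q \<noteq> {}"
  by (simp, use zero_in_residues in blast)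

lemma add_char_e_scale: "add_char (\<lambda>x. e (a * x))" "add_char (\<lambda>x. e (x * a))"
  using add_char_scale[OF add_char_e, of a] by (simp_all add: mult.commute)

lemma periodic_e_scale: "periodic_mod Q (\<lambda>x. e (a * x))" "periodic_mod Q (\<lambda>x. e (x * a))"
  by (auto intro!: periodic_modI primitive_char_eq[OF primitive]
      simp: left_diff_distrib[symmetric] right_diff_distrib[symmetric])

lemma average_e_scale: "average (residues Q) (\<lambda>x. e (a * x)) = (if Q dvd a then 1 else 0)"
proof (cases "Q dvd a")
  case True
  then have "e (a * x) = 1" for x by (intro primitive_char_dvd[OF primitive]) auto
  with True show ?thesis by (simp add: average_const)
next
  case False
  then obtain z where "e (a * z) \<noteq> 1" using primitive_char_nontrivial[OF primitive] by blast
  with average_add_char_eq_0[OF Q_nonzero add_char_e_scale(1) periodic_e_scale(1)] False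
  show ?thesis by simp
qed

lemma sum_e_scale: "(\<Sum>a\<in>residues Q. e (a * x)) = (if Q dvd x then of_nat (poly_norm Q) else 0)"
  using average_e_scale[of x]
  by (simp add: average_def card_residues mult.commute split: if_splits)

lemma average_e_correlation:
  assumes "a \<in> residues Q" "b \<in> residues Q"
  shows "average (residues Q) (\<lambda>x. e (a * x) * cnj (e (b * x))) = (if a = b then 1 else 0)"
proof -
  have "e (a * x) * cnj (e (b * x)) = e ((a - b) * x)" for x
    by (simp add: add_char_diff[OF add_char_e] left_diff_distrib)
  then show ?thesis using average_e_scale[of "a - b"] residues_eq_iff_dvd[OF assms] by simp
qed

definition fourier :: "('a poly \<Rightarrow> complex) \<Rightarrow> 'a poly \<Rightarrow> complex" where
  "fourier f a = average (residues Q) (\<lambda>x. f x * cnj (e (a * x)))"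

lemma fourier_inversion:
  assumes "x \<in> residues Q"
  shows "(\<Sum>a\<in>residues Q. fourier f a * e (a * x)) = f x"
proof -
  have "(\<Sum>a\<in>residues Q. fourier f a * e (a * x)) =
        average (residues Q) (\<lambda>y. f y * (\<Sum>a\<in>residues Q. e (a * (x - y))))"
    unfolding fourier_def average_mult_left[symmetric] average_sum[symmetric] sum_distrib_left
    by (intro average_cong sum.cong refl)
       (simp add: add_char_diff[OF add_char_e] right_diff_distrib)
  also have "\<dots> = average (residues Q) (\<lambda>y. if y = x then f x * of_nat (poly_norm Q) else 0)"
    by (intro average_cong) (auto simp: sum_e_scale residues_eq_iff_dvd[OF assms, symmetric])
  also have "\<dots> = f x"
    using assms by (simp add: average_def card_residues sum.delta)
  finally show ?thesis .
qed

lemma parseval: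
  "average (residues Q) (\<lambda>x. (cmod (\<Sum>a\<in>residues Q. c a * e (a * x)))\<^sup>2) =
   (\<Sum>a\<in>residues Q. (cmod (c a))\<^sup>2)"
proof -
  have "complex_of_real (average (residues Q) (\<lambda>x. (cmod (\<Sum>a\<in>residues Q. c a * e (a * x)))\<^sup>2)) =
    average (residues Q) (\<lambda>x. \<Sum>a\<in>residues Q. \<Sum>b\<in>residues Q. c a * cnj (c b) * (e (a * x) * cnj (e (b * x))))"
    by (simp add: average_def complex_norm_square cnj_sum sum_product mult_ac del: of_real_power)
  also have "\<dots> = (\<Sum>a\<in>residues Q. \<Sum>b\<in>residues Q. c a * cnj (c b) * (if a = b then 1 else 0))"
    unfolding average_sum average_mult_right
    by (intro sum.cong refl) (simp add: average_e_correlation)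
  also have "\<dots> = complex_of_real (\<Sum>a\<in>residues Q. (cmod (c a))\<^sup>2)"
    by (simp add: sum.delta complex_norm_square if_distrib[where f = "\<lambda>x. _ * x"] del: of_real_power
          cong: if_cong)
  finally show ?thesis by (simp only: of_real_eq_iff)
qed

lemma plancherel:
  "(\<Sum>a\<in>residues Q. (cmod (fourier f a))\<^sup>2) = average (residues Q) (\<lambda>x. (cmod (f x))\<^sup>2)"
  unfolding parseval[symmetric] by (intro average_cong) (simp add: fourier_inversion)

text \<open>By Plancherel \<open>\<psi>\<close> correlates with some \<open>e (b * x)\<close>; the
  quotient of the two is a character with nonzero average, hence trivial.\<close>

lemma add_char_eq_scale:
  assumes \<psi>: "add_char \<psi>" "periodic_mod Q \<psi>"
  obtains b where "b \<in> residues Q" "\<And>x. \<psi> x = e (b * x)"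
proof -
  have "\<exists>b\<in>residues Q. fourier \<psi> b \<noteq> 0"
  proof (rule ccontr)
    assume "\<not> ?thesis"
    then have "(\<Sum>a\<in>residues Q. (cmod (fourier \<psi> a))\<^sup>2) = 0" by simp
    then show False by (simp add: plancherel add_char_norm[OF \<psi>(1)] average_const)
  qed
  then obtain b where b: "b \<in> residues Q" "fourier \<psi> b \<noteq> 0" by blast
  define \<phi> where "\<phi> x = \<psi> x * cnj (e (b * x))" for x
  have "add_char \<phi>" unfolding \<phi>_def
    by (intro add_char_mult add_char_cnj \<psi>(1) add_char_e_scale)
  moreover have "periodic_mod Q \<phi>" unfolding \<phi>_def
    by (rule periodic_modI) (metis periodic_modD[OF \<psi>(2)] periodic_modD[OF periodic_e_scale(1)])
  moreover have "average (residues Q) \<phi> \<noteq> 0" using b(2) by (simp add: fourier_def \<phi>_def[abs_def])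
  ultimately have "\<phi> x = 1" for x
    using average_add_char_eq_0[OF Q_nonzero, of \<phi> x] by blast
  then have "\<psi> x = e (b * x)" for x
  proof -
    have "\<psi> x * cnj (e (b * x)) = e (b * x) * cnj (e (b * x))"
      using \<open>\<phi> x = 1\<close> complex_norm_square[of "e (b * x)"] by (simp add: \<phi>_def add_char_norm[OF add_char_e])
    then show ?thesis using add_char_nonzero[OF add_char_e] by simp
  qed
  then show thesis using that b(1) by blast
qed

text \<open>The indicator of \<open>G\<close> is periodic and not constant, so it has a nonzero
  Fourier coefficient at some nonzero residue \<open>a\<close>. Its invariance under shifts by
  \<open>g\<close> in \<open>G\<close> then forces \<open>e (a * g) = 1\<close>.\<close>

lemma proper_subgroup_annihilated:
  assumes 0: "0 \<in> G" and diff: "\<And>x y. x \<in> G \<Longrightarrow> y \<in> G \<Longrightarrow> x - y \<in> G"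
    and ideal: "\<And>z. Q * z \<in> G" and proper: "G \<noteq> UNIV"
  obtains a where "\<not> Q dvd a" "\<And>x. x \<in> G \<Longrightarrow> e (a * x) = 1"
proof -
  have add: "x + y \<in> G" if "x \<in> G" "y \<in> G" for x y
    using diff[OF that(1) diff[OF 0 that(2)]] by simp
  have per: "x \<in> G \<longleftrightarrow> y \<in> G" if "Q dvd x - y" for x y
  proof -
    obtain z where z: "x - y = Q * z" using \<open>Q dvd x - y\<close> by (elim dvdE)
    then have "x = y + Q * z" "y = x - Q * z" by (simp_all add: algebra_simps)
    then show ?thesis using add diff ideal by metis
  qed
  define f :: "'a poly \<Rightarrow> complex" where "f x = (if x \<in> G then 1 else 0)" for x
  have f: "periodic_mod Q f" by (rule periodic_modI) (use per in \<open>auto simp: f_def\<close>)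
  have "\<exists>a\<in>residues Q. a \<noteq> 0 \<and> fourier f a \<noteq> 0"
  proof (rule ccontr)
    assume "\<not> ?thesis"
    then have "fourier f a = 0" if "a \<in> residues Q - {0}" for a using that by blast
    then have const: "f x = fourier f 0" if "x \<in> residues Q" for x
      using fourier_inversion[OF that, of f] sum.remove[of "residues Q" 0 "\<lambda>a. fourier f a * e (a * x)"]
      by (simp add: add_char_0[OF add_char_e])
    have "f x = f 0" for x
      using const[of "x mod Q"] const[of 0] periodic_mod_mod[OF f, of x] by simp
    then have "x \<in> G" for x using 0 by (metis f_def zero_neq_one)
    then show False using proper by blast
  qed
  then obtain a where a: "a \<in> residues Q" "a \<noteq> 0" "fourier f a \<noteq> 0" by blast
  have "e (a * g) = 1" if "g \<in> G" for g
  proof -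
    define h where "h x = f x * cnj (e (a * x))" for x
    have h: "periodic_mod Q h" unfolding h_def
      by (rule periodic_modI) (metis periodic_modD[OF f] periodic_modD[OF periodic_e_scale(1)])
    have "x + g \<in> G \<longleftrightarrow> x \<in> G" for x
      using add[OF _ that] diff[OF _ that, of "x + g"] by auto
    then have "h (x + g) = h x * cnj (e (a * g))" for x
      by (simp add: h_def f_def distrib_left add_char_add[OF add_char_e])
    then have "average (residues Q) h = average (residues Q) h * cnj (e (a * g))"
      using average_translate[OF Q_nonzero h, of g] by (simp add: average_mult_left)
    moreover have "average (residues Q) h \<noteq> 0" using a(3) by (simp add: fourier_def h_def[abs_def])
    ultimately have "cnj (e (a * g)) = 1" by simp
    then show ?thesis by (metis complex_cnj_cnj complex_cnj_one)
  qed
  moreover have "\<not> Q dvd a" using a residues_eq_iff_dvd[OF a(1) zero_in_residues] by simp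
  ultimately show thesis using that by blast
qed

end

section \<open>Power sums and tuples modulo an irreducible polynomial\<close>

definition power_sum :: "nat \<Rightarrow> (nat \<Rightarrow> 'b::comm_ring_1) \<Rightarrow> nat \<Rightarrow> 'b" where
  "power_sum n x r = (\<Sum>i<n. x i ^ r)"

text \<open>The coefficients are, up to sign, the elementary symmetric functions of the \<open>x i\<close>.\<close>
definition root_fps :: "nat \<Rightarrow> (nat \<Rightarrow> 'b::comm_ring_1) \<Rightarrow> 'b fps" where
  "root_fps n x = (\<Prod>i<n. 1 - fps_const (x i) * fps_X)"

lemma root_fps_Suc: "root_fps (Suc n) x = root_fps n x * (1 - fps_const (x n) * fps_X)"
  by (simp add: root_fps_def)

lemma root_fps_nth_0 [simp]: "root_fps n x $ 0 = 1"
  by (induction n) (simp_all add: root_fps_def)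

lemma root_fps_Suc_nth_Suc: "root_fps (Suc n) x $ Suc k = root_fps n x $ Suc k - x n * root_fps n x $ k"
proof -
  have "root_fps (Suc n) x = root_fps n x - fps_const (x n) * (root_fps n x * fps_X)"
    by (simp add: root_fps_Suc algebra_simps)
  then show ?thesis by (simp add: fps_X_mult_right_nth)
qed

text \<open>This is the logarithmic derivative written without division: each linear factor
  contributes minus a geometric series.\<close>

lemma fps_deriv_root_fps: "fps_deriv (root_fps n x) = - root_fps n x * Abs_fps (\<lambda>m. power_sum n x (Suc m))"
proof (induction n)
  case 0
  have "Abs_fps (\<lambda>m. power_sum 0 x (Suc m)) = 0" by (rule fps_ext) (simp add: power_sum_def)
  then show ?case by (simp add: root_fps_def)
next
  case (Suc n)
  define L where "L = Abs_fps (\<lambda>m. power_sum n x (Suc m))"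
  define G where "G = Abs_fps (\<lambda>m. x n ^ Suc m)"
  have L: "Abs_fps (\<lambda>m. power_sum (Suc n) x (Suc m)) = L + G"
    by (rule fps_ext) (simp add: L_def G_def power_sum_def)
  have G: "(1 - fps_const (x n) * fps_X) * G = fps_const (x n)"
  proof (rule fps_ext)
    fix k show "((1 - fps_const (x n) * fps_X) * G) $ k = fps_const (x n) $ k"
      by (cases k) (simp_all add: G_def left_diff_distrib mult.assoc)
  qed
  have "fps_deriv (root_fps (Suc n) x) =
      - root_fps n x * L * (1 - fps_const (x n) * fps_X) - root_fps n x * fps_const (x n)"
    using Suc by (simp add: root_fps_Suc L_def algebra_simps)
  also have "root_fps n x * fps_const (x n) = root_fps n x * ((1 - fps_const (x n) * fps_X) * G)"
    by (simp only: G)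
  also have "- root_fps n x * L * (1 - fps_const (x n) * fps_X) - \<dots> = - root_fps (Suc n) x * (L + G)"
    by (simp add: root_fps_Suc algebra_simps)
  finally show ?case by (simp add: L)
qed

text \<open>Comparison of coefficients in \<open>fps_deriv_root_fps\<close>. The factor
  \<open>Suc m\<close> on the left is the reason why an index divisible by the characteristic gives
  no hold on its coefficient.\<close>

lemma newton_identity:
  "of_nat (Suc m) * root_fps n x $ Suc m = - (\<Sum>i\<le>m. root_fps n x $ i * power_sum n x (Suc (m - i)))"
proof -
  have "fps_deriv (root_fps n x) $ m = (- root_fps n x * Abs_fps (\<lambda>m. power_sum n x (Suc m))) $ m"
    by (simp only: fps_deriv_root_fps)
  then show ?thesis by (simp add: fps_mult_nth sum_negf atLeast0AtMost)
qed

lemma root_fps_nth_eq_0: "n < k \<Longrightarrow> root_fps n x $ k = 0"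
proof (induction n arbitrary: k)
  case 0
  then show ?case by (simp add: root_fps_def)
next
  case (Suc n)
  then obtain k' where "k = Suc k'" by (cases k) auto
  with Suc show ?case by (simp add: root_fps_Suc_nth_Suc)
qed

text \<open>\<open>root_fps\<close> is the reversal of the polynomial with roots \<open>x i\<close>,
  so congruent coefficients can be read as shared roots.\<close>

lemma prod_diff_eq_root_fps: "(\<Prod>i<n. y - x i) = (\<Sum>k\<le>n. root_fps n x $ k * y ^ (n - k))"
proof (induction n)
  case 0
  then show ?case by (simp add: root_fps_def)
next
  case (Suc n)
  have "(\<Sum>k\<le>Suc n. root_fps (Suc n) x $ k * y ^ (Suc n - k)) =
      y ^ Suc n + (\<Sum>k\<le>n. root_fps (Suc n) x $ Suc k * y ^ (n - k))"
    by (simp add: sum.atMost_Suc_shift del: sum.atMost_Suc)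
  also have "\<dots> = (y ^ Suc n + (\<Sum>k\<le>n. root_fps n x $ Suc k * y ^ (n - k))) -
      x n * (\<Sum>k\<le>n. root_fps n x $ k * y ^ (n - k))"
    by (simp add: root_fps_Suc_nth_Suc left_diff_distrib sum_subtractf sum_distrib_left mult.assoc)
  also have "y ^ Suc n + (\<Sum>k\<le>n. root_fps n x $ Suc k * y ^ (n - k)) =
      (\<Sum>k\<le>Suc n. root_fps n x $ k * y ^ (Suc n - k))"
    by (simp add: sum.atMost_Suc_shift del: sum.atMost_Suc)
  also have "\<dots> = (\<Sum>k\<le>n. root_fps n x $ k * y ^ Suc (n - k))"
    by (simp add: root_fps_nth_eq_0 Suc_diff_le)
  also have "\<dots> = y * (\<Sum>k\<le>n. root_fps n x $ k * y ^ (n - k))"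
    by (simp add: sum_distrib_left mult_ac)
  finally show ?case using Suc by (simp add: algebra_simps)
qed

lemma irreducible_poly_dvd_prod:
  fixes R :: "'a::field poly"
  assumes "irreducible R" "finite I" "R dvd (\<Prod>i\<in>I. f i)"
  shows "\<exists>i\<in>I. R dvd f i"
  using assms(2,3)
proof (induction I rule: finite_induct)
  case empty
  then show ?case using assms(1) by (simp add: irreducible_def)
next
  case (insert i I)
  then show ?case using irreducible_poly_dvd_mult[OF assms(1), of "f i"] by auto
qed

lemma dvd_diff_sum: "(\<And>i. i \<in> I \<Longrightarrow> R dvd f i - g i) \<Longrightarrow> R dvd (\<Sum>i\<in>I. f i) - (\<Sum>i\<in>I. g i)"
  for R :: "'a::comm_ring_1"
  unfolding sum_subtractf[symmetric] by (rule dvd_sum)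

lemma dvd_diff_mult: "R dvd a - b \<Longrightarrow> R dvd c - d \<Longrightarrow> R dvd a * c - b * d"
  for R :: "'a::comm_ring_1"
proof -
  assume "R dvd a - b" "R dvd c - d"
  moreover have "a * c - b * d = (a - b) * c + b * (c - d)" by (simp add: algebra_simps)
  ultimately show ?thesis by simp
qed

lemma prime_CHAR_finite_field: "prime CHAR('a::{field,finite})"
  by (rule prime_CHAR_semidom) (rule finite_imp_CHAR_pos, simp)

lemma is_unit_of_nat_poly:
  assumes "\<not> CHAR('a::field) dvd n"
  shows "is_unit (of_nat n :: 'a poly)"
proof -
  have "(of_nat n :: 'a) \<noteq> 0" using assms by (simp add: of_nat_eq_0_iff_char_dvd)
  then show ?thesis by (simp add: of_nat_poly is_unit_pCons_iff)
qed

lemma power_sum_CHAR_mult: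
  fixes x :: "nat \<Rightarrow> 'a::{field,finite} poly"
  shows "power_sum n x (j * CHAR('a)) = power_sum n x j ^ CHAR('a)"
proof -
  have "prime CHAR('a poly)" by (simp only: semiring_char_poly prime_CHAR_finite_field)
  from freshmans_dream_sum[OF this refl, of "\<lambda>i. x i ^ j" "{..<n}"]
  show ?thesis by (simp only: power_sum_def semiring_char_poly power_mult)
qed

text \<open>For an exponent divisible by the characteristic p, Frobenius makes the power sum the
  p-th power of one with a smaller exponent.\<close>

lemma power_sum_cong:
  fixes x y :: "nat \<Rightarrow> 'a::{field,finite} poly"
  assumes "\<And>r. 0 < r \<Longrightarrow> r \<le> d \<Longrightarrow> \<not> CHAR('a) dvd r \<Longrightarrow> R dvd power_sum n x r - power_sum n y r"
    and "0 < r" "r \<le> d"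
  shows "R dvd power_sum n x r - power_sum n y r"
  using assms(2,3)
proof (induction r rule: less_induct)
  case (less r)
  show ?case
  proof (cases "CHAR('a) dvd r")
    case True
    then obtain j where "r = CHAR('a) * j" by (elim dvdE)
    then have j: "r = j * CHAR('a)" by simp
    have "1 < CHAR('a)" using prime_CHAR_finite_field prime_gt_1_nat by blast
    then have "0 < j" "j < r" using j less.prems by (auto intro: Nat.gr0I)
    then have "R dvd power_sum n x j - power_sum n y j" using less by simp
    then show ?thesis by (simp only: j power_sum_CHAR_mult dvd_diff_power)
  qed (use assms(1) less.prems in simp)
qed

text \<open>Newton's identity gives \<open>r\<close> times the \<open>r\<close>-th coefficient in
  terms of earlier data, and \<open>r\<close> is a unit when prime to the characteristic; the
  remaining indices are covered by assumption \<open>es\<close>.\<close>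

lemma root_fps_cong:
  fixes x y :: "nat \<Rightarrow> 'a::{field,finite} poly"
  assumes ps: "\<And>r. 0 < r \<Longrightarrow> r \<le> d \<Longrightarrow> \<not> CHAR('a) dvd r \<Longrightarrow> R dvd power_sum n x r - power_sum n y r"
    and es: "\<And>r. 0 < r \<Longrightarrow> r \<le> d \<Longrightarrow> CHAR('a) dvd r \<Longrightarrow> R dvd root_fps n x $ r - root_fps n y $ r"
    and "r \<le> d"
  shows "R dvd root_fps n x $ r - root_fps n y $ r"
  using assms(3)
proof (induction r rule: less_induct)
  case (less r)
  consider "r = 0" | "0 < r" "CHAR('a) dvd r" | "0 < r" "\<not> CHAR('a) dvd r" by blast
  then show ?case
  proof cases
    case 3
    then obtain m where m: "r = Suc m" by (cases r) auto
    have "R dvd (\<Sum>i\<le>m. root_fps n x $ i * power_sum n x (Suc (m - i))) -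
        (\<Sum>i\<le>m. root_fps n y $ i * power_sum n y (Suc (m - i)))"
      using less m by (intro dvd_diff_sum dvd_diff_mult power_sum_cong[OF ps]) auto
    then have "R dvd of_nat r * root_fps n y $ r - of_nat r * root_fps n x $ r"
      unfolding m newton_identity by (simp add: algebra_simps)
    then have "R dvd of_nat r * (root_fps n x $ r - root_fps n y $ r)"
      by (subst dvd_minus_iff[symmetric]) (simp add: algebra_simps)
    then show ?thesis
      using is_unit_of_nat_poly[OF 3(2)] by (simp add: dvd_mult_unit_iff')
  qed (use es less.prems in auto)
qed

text \<open>The product of all \<open>y i - y j\<close> vanishes and agrees modulo \<open>R\<close>
  with the product of all \<open>y i - x j\<close>; irreducibility then picks a factor.\<close>

lemma root_fps_cong_imp_root:
  fixes x y :: "nat \<Rightarrow> 'a::field poly"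
  assumes "irreducible R" "\<And>r. r \<le> n \<Longrightarrow> R dvd root_fps n x $ r - root_fps n y $ r" "i < n"
  shows "\<exists>j<n. R dvd y i - x j"
proof -
  have "R dvd (\<Prod>j<n. y i - x j) - (\<Prod>j<n. y i - y j)"
    unfolding prod_diff_eq_root_fps
    using assms(2) by (intro dvd_diff_sum) (auto simp: left_diff_distrib[symmetric])
  also have "(\<Prod>j<n. y i - y j) = 0" using assms(3) by (intro prod_zero) auto
  finally have "R dvd (\<Prod>j<n. y i - x j)" by simp
  then show ?thesis using irreducible_poly_dvd_prod[OF assms(1), of "{..<n}"] by auto
qed

section \<open>Counting tuples and roots modulo an irreducible polynomial\<close>

lemma card_le_fibers:
  assumes "finite A" "finite B" "f ` A \<subseteq> B" "\<And>b. b \<in> B \<Longrightarrow> card {a \<in> A. f a = b} \<le> c"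
  shows "card A \<le> card B * c"
proof -
  have "card A = (\<Sum>b\<in>f ` A. card {a \<in> A. f a = b})"
    using sum.image_gen[OF assms(1), of "\<lambda>_. 1::nat" f] by simp
  also have "\<dots> \<le> (\<Sum>b\<in>f ` A. c)" using assms(3,4) by (intro sum_mono) auto
  also have "\<dots> \<le> card B * c" using card_mono[OF assms(2,3)] by simp
  finally show ?thesis .
qed

text \<open>By Newton's identities the power sums with exponents prime to the characteristic determine all
  elementary symmetric functions except those whose index is divisible by the characteristic.\<close>
lemma card_equal_power_sums:
  fixes R :: "'a::{field,finite} poly" and y :: "nat \<Rightarrow> 'a poly"
  assumes R: "irreducible R"
  shows "card {x \<in> {..<d} \<rightarrow>\<^sub>E residues R.
           \<forall>r\<in>{1..d}. \<not> CHAR('a) dvd r \<longrightarrow> R dvd power_sum d x r - power_sum d y r}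
    \<le> poly_norm R ^ card {r \<in> {1..d}. CHAR('a) dvd r} * d ^ d" (is "card ?X \<le> _ ^ card ?J * _")
proof -
  have R0: "R \<noteq> 0" using R by auto
  \<comment> \<open>These are the symmetric functions left undetermined; they account for the factor
    \<open>poly_norm R ^ card ?J\<close>.\<close>
  define f where "f x = (\<lambda>r\<in>?J. root_fps d x $ r mod R)" for x :: "nat \<Rightarrow> 'a poly"
  have "card ?X \<le> card (?J \<rightarrow>\<^sub>E residues R) * d ^ d"
  proof (rule card_le_fibers)
    show "finite ?X" by (rule finite_subset[of _ "{..<d} \<rightarrow>\<^sub>E residues R"]) (auto intro!: finite_PiE R0)
    show "finite (?J \<rightarrow>\<^sub>E residues R)" by (auto intro!: finite_PiE R0)
    show "f ` ?X \<subseteq> ?J \<rightarrow>\<^sub>E residues R" by (auto simp: f_def)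
    fix b assume "b \<in> ?J \<rightarrow>\<^sub>E residues R"
    show "card {x \<in> ?X. f x = b} \<le> d ^ d"
    proof (cases "{x \<in> ?X. f x = b} = {}")
      case False
      then obtain w where w: "w \<in> ?X" "f w = b" by blast
      \<comment> \<open>Against a fixed member \<open>w\<close> of the fibre, every entry of any
        member is one of the entries of \<open>w\<close>; this leaves at most \<open>d ^ d\<close>
        tuples.\<close>
      have "x i \<in> w ` {..<d}" if x: "x \<in> ?X" "f x = b" and i: "i < d" for x i
      proof -
        have "R dvd root_fps d w $ r - root_fps d x $ r" if "r \<le> d" for r
        proof (rule root_fps_cong[OF _ _ that])
          fix r assume r: "0 < r" "r \<le> d" "\<not> CHAR('a) dvd r"
          then have "R dvd power_sum d w r - power_sum d y r" "R dvd power_sum d x r - power_sum d y r"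
            using w x by auto
          from dvd_diff[OF this] show "R dvd power_sum d w r - power_sum d x r" by simp
        next
          fix r assume r: "0 < r" "r \<le> d" "CHAR('a) dvd r"
          have "f w r = f x r" using w x by simp
          then show "R dvd root_fps d w $ r - root_fps d x $ r"
            using r by (simp add: f_def mod_eq_dvd_iff)
        qed
        from root_fps_cong_imp_root[OF R this i] obtain j where j: "j < d" "R dvd x i - w j" by blast
        moreover have "x i \<in> residues R" "w j \<in> residues R" using x w i j by auto
        ultimately show ?thesis using residues_eq_iff_dvd by blast
      qed
      then have "{x \<in> ?X. f x = b} \<subseteq> {..<d} \<rightarrow>\<^sub>E w ` {..<d}" by (auto simp: PiE_iff extensional_def)
      then have "card {x \<in> ?X. f x = b} \<le> card ({..<d} \<rightarrow>\<^sub>E w ` {..<d})"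
        by (intro card_mono finite_PiE) auto
      also have "\<dots> \<le> d ^ d" using card_image_le[of "{..<d}" w] by (simp add: card_PiE power_mono)
      finally show ?thesis .
    qed (simp only: card.empty)
  qed
  also have "card (?J \<rightarrow>\<^sub>E residues R) = poly_norm R ^ card ?J"
    by (simp add: card_PiE card_residues R0)
  finally show ?thesis .
qed

text \<open>The usual root count by splitting off linear factors. Nonvanishing modulo
  \<open>R\<close> is asked of some coefficient rather than the leading one, a condition that the
  quotient inherits.\<close>

lemma card_roots_mod_irreducible:
  fixes f :: "'a::{field,finite} poly poly"
  assumes R: "irreducible R" and "\<exists>i. \<not> R dvd coeff f i"
  shows "card {a \<in> residues R. R dvd poly f a} \<le> degree f"
  using assms(2)
proof (induction "degree f" arbitrary: f)
  case 0
  then obtain c where c: "f = [:c:]" by (metis degree_eq_zeroE)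
  obtain i where "\<not> R dvd coeff f i" using 0 by blast
  then have "\<not> R dvd c" by (cases i) (simp_all add: c)
  then show ?case by (simp add: c)
next
  case (Suc n)
  have R0: "R \<noteq> 0" using R by auto
  show ?case
  proof (cases "{a \<in> residues R. R dvd poly f a} = {}")
    case False
    then obtain a where a: "a \<in> residues R" "R dvd poly f a" by blast
    define q where "q = synthetic_div f a"
    have f: "f = [:-a, 1:] * q + [:poly f a:]" by (simp only: q_def synthetic_div_correct')
    have q: "degree q = n" using Suc(2) by (simp add: q_def degree_synthetic_div)
    have "\<exists>i. \<not> R dvd coeff q i"
    proof (rule ccontr)
      assume "\<not> ?thesis"
      then have "R dvd coeff f i" for i
        by (subst f) (use a in \<open>auto simp: coeff_pCons split: nat.splits\<close>)
      then show False using Suc.prems by blast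
    qed
    then have IH: "card {a \<in> residues R. R dvd poly q a} \<le> n" using Suc(1)[of q] q by simp
    have "{a \<in> residues R. R dvd poly f a} \<subseteq> insert a {a \<in> residues R. R dvd poly q a}"
    proof
      fix b assume b: "b \<in> {a \<in> residues R. R dvd poly f a}"
      have "poly f b = (b - a) * poly q b + poly f a" by (subst f) (simp add: algebra_simps)
      then have "R dvd (b - a) * poly q b" using b a by (metis (no_types, lifting) dvd_add_left_iff mem_Collect_eq)
      then have "R dvd b - a \<or> R dvd poly q b" using irreducible_poly_dvd_mult[OF R] by blast
      then show "b \<in> insert a {a \<in> residues R. R dvd poly q a}"
        using b residues_eq_iff_dvd[OF _ a(1), of b] by auto
    qed
    then have "card {a \<in> residues R. R dvd poly f a} \<le> card (insert a {a \<in> residues R. R dvd poly q a})"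
      using R0 by (intro card_mono) auto
    also have "\<dots> \<le> Suc n" using IH R0 by (simp add: card_insert_if)
    finally show ?thesis using Suc(2) by simp
  qed (simp only: card.empty)
qed

section \<open>Exponential sums\<close>

lemma sum_swap3:
  "(\<Sum>a\<in>A. \<Sum>b\<in>B. \<Sum>c\<in>C. f a b c) = (\<Sum>c\<in>C. \<Sum>b\<in>B. \<Sum>a\<in>A. f a b c)"
proof -
  have "(\<Sum>a\<in>A. \<Sum>b\<in>B. \<Sum>c\<in>C. f a b c) = (\<Sum>b\<in>B. \<Sum>a\<in>A. \<Sum>c\<in>C. f a b c)"
    by (rule sum.swap)
  also have "\<dots> = (\<Sum>b\<in>B. \<Sum>c\<in>C. \<Sum>a\<in>A. f a b c)"
    by (rule sum.cong[OF refl], rule sum.swap)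
  also have "\<dots> = (\<Sum>c\<in>C. \<Sum>b\<in>B. \<Sum>a\<in>A. f a b c)"
    by (rule sum.swap)
  finally show ?thesis .
qed

context primitive_char_mod
begin

text \<open>The coefficients form a function on the exponent set \<open>I\<close>, so that moments
  over all coefficient vectors can be taken.\<close>

definition exp_sum :: "nat set \<Rightarrow> (nat \<Rightarrow> 'a poly) \<Rightarrow> complex" where
  "exp_sum I \<beta> = (\<Sum>v\<in>residues Q. e (\<Sum>r\<in>I. \<beta> r * v ^ r))"

lemma exp_sum_power:
  "exp_sum I \<beta> ^ d = (\<Sum>x\<in>{..<d} \<rightarrow>\<^sub>E residues Q. e (\<Sum>r\<in>I. \<beta> r * power_sum d x r))"
proof -
  have "exp_sum I \<beta> ^ d = (\<Prod>i<d. \<Sum>v\<in>residues Q. e (\<Sum>r\<in>I. \<beta> r * v ^ r))"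
    by (simp add: exp_sum_def)
  also have "\<dots> = (\<Sum>x\<in>{..<d} \<rightarrow>\<^sub>E residues Q. \<Prod>i<d. e (\<Sum>r\<in>I. \<beta> r * x i ^ r))"
    by (rule prod_sum_PiE) auto
  also have "\<dots> = (\<Sum>x\<in>{..<d} \<rightarrow>\<^sub>E residues Q. e (\<Sum>r\<in>I. \<beta> r * power_sum d x r))"
  proof (intro sum.cong refl)
    fix x :: "nat \<Rightarrow> 'a poly"
    have "(\<Prod>i<d. e (\<Sum>r\<in>I. \<beta> r * x i ^ r)) = e (\<Sum>i<d. \<Sum>r\<in>I. \<beta> r * x i ^ r)"
      by (simp add: add_char_sum[OF add_char_e])
    also have "(\<Sum>i<d. \<Sum>r\<in>I. \<beta> r * x i ^ r) = (\<Sum>r\<in>I. \<beta> r * power_sum d x r)"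
      by (subst sum.swap) (simp add: power_sum_def sum_distrib_left)
    finally show "(\<Prod>i<d. e (\<Sum>r\<in>I. \<beta> r * x i ^ r)) = e (\<Sum>r\<in>I. \<beta> r * power_sum d x r)" .
  qed
  finally show ?thesis .
qed

text \<open>After expanding both powers, the coordinates \<open>\<beta> r\<close> vary
  independently; orthogonality in each of them leaves the pairs of tuples whose power sums are
  congruent for all exponents in \<open>I\<close>.\<close>

lemma exp_sum_moment:
  assumes I: "finite I"
  shows "(\<Sum>\<beta>\<in>I \<rightarrow>\<^sub>E residues Q. cmod (exp_sum I \<beta>) ^ (2 * d)) =
    real (poly_norm Q ^ card I *
      (\<Sum>y\<in>{..<d} \<rightarrow>\<^sub>E residues Q. card {x \<in> {..<d} \<rightarrow>\<^sub>E residues Q.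
         \<forall>r\<in>I. Q dvd power_sum d x r - power_sum d y r}))"
proof -
  let ?T = "{..<d} \<rightarrow>\<^sub>E residues Q"
  let ?P = "\<lambda>x y. \<forall>r\<in>I. Q dvd power_sum d x r - power_sum d y r"
  have fin: "finite ?T" by (intro finite_PiE) auto
  have "complex_of_real (cmod z ^ (2 * d)) = z ^ d * cnj (z ^ d)" for z
  proof -
    have "(cmod z ^ d)\<^sup>2 = cmod z ^ (2 * d)" by (simp add: power_mult[symmetric] mult.commute)
    then show ?thesis using complex_norm_square[of "z ^ d"] by (simp only: norm_power)
  qed
  then have "complex_of_real (\<Sum>\<beta>\<in>I \<rightarrow>\<^sub>E residues Q. cmod (exp_sum I \<beta>) ^ (2 * d)) =
      (\<Sum>\<beta>\<in>I \<rightarrow>\<^sub>E residues Q. exp_sum I \<beta> ^ d * cnj (exp_sum I \<beta> ^ d))"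
    by (simp only: of_real_sum)
  also have "\<dots> = (\<Sum>\<beta>\<in>I \<rightarrow>\<^sub>E residues Q. \<Sum>x\<in>?T. \<Sum>y\<in>?T.
      \<Prod>r\<in>I. e (\<beta> r * (power_sum d x r - power_sum d y r)))"
    unfolding exp_sum_power cnj_sum sum_product
    by (intro sum.cong refl)
       (simp add: add_char_diff[OF add_char_e, symmetric] add_char_sum[OF add_char_e, symmetric]
          sum_subtractf[symmetric] right_diff_distrib)
  also have "\<dots> = (\<Sum>y\<in>?T. \<Sum>x\<in>?T. \<Sum>\<beta>\<in>I \<rightarrow>\<^sub>E residues Q.
      \<Prod>r\<in>I. e (\<beta> r * (power_sum d x r - power_sum d y r)))"
    by (rule sum_swap3)
  also have "\<dots> = (\<Sum>y\<in>?T. \<Sum>x\<in>?T. \<Prod>r\<in>I. \<Sum>b\<in>residues Q. e (b * (power_sum d x r - power_sum d y r)))"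
    by (simp add: prod_sum_PiE[OF I])
  also have "\<dots> = (\<Sum>y\<in>?T. \<Sum>x\<in>?T. if ?P x y then of_nat (poly_norm Q ^ card I) else 0)"
  proof (intro sum.cong refl)
    fix x y :: "nat \<Rightarrow> 'a poly"
    show "(\<Prod>r\<in>I. \<Sum>b\<in>residues Q. e (b * (power_sum d x r - power_sum d y r))) =
        (if ?P x y then of_nat (poly_norm Q ^ card I) else 0)"
    proof (cases "?P x y")
      case False
      then have "\<exists>r\<in>I. (\<Sum>b\<in>residues Q. e (b * (power_sum d x r - power_sum d y r))) = 0"
        by (auto simp: sum_e_scale)
      then have "(\<Prod>r\<in>I. \<Sum>b\<in>residues Q. e (b * (power_sum d x r - power_sum d y r))) = 0"
        using I by (intro prod_zero)
      then show ?thesis using False by simp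
    qed (simp add: sum_e_scale)
  qed
  also have "\<dots> = (\<Sum>y\<in>?T. of_nat (card {x \<in> ?T. ?P x y}) * of_nat (poly_norm Q ^ card I))"
    using fin by (simp add: sum.inter_filter[symmetric])
  also have "\<dots> = complex_of_real (real (poly_norm Q ^ card I * (\<Sum>y\<in>?T. card {x \<in> ?T. ?P x y})))"
    by (simp add: sum_distrib_left mult.commute)
  finally show ?thesis by (simp only: of_real_eq_iff)
qed

text \<open>Mordell's argument: replacing \<open>v\<close> by \<open>a * v\<close> shows that at least \<open>(poly_norm Q - 1) / d\<close>
  coefficient vectors share the value of the sum at \<open>\<beta>\<close>, and the moment bounds their total.\<close>
lemma exp_sum_irreducible_bound:
  assumes irr: "irreducible Q" and d: "0 < d"
    and I: "I = {r \<in> {1..d}. \<not> CHAR('a) dvd r}"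
    and nz: "s \<in> I" "\<not> Q dvd \<beta> s"
  shows "cmod (exp_sum I \<beta>) ^ (2 * d) * (real (poly_norm Q) - 1) \<le> real d ^ (d + 1) * real (poly_norm Q) ^ (2 * d)"
proof -
  let ?T = "{..<d} \<rightarrow>\<^sub>E residues Q"
  let ?J = "{r \<in> {1..d}. CHAR('a) dvd r}"
  let ?K = "poly_norm Q"
  \<comment> \<open>The coefficients of the phase after substituting \<open>a * v\<close> for
    \<open>v\<close>.\<close>
  define \<beta>' where "\<beta>' a = (\<lambda>r\<in>I. (\<beta> r * a ^ r) mod Q)" for a
  have finI: "finite I" by (simp add: I)
  have fin: "finite (I \<rightarrow>\<^sub>E residues Q)" by (intro finite_PiE finI) auto
  have "card I + card ?J = card (I \<union> ?J)" unfolding I by (subst card_Un_disjoint) auto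
  also have "I \<union> ?J = {1..d}" by (auto simp: I)
  finally have IJ: "card I + card ?J = d" by simp
  have same: "exp_sum I (\<beta>' a) = exp_sum I \<beta>" if a: "a \<in> residues Q - {0}" for a
  proof -
    have per: "periodic_mod Q (\<lambda>v. e (\<Sum>r\<in>I. \<beta> r * v ^ r))"
      by (intro periodic_modI primitive_char_eq[OF primitive] dvd_diff_sum dvd_diff_mult dvd_diff_power) auto
    have na: "\<not> Q dvd a" using a residues_eq_iff_dvd[of a Q 0] by auto
    have "exp_sum I (\<beta>' a) = (\<Sum>v\<in>residues Q. e (\<Sum>r\<in>I. \<beta> r * (a * v) ^ r))"
      unfolding exp_sum_def
    proof (intro sum.cong refl primitive_char_eq[OF primitive] dvd_diff_sum)
      fix v r assume "r \<in> I"
      then have "\<beta>' a r * v ^ r - \<beta> r * (a * v) ^ r = (\<beta>' a r - \<beta> r * a ^ r) * v ^ r"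
        by (simp add: power_mult_distrib algebra_simps)
      moreover have "Q dvd \<beta>' a r - \<beta> r * a ^ r"
        using \<open>r \<in> I\<close> by (simp add: \<beta>'_def mod_eq_dvd_iff[symmetric])
      ultimately show "Q dvd \<beta>' a r * v ^ r - \<beta> r * (a * v) ^ r" by simp
    qed
    also have "\<dots> = exp_sum I \<beta>"
      unfolding exp_sum_def by (rule sum_residues_scale[OF irr na per])
    finally show ?thesis .
  qed
  have s: "1 \<le> s" "s \<le> d" using nz(1) by (auto simp: I)
  have "card (residues Q - {0}) \<le> card (\<beta>' ` (residues Q - {0})) * d"
  proof (rule card_le_fibers)
    fix b assume "b \<in> \<beta>' ` (residues Q - {0})"
    then obtain w where w: "b = \<beta>' w" by blast
    \<comment> \<open>As \<open>\<beta> s\<close> is invertible modulo \<open>Q\<close>, multipliers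
      \<open>a\<close> and \<open>w\<close> with the same vector satisfy
      \<open>Q dvd a ^ s - w ^ s\<close>; so \<open>a\<close> is a root of this polynomial, whose
      degree is at most \<open>d\<close>.\<close>
    define f where "f = monom 1 s - [:w ^ s:]"
    have "degree f \<le> s" unfolding f_def by (intro degree_diff_le) (simp_all add: degree_monom_eq)
    moreover have "coeff f s = 1" using s by (simp add: f_def coeff_pCons split: nat.splits)
    then have "\<not> Q dvd coeff f s" using irr by (simp add: irreducible_def)
    ultimately have "card {a \<in> residues Q. Q dvd poly f a} \<le> d"
      using card_roots_mod_irreducible[OF irr, of f] s by force
    moreover have "{a \<in> residues Q - {0}. \<beta>' a = b} \<subseteq> {a \<in> residues Q. Q dvd poly f a}"
    proof safe
      fix a assume "b = \<beta>' a"
      then have "\<beta>' a s = \<beta>' w s" using w by simp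
      then have "Q dvd \<beta> s * (a ^ s - w ^ s)"
        using nz(1) by (simp add: \<beta>'_def mod_eq_dvd_iff right_diff_distrib)
      from irreducible_poly_dvd_mult[OF irr nz(2) this]
      show "Q dvd poly f a" by (simp add: f_def poly_monom)
    qed
    then have "card {a \<in> residues Q - {0}. \<beta>' a = b} \<le> card {a \<in> residues Q. Q dvd poly f a}"
      by (intro card_mono) auto
    ultimately show "card {a \<in> residues Q - {0}. \<beta>' a = b} \<le> d" by linarith
  qed auto
  then have "?K - 1 \<le> card (\<beta>' ` (residues Q - {0})) * d"
    by (simp add: card_Diff_singleton card_residues)
  then have orbit: "real ?K - 1 \<le> real (card (\<beta>' ` (residues Q - {0}))) * d"
    by (metis Num.of_nat_simps(2) Suc_leI of_nat_diff of_nat_le_iff of_nat_mult poly_norm_pos One_nat_def)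
  have "real (card (\<beta>' ` (residues Q - {0}))) * cmod (exp_sum I \<beta>) ^ (2 * d) =
      (\<Sum>\<gamma>\<in>\<beta>' ` (residues Q - {0}). cmod (exp_sum I \<beta>) ^ (2 * d))"
    by simp
  also have "\<dots> = (\<Sum>\<gamma>\<in>\<beta>' ` (residues Q - {0}). cmod (exp_sum I \<gamma>) ^ (2 * d))"
    by (intro sum.cong refl) (use same in force)
  also have "\<dots> \<le> (\<Sum>\<gamma>\<in>I \<rightarrow>\<^sub>E residues Q. cmod (exp_sum I \<gamma>) ^ (2 * d))"
    by (intro sum_mono2 fin) (auto simp: \<beta>'_def)
  also have "\<dots> = real (?K ^ card I * (\<Sum>y\<in>?T. card {x \<in> ?T. \<forall>r\<in>I. Q dvd power_sum d x r - power_sum d y r}))"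
    by (rule exp_sum_moment[OF finI])
  also have "\<dots> \<le> real (?K ^ card I * (\<Sum>y\<in>?T. ?K ^ card ?J * d ^ d))"
  proof (intro of_nat_mono mult_left_mono sum_mono)
    fix y
    show "card {x \<in> ?T. \<forall>r\<in>I. Q dvd power_sum d x r - power_sum d y r} \<le> ?K ^ card ?J * d ^ d"
      using card_equal_power_sums[OF irr, of d y] by (simp add: I imp_conjL Ball_def)
  qed auto
  also have "\<dots> = real ?K ^ (2 * d) * real d ^ d"
  proof -
    \<comment> \<open>Undetermined symmetric functions cost \<open>card ?J\<close> powers, but only
      \<open>card I\<close> coefficients are averaged over; the total is the same as if no exponent
      were divisible by the characteristic.\<close>
    have "?K ^ card I * (\<Sum>y\<in>?T. ?K ^ card ?J * d ^ d) = ?K ^ (card I + card ?J) * ?K ^ d * d ^ d"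
      using card_PiE[of "{..<d}" "\<lambda>_. residues Q"] by (simp add: card_residues power_add)
    also have "\<dots> = ?K ^ d * ?K ^ d * d ^ d" by (simp only: IJ)
    finally show ?thesis by (simp only: mult_2 power_add of_nat_mult of_nat_power)
  qed
  finally have main: "real (card (\<beta>' ` (residues Q - {0}))) * cmod (exp_sum I \<beta>) ^ (2 * d)
      \<le> real ?K ^ (2 * d) * real d ^ d" .
  have "cmod (exp_sum I \<beta>) ^ (2 * d) * (real ?K - 1) \<le>
      cmod (exp_sum I \<beta>) ^ (2 * d) * (real (card (\<beta>' ` (residues Q - {0}))) * d)"
    by (intro mult_left_mono orbit) auto
  also have "\<dots> = real d * (real (card (\<beta>' ` (residues Q - {0}))) * cmod (exp_sum I \<beta>) ^ (2 * d))"
    by simp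
  also have "\<dots> \<le> real d * (real ?K ^ (2 * d) * real d ^ d)"
    by (intro mult_left_mono main) auto
  finally show ?thesis by (simp add: mult_ac)
qed

end

section \<open>Reduction to an irreducible modulus\<close>

text \<open>The remainder is kept as a multiple of \<open>u ^ 2\<close>, without a division by 2, so
  that characteristic 2 is covered.\<close>

lemma poly_taylor2:
  fixes G :: "'b::idom poly"
  obtains c where "poly G (y + u) = poly G y + u * poly (pderiv G) y + u ^ 2 * c"
proof (induction G arbitrary: thesis)
  case 0
  show ?case by (rule 0[of 0]) simp
next
  case (pCons a G)
  obtain c where c: "poly G (y + u) = poly G y + u * poly (pderiv G) y + u ^ 2 * c"
    using pCons.IH by blast
  show ?case
    by (rule pCons.prems[of "poly (pderiv G) y + (y + u) * c"])
       (unfold poly_pCons c pderiv_pCons poly_add, simp add: algebra_simps power2_eq_square)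
qed

lemma mult_dvd_of_bezout:
  assumes "A * u + B * v = (1::'b::comm_ring_1)" "A dvd x" "B dvd x"
  shows "A * B dvd x"
proof -
  obtain a where "x = A * a" using assms(2) by (rule dvdE)
  moreover obtain b where "x = B * b" using assms(3) by (rule dvdE)
  ultimately have "A * u * x = A * B * (u * b)" "B * v * x = A * B * (v * a)" by (metis mult.assoc mult.commute)+
  moreover have "x = A * u * x + B * v * x" using assms(1) by (metis distrib_right mult_1)
  ultimately have "x = A * B * (u * b + v * a)" by (simp add: algebra_simps)
  then show ?thesis by (metis dvd_triv_left)
qed

text \<open>A shift leaves the outer average unchanged, so an inner average over shifts can be
  inserted at no cost.\<close>

lemma average_periodic_average_translate:
  fixes f :: "'a::{field,finite} poly \<Rightarrow> complex"
  assumes "Q \<noteq> 0" "periodic_mod Q f" "finite S" "S \<noteq> {}"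
  shows "average (residues Q) f = average (residues Q) (\<lambda>y. average S (\<lambda>v. f (y + g v)))"
  by (simp add: average_swap[of "residues Q"] average_translate[OF assms(1,2)] average_const[OF assms(3,4)])

lemma average_periodic_divisor:
  fixes f :: "'a::{field,finite} poly \<Rightarrow> complex"
  assumes "Q \<noteq> 0" "R dvd Q" "periodic_mod R f"
  shows "average (residues Q) f = average (residues R) f"
proof -
  have R: "R \<noteq> 0" using assms(1,2) by auto
  have ne: "residues R \<noteq> {}" "residues Q \<noteq> {}" using zero_in_residues by blast+
  have inner: "average (residues R) (\<lambda>v. f (y + v)) = average (residues R) f" for y
    using average_translate[OF R assms(3), of y] by (simp add: add.commute)
  have "average (residues Q) f = average (residues Q) (\<lambda>y. average (residues R) (\<lambda>v. f (y + v)))"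
    using average_periodic_average_translate[OF assms(1) periodic_mod_mult[OF assms(3,2)], of "residues R" "\<lambda>v. v"]
      R ne by simp
  also have "\<dots> = average (residues R) f" using ne assms(1) by (simp add: inner average_const)
  finally show ?thesis .
qed

lemma poly_norm_irreducible_ge_2: "irreducible (R :: 'a::{field,finite} poly) \<Longrightarrow> 2 \<le> poly_norm R"
proof -
  assume "irreducible R"
  then have "0 < degree R" using is_unit_iff_degree[of R] by (auto simp: irreducible_def)
  moreover have "card {0, 1::'a} \<le> CARD('a)" by (intro card_mono) auto
  then have "2 \<le> CARD('a)" by simp
  moreover from this have "CARD('a) \<le> CARD('a) ^ degree R"
    using calculation(1) by (intro self_le_power) auto
  ultimately show ?thesis by (simp add: poly_norm_def)
qed

text \<open>Averaging over translates by \<open>W * v\<close> isolates the irreducible factor \<open>R\<close>. When \<open>R\<close> divides \<open>W\<close>,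
  the phase is linear in \<open>v\<close> with slope given by the derivative; otherwise the Chinese remainder
  theorem leaves a complete sum modulo \<open>R\<close>.\<close>
lemma exp_average_bound_primitive:
  fixes R W Q :: "'a::{field,finite} poly" and G :: "'a poly poly"
  assumes Q: "Q \<noteq> 0" "R * W dvd Q" and R: "irreducible R" and e: "primitive_char (R * W) e"
    and G: "degree G \<le> d" "\<And>r. CHAR('a) dvd r \<Longrightarrow> coeff G r = 0" and s: "\<not> R dvd coeff G s"
  shows "cmod (average (residues Q) (\<lambda>y. e (poly G y))) ^ (2 * d) * real (poly_norm R) \<le> 2 * real d ^ (d + 1)"
proof -
  have W: "W \<noteq> 0" and R0: "R \<noteq> 0" using Q by auto
  have add: "add_char e" using e by (rule primitive_char_add_char)
  \<comment> \<open>A primitive character modulo \<open>R\<close> alone, which is what remains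
    visible when \<open>y\<close> moves by multiples of \<open>W\<close>.\<close>
  define eR where "eR x = e (W * x)" for x
  have "primitive_char R eR"
    using primitive_char_cofactor[of W R e] e W by (simp add: eR_def[abs_def] mult.commute)
  then interpret R: primitive_char_mod R eR
    using R0 by unfold_locales
  define I where "I = {r \<in> {1..d}. \<not> CHAR('a) dvd r}"
  have coeff_0: "coeff G r = 0" if "r \<notin> I" for r
  proof (cases "r = 0 \<or> CHAR('a) dvd r")
    case False
    then have "degree G < r" using that G(1) by (auto simp: I_def)
    then show ?thesis by (rule coeff_eq_0)
  qed (use G(2) in auto)
  have sI: "s \<in> I" using coeff_0 s by (metis dvd_0_right)
  have d: "0 < d" using sI by (auto simp: I_def)
  define K where "K = real (poly_norm R)"
  have K: "2 \<le> K" using poly_norm_irreducible_ge_2[OF R] by (simp add: K_def)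
  define f where "f y = e (poly G y)" for y
  have f_per: "periodic_mod (R * W) f" unfolding f_def
    by (intro periodic_modI primitive_char_eq[OF e] dvd_diff_poly)
  define A where "A = average (residues Q) f"
  have A: "A = average (residues Q) (\<lambda>y. average (residues R) (\<lambda>v. f (y + W * v)))"
    unfolding A_def
    by (rule average_periodic_average_translate[OF Q(1) periodic_mod_mult[OF f_per Q(2)]]) simp_all
  have Qres: "finite (residues Q)" "residues Q \<noteq> {}" using Q(1) zero_in_residues by (simp, blast)
  have "cmod A ^ (2 * d) * K \<le> 2 * real d ^ (d + 1)"
  proof (cases "R dvd W")
    case True
    define g :: "'a poly \<Rightarrow> complex" where "g y = (if R dvd poly (pderiv G) y then 1 else 0)" for y
    have "average (residues R) (\<lambda>v. f (y + W * v)) = f y * g y" for y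
    proof -
      have "f (y + W * v) = f y * eR (poly (pderiv G) y * v)" for v
      proof -
        obtain c where c: "poly G (y + W * v) = poly G y + W * v * poly (pderiv G) y + (W * v)\<^sup>2 * c"
          by (rule poly_taylor2)
        \<comment> \<open>As \<open>R\<close> divides \<open>W\<close>, the quadratic Taylor term is
          a multiple of \<open>R * W\<close> and drops out.\<close>
        have "R * W dvd W * W" using True by (simp add: mult_dvd_mono)
        then have "R * W dvd (W * v)\<^sup>2 * c"
          unfolding power2_eq_square by (metis dvd_mult2 mult.assoc mult.left_commute)
        then have "f (y + W * v) = e (poly G y + W * v * poly (pderiv G) y)"
          unfolding f_def by (intro primitive_char_eq[OF e]) (simp add: c)
        then show ?thesis by (simp add: f_def eR_def add_char_add[OF add] mult_ac)
      qed
      then show ?thesis by (simp add: average_mult_right R.average_e_scale g_def)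
    qed
    then have A: "A = average (residues Q) (\<lambda>y. f y * g y)" using A by simp
    have "complex_of_real (average (residues Q) (\<lambda>y. cmod (g y))) = average (residues Q) g"
      by (simp add: average_def g_def if_distrib cong: if_cong)
    also have "\<dots> = average (residues R) g"
    proof (rule average_periodic_divisor[OF Q(1)])
      show "R dvd Q" using Q(2) dvd_mult_left by blast
      show "periodic_mod R g" unfolding g_def
        by (rule periodic_modI) (metis dvd_diff_poly dvd_diff_commute dvd_add_right_iff diff_add_cancel)
    qed
    also have "\<dots> = complex_of_real (real (card {y \<in> residues R. R dvd poly (pderiv G) y}) / K)"
      by (simp add: average_def g_def sum.inter_filter[symmetric] card_residues R0 K_def)
    finally have gK: "average (residues Q) (\<lambda>y. cmod (g y)) = real (card {y \<in> residues R. R dvd poly (pderiv G) y}) / K"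
      by (simp only: of_real_eq_iff)
    \<comment> \<open>Since \<open>s\<close> is prime to the characteristic, differentiation
      preserves a coefficient that \<open>R\<close> does not divide.\<close>
    have "\<not> R dvd coeff (pderiv G) (s - 1)"
    proof
      assume "R dvd coeff (pderiv G) (s - 1)"
      then have "R dvd of_nat s * coeff G s" using sI by (simp add: coeff_pderiv I_def)
      moreover have "is_unit (of_nat s :: 'a poly)" using sI by (intro is_unit_of_nat_poly) (simp add: I_def)
      ultimately show False using s by (simp add: dvd_mult_unit_iff')
    qed
    then have "card {y \<in> residues R. R dvd poly (pderiv G) y} \<le> degree (pderiv G)"
      using card_roots_mod_irreducible[OF R] by blast
    also have "\<dots> \<le> degree G" by (rule degree_le) (simp add: coeff_pderiv coeff_eq_0)
    also have "\<dots> \<le> d" by (rule G(1))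
    finally have roots: "card {y \<in> residues R. R dvd poly (pderiv G) y} \<le> d" .
    have "cmod A \<le> average (residues Q) (\<lambda>y. cmod (f y * g y))"
      unfolding A by (rule norm_average_le)
    also have "\<dots> = average (residues Q) (\<lambda>y. cmod (g y))"
      by (simp add: norm_mult f_def add_char_norm[OF add])
    also have "\<dots> \<le> real d / K"
      unfolding gK using roots K by (intro divide_right_mono) auto
    finally have "cmod A \<le> real d / K" .
    moreover have "cmod A \<le> 1"
      unfolding A_def f_def by (rule norm_average_le_bound[OF Qres]) (simp add: add_char_norm[OF add])
    \<comment> \<open>This case gives the full saving \<open>1 / K\<close>; it is weakened to match
      the exponent \<open>2 * d\<close> of the other case.\<close>
    moreover have "cmod A ^ (2 * d) \<le> cmod A ^ 1"
      using d \<open>cmod A \<le> 1\<close> by (intro power_decreasing) auto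
    ultimately have "cmod A ^ (2 * d) \<le> real d / K" by simp
    then have "cmod A ^ (2 * d) * K \<le> real d" using K by (simp add: field_simps)
    also have "\<dots> \<le> 2 * real d ^ (d + 1)"
    proof -
      have "real d * 1 \<le> real d * real d ^ d" using d by (intro mult_left_mono one_le_power) auto
      then show ?thesis by simp
    qed
    finally show ?thesis .
  next
    case False
    obtain u w where uw: "R * u + W * w = 1" using irreducible_poly_bezout[OF R False] .
    \<comment> \<open>One factor of \<open>W ^ r\<close> is absorbed by \<open>eR\<close>, hence the
      exponent \<open>r - 1\<close>.\<close>
    define \<beta> where "\<beta> r = coeff G r * W ^ (r - 1)" for r
    define g where "g v = f (W * v)" for v
    have G0: "poly G 0 = 0" using coeff_0[of 0] by (simp add: I_def poly_0_coeff_0)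
    \<comment> \<open>Modulo \<open>R\<close>, and likewise modulo \<open>W\<close>, one of the two
      summands vanishes; as \<open>G\<close> has no constant term, the phase is additive modulo
      \<open>R * W\<close>.\<close>
    have split: "f (R * a + W * b) = f (R * a) * f (W * b)" for a b
    proof -
      let ?x = "poly G (R * a + W * b) - (poly G (R * a) + poly G (W * b))"
      have "R dvd (poly G (R * a + W * b) - poly G (W * b)) - (poly G (R * a) - poly G 0)"
        by (rule dvd_diff, (rule dvd_diff_poly, simp)+)
      then have 1: "R dvd ?x" by (simp add: G0 algebra_simps)
      have "W dvd (poly G (R * a + W * b) - poly G (R * a)) - (poly G (W * b) - poly G 0)"
        by (rule dvd_diff, (rule dvd_diff_poly, simp)+)
      then have 2: "W dvd ?x" by (simp add: G0 algebra_simps)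
      from mult_dvd_of_bezout[OF uw 1 2] show ?thesis
        by (simp add: f_def add_char_add[OF add, symmetric] primitive_char_eq[OF e])
    qed
    have g_per: "periodic_mod R g"
      unfolding g_def
    proof (rule periodic_modI)
      fix x y assume "R dvd x - y"
      then have "R * W dvd W * x - W * y" by (simp add: right_diff_distrib[symmetric] mult.commute)
      then show "f (W * x) = f (W * y)" by (rule periodic_modD[OF f_per])
    qed
    \<comment> \<open>The Bezout relation writes \<open>y\<close> as
      \<open>R * (u * y) + W * (w * y)\<close>: the first part contributes a unimodular factor, the
      second only shifts \<open>v\<close>.\<close>
    have inner: "cmod (average (residues R) (\<lambda>v. f (y + W * v))) = cmod (average (residues R) g)" for y
    proof -
      have "(R * u + W * w) * y + W * v = R * (u * y) + W * (v + w * y)" for v by (simp add: algebra_simps)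
      then have "y + W * v = R * (u * y) + W * (v + w * y)" for v by (simp only: uw mult_1_left)
      then have "average (residues R) (\<lambda>v. f (y + W * v)) = f (R * (u * y)) * average (residues R) (\<lambda>v. g (v + w * y))"
        by (simp add: split average_mult_right g_def)
      also have "\<dots> = f (R * (u * y)) * average (residues R) g"
        by (simp add: average_translate[OF R0 g_per])
      finally show ?thesis by (simp add: norm_mult f_def add_char_norm[OF add])
    qed
    have "cmod A \<le> cmod (average (residues R) g)"
      unfolding A by (rule norm_average_le_bound[OF Qres]) (simp add: inner)
    also have g: "g v = eR (\<Sum>r\<in>I. \<beta> r * v ^ r)" for v
    proof -
      have "poly G (W * v) = (\<Sum>r\<le>degree G. coeff G r * (W * v) ^ r)" by (rule poly_altdef)
      also have "\<dots> = (\<Sum>r\<in>I. coeff G r * (W * v) ^ r)"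
        by (rule sum.mono_neutral_cong) (auto simp: I_def coeff_eq_0 coeff_0 not_le)
      also have "\<dots> = (\<Sum>r\<in>I. W * (\<beta> r * v ^ r))"
      proof (rule sum.cong[OF refl])
        fix r assume "r \<in> I"
        then have "W ^ r = W * W ^ (r - 1)" by (simp add: I_def power_eq_if)
        then show "coeff G r * (W * v) ^ r = W * (\<beta> r * v ^ r)"
          by (simp add: \<beta>_def power_mult_distrib mult_ac)
      qed
      finally show ?thesis by (simp add: g_def f_def eR_def sum_distrib_left)
    qed
    then have "cmod (average (residues R) g) = cmod (R.exp_sum I \<beta>) / K"
      by (simp add: average_def R.exp_sum_def card_residues R0 norm_divide K_def)
    finally have AK: "cmod A \<le> cmod (R.exp_sum I \<beta>) / K" .
    have \<beta>s: "\<not> R dvd \<beta> s"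
    proof -
      have "\<not> R dvd W ^ n" for n
      proof (induction n)
        case 0
        then show ?case using R by (simp add: irreducible_def)
      next
        case (Suc n)
        then show ?case using irreducible_poly_dvd_mult[OF R False, of "W ^ n"] by (metis power_Suc)
      qed
      then show ?thesis using irreducible_poly_dvd_mult[OF R s, of "W ^ (s - 1)"] unfolding \<beta>_def by blast
    qed
    from R.exp_sum_irreducible_bound[of d I s \<beta>, OF R d I_def sI \<beta>s]
    have *: "cmod (R.exp_sum I \<beta>) ^ (2 * d) * (K - 1) \<le> real d ^ (d + 1) * K ^ (2 * d)"
      by (simp add: K_def)
    \<comment> \<open>The factor 2 of the final bound arises here, from
      \<open>K \<le> 2 * (K - 1)\<close> for \<open>K \<ge> 2\<close>.\<close>
    have "cmod A ^ (2 * d) * K \<le> (cmod (R.exp_sum I \<beta>) / K) ^ (2 * d) * (2 * (K - 1))"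
      using AK K by (intro mult_mono power_mono) auto
    also have "\<dots> = 2 * (cmod (R.exp_sum I \<beta>) ^ (2 * d) * (K - 1)) / K ^ (2 * d)"
      by (simp add: power_divide)
    also have "\<dots> \<le> 2 * (real d ^ (d + 1) * K ^ (2 * d)) / K ^ (2 * d)"
      using K * by (intro divide_right_mono mult_left_mono) auto
    also have "\<dots> = 2 * real d ^ (d + 1)" using K by simp
    finally show ?thesis .
  qed
  then show ?thesis by (simp add: A_def f_def[abs_def] K_def)
qed

text \<open>The ideal annihilating all coefficients of the phase is generated by a divisor \<open>Q'\<close> of \<open>Q\<close>, so
  the phase is primitive modulo \<open>Q'\<close>.\<close>
lemma exp_average_bound:
  fixes Q :: "'a::{field,finite} poly" and G :: "'a poly poly"
  assumes Q: "0 < degree Q" and e: "primitive_char Q e"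
    and G: "degree G \<le> d" "\<And>r. CHAR('a) dvd r \<Longrightarrow> coeff G r = 0" and s: "\<not> Q dvd coeff G s"
  shows "cmod (average (residues Q) (\<lambda>y. e (poly G y))) ^ (2 * d) * real (lpf Q) \<le> 2 * real d ^ (d + 1)"
proof -
  have Q0: "Q \<noteq> 0" using Q by auto
  define J where "J = {g. \<forall>r. Q dvd g * coeff G r}"
  obtain Q' where Q': "lead_coeff Q' = 1" "\<And>x. x \<in> J \<longleftrightarrow> Q' dvd x"
  proof (rule poly_ideal_principal[of J Q])
    show "x + y \<in> J" if "x \<in> J" "y \<in> J" for x y using that by (auto simp: J_def distrib_right)
    show "z * x \<in> J" if "x \<in> J" for x z using that by (auto simp: J_def mult.assoc)
  qed (use Q0 in \<open>auto simp: J_def\<close>)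
  have Q'0: "Q' \<noteq> 0" using Q'(1) by auto
  have "1 \<notin> J" using s by (auto simp: J_def)
  then have "\<not> is_unit Q'" using Q'(2) by blast
  then have "0 < degree Q'" using Q'0 by (simp add: is_unit_iff_degree)
  then obtain R where R: "lead_coeff R = 1" "irreducible R" "R dvd Q'"
    using poly_irreducible_divisor_exists by blast
  then obtain W where W: "Q' = R * W" by (auto elim: dvdE)
  have "Q \<in> J" by (simp add: J_def)
  then obtain h where h: "Q = h * Q'" using Q'(2) by (metis dvdE mult.commute)
  have h0: "h \<noteq> 0" using h Q0 by auto
  have "h dvd coeff G r" for r
  proof -
    have "Q dvd Q' * coeff G r" using Q'(2)[of Q'] by (simp add: J_def)
    then have "h * Q' dvd coeff G r * Q'" unfolding h by (simp only: mult.commute[of Q' "coeff G r"])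
    then show ?thesis using Q'0 by (simp only: dvd_mult_cancel_right) simp
  qed
  then have "[:h:] dvd G" by (simp add: const_poly_dvd_iff)
  then obtain G' where "G = [:h:] * G'" by (elim dvdE)
  then have G': "G = smult h G'" by simp
  have e': "primitive_char (R * W) (\<lambda>x. e (h * x))"
    using primitive_char_cofactor[of h Q' e] e h h0 W by simp
  \<comment> \<open>If \<open>R\<close> divided all coefficients of \<open>G'\<close>, then already
    \<open>W\<close> would annihilate those of \<open>G\<close> modulo \<open>Q\<close>, although
    the generator \<open>Q' = R * W\<close> does not divide \<open>W\<close>.\<close>
  have "\<exists>s. \<not> R dvd coeff G' s"
  proof (rule ccontr)
    assume "\<not> ?thesis"
    then have "Q dvd W * coeff G r" for r
      by (simp add: h W G')
    then have "Q' dvd W" using Q'(2)[of W] by (simp add: J_def)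
    then have "R * W dvd 1 * W" using W by simp
    then have "R dvd 1" using W Q'0 by (metis dvd_mult_cancel_right mult_eq_0_iff)
    then show False using R(2) by (simp add: irreducible_def)
  qed
  then obtain s' where s': "\<not> R dvd coeff G' s'" by blast
  have "degree G' \<le> d" using G(1) h0 by (simp add: G')
  moreover have "coeff G' r = 0" if "CHAR('a) dvd r" for r using G(2)[OF that] h0 by (simp add: G')
  moreover have "R * W dvd Q" using h W by simp
  ultimately have "cmod (average (residues Q) (\<lambda>y. e (h * poly G' y))) ^ (2 * d) * real (poly_norm R) \<le> 2 * real d ^ (d + 1)"
    by (intro exp_average_bound_primitive[OF Q0 _ R(2) e' _ _ s'])
  moreover have "lpf Q \<le> poly_norm R"
    using R h by (intro lpf_le Q0) auto
  then have "cmod (average (residues Q) (\<lambda>y. e (poly G y))) ^ (2 * d) * real (lpf Q) \<le>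
      cmod (average (residues Q) (\<lambda>y. e (poly G y))) ^ (2 * d) * real (poly_norm R)"
    by (intro mult_left_mono) auto
  ultimately show ?thesis by (simp add: G')
qed

lemma l2_norm_scale: "l2_norm S (\<lambda>x. c * f x) = cmod c * l2_norm S f"
  by (simp add: l2_norm_def norm_mult power_mult_distrib average_mult_right real_sqrt_mult)

lemma l2_norm_nonneg: "0 \<le> l2_norm S f"
  by (simp add: l2_norm_def average_def sum_nonneg)

section \<open>Linearised phases\<close>

context primitive_char_mod
begin

text \<open>Since \<open>z \<mapsto> z ^ CHAR('a)\<close> is additive, \<open>z \<mapsto> e (c * z ^ CHAR('a))\<close> is again a character modulo
  \<open>Q\<close>, which removes factors of the characteristic from the exponents.\<close>
lemma monomial_phase:
  assumes "0 < i"
  obtains b r where "0 < r" "r \<le> i" "\<not> CHAR('a) dvd r" "\<And>y. e (c * y ^ i) = e (b * y ^ r)"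
  using assms
proof (induction i arbitrary: c thesis rule: less_induct)
  case (less i)
  show ?case
  proof (cases "CHAR('a) dvd i")
    case False
    then show ?thesis using less.prems by blast
  next
    case True
    define p where "p = CHAR('a)"
    have p: "prime p" unfolding p_def by (rule prime_CHAR_finite_field)
    then have pp: "prime CHAR('a poly)" by (simp add: p_def)
    obtain j where "i = p * j" using True unfolding p_def by (elim dvdE)
    then have j: "i = j * p" by simp
    have "1 < p" using p by (rule prime_gt_1_nat)
    then have j0: "0 < j" "j < i" using j less.prems(2) by (auto intro: Nat.gr0I)
    \<comment> \<open>Frobenius is additive, and every character modulo \<open>Q\<close> has the
      form \<open>e (b * z)\<close>; the new coefficient \<open>b\<close> comes from this duality
      and is not explicit.\<close>
    have "add_char (\<lambda>z. e (c * z ^ p))"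
      using freshmans_dream[OF pp] add_char_e by (simp add: add_char_def p_def distrib_left)
    moreover have "periodic_mod Q (\<lambda>z. e (c * z ^ p))"
      by (intro periodic_modI primitive_char_eq[OF primitive] dvd_diff_mult dvd_diff_power) auto
    ultimately obtain b where b: "\<And>z. e (c * z ^ p) = e (b * z)"
      by (rule add_char_eq_scale) blast
    obtain b' r where "0 < r" "r \<le> j" "\<not> CHAR('a) dvd r" "\<And>y. e (b * y ^ j) = e (b' * y ^ r)"
      using less.IH[OF j0(2) _ j0(1), of b] by blast
    moreover from this have "e (c * y ^ i) = e (b' * y ^ r)" for y
      using b[of "y ^ j"] by (simp add: j power_mult)
    ultimately show ?thesis using less.prems(1)[of r b'] j0 by simp
  qed
qed

text \<open>Monomials are treated one by one; several may land on the same exponent and even cancel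
  modulo \<open>Q\<close>. The constant term of \<open>P\<close> is removed beforehand, since its
  exponent 0 is divisible by the characteristic.\<close>

lemma poly_phase_linearised:
  obtains G where "degree G \<le> degree P" "\<And>r. CHAR('a) dvd r \<Longrightarrow> coeff G r = 0"
    "\<And>y. e (a * (poly P y - poly P 0)) = e (poly G y)"
proof -
  have "\<exists>b r. 0 < r \<and> r \<le> i \<and> \<not> CHAR('a) dvd r \<and> (\<forall>y. e (a * coeff P i * y ^ i) = e (b * y ^ r))"
    if "0 < i" for i
    using monomial_phase[OF that, of "a * coeff P i"] by metis
  then obtain b r where br: "\<And>i. 0 < i \<Longrightarrow> 0 < r i \<and> r i \<le> i \<and> \<not> CHAR('a) dvd r i \<and>
      (\<forall>y. e (a * coeff P i * y ^ i) = e (b i * y ^ r i))"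
    by metis
  define G where "G = (\<Sum>i\<in>{1..degree P}. monom (b i) (r i))"
  have "degree G \<le> degree P"
    unfolding G_def
  proof (rule degree_sum_le)
    fix i assume i: "i \<in> {1..degree P}"
    have "degree (monom (b i) (r i)) \<le> r i" by (rule degree_monom_le)
    also have "\<dots> \<le> degree P" using br[of i] i by auto
    finally show "degree (monom (b i) (r i)) \<le> degree P" .
  qed simp
  moreover have "coeff G s = 0" if "CHAR('a) dvd s" for s
    unfolding G_def coeff_sum using br that by (intro sum.neutral) auto
  moreover have "e (a * (poly P y - poly P 0)) = e (poly G y)" for y
  proof -
    have "{..degree P} = insert 0 {1..degree P}" by auto
    then have "poly P y - poly P 0 = (\<Sum>i\<in>{1..degree P}. coeff P i * y ^ i)"
      by (simp add: poly_altdef[of P] poly_0_coeff_0)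
    then have "e (a * (poly P y - poly P 0)) = (\<Prod>i\<in>{1..degree P}. e (a * coeff P i * y ^ i))"
      by (simp only: sum_distrib_left add_char_sum[OF add_char_e] mult.assoc)
    also have "\<dots> = (\<Prod>i\<in>{1..degree P}. e (b i * y ^ r i))"
      using br by (intro prod.cong) auto
    also have "\<dots> = e (poly G y)"
      by (simp add: G_def poly_sum poly_monom add_char_sum[OF add_char_e])
    finally show ?thesis .
  qed
  ultimately show thesis by (rule that)
qed

lemma value_subgroup_annihilated:
  assumes "\<And>y. e (a * (poly P y - poly P 0)) = 1" "h \<in> value_subgroup P"
  shows "e (a * h) = 1"
  using assms(2) unfolding value_subgroup_def
proof (induction rule: group_closure.induct)
  case (base s)
  then show ?case using assms(1) add_char_0[OF add_char_e] by auto
next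
  case (diff s t)
  then show ?case by (simp add: right_diff_distrib add_char_diff[OF add_char_e])
qed

text \<open>If \<open>Q\<close> divided all coefficients of \<open>G\<close>, then
  \<open>e (a * x)\<close> would be 1 on the value subgroup and on the multiples of
  \<open>Q\<close>, hence for every \<open>x\<close> by the covering assumption, against
  primitivity.\<close>

lemma average_poly_phase_bound:
  assumes deg: "0 < degree Q"
    and covers: "{h + Q * r |h r. h \<in> value_subgroup P} = UNIV" and a: "\<not> Q dvd a"
  shows "cmod (average (residues Q) (\<lambda>y. e (a * poly P y))) ^ (2 * degree P) * real (lpf Q)
    \<le> 2 * real (degree P) ^ (degree P + 1)"
proof -
  obtain G where G: "degree G \<le> degree P" "\<And>r. CHAR('a) dvd r \<Longrightarrow> coeff G r = 0"
    "\<And>y. e (a * (poly P y - poly P 0)) = e (poly G y)"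
    using poly_phase_linearised[of P a] by blast
  have "\<exists>s. \<not> Q dvd coeff G s"
  proof (rule ccontr)
    assume "\<not> ?thesis"
    then have "Q dvd poly G y" for y unfolding poly_altdef by (intro dvd_sum dvd_mult2) auto
    then have triv: "e (a * (poly P y - poly P 0)) = 1" for y
      using G(3) primitive_char_dvd[OF primitive] by simp
    have "e (a * x) = 1" for x
    proof -
      have "x \<in> {h + Q * r |h r. h \<in> value_subgroup P}" using covers by blast
      then obtain h r where hr: "h \<in> value_subgroup P" "x = h + Q * r" by blast
      have "e (a * x) = e (a * h)"
        using hr(2) by (intro primitive_char_eq[OF primitive]) (simp add: algebra_simps)
      then show ?thesis using value_subgroup_annihilated[OF triv hr(1)] by simp
    qed
    then show False using a primitive_char_nontrivial[OF primitive] by blast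
  qed
  then obtain s where s: "\<not> Q dvd coeff G s" by blast
  have eq: "e (a * poly P y) = e (a * poly P 0) * e (poly G y)" for y
  proof -
    have "a * poly P y = a * poly P 0 + a * (poly P y - poly P 0)" by (simp add: algebra_simps)
    then show ?thesis by (simp only: add_char_add[OF add_char_e] G(3))
  qed
  have "average (residues Q) (\<lambda>y. e (a * poly P y)) = average (residues Q) (\<lambda>y. e (a * poly P 0) * e (poly G y))"
    by (intro average_cong eq)
  then have "cmod (average (residues Q) (\<lambda>y. e (a * poly P y))) = cmod (average (residues Q) (\<lambda>y. e (poly G y)))"
    by (simp add: average_mult_right norm_mult add_char_norm[OF add_char_e])
  then show ?thesis using exp_average_bound[OF deg primitive G(1,2) s] by simp
qed

section \<open>The averaging operator\<close>

definition avg_dev :: "'a poly poly \<Rightarrow> ('a poly \<Rightarrow> complex) \<Rightarrow> 'a poly \<Rightarrow> complex" where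
  "avg_dev P f x = average (residues Q) (\<lambda>y. f ((x + poly P y) mod Q)) - average (residues Q) f"

lemma avg_dev_fourier:
  assumes "x \<in> residues Q"
  shows "avg_dev P f x = (\<Sum>a\<in>residues Q.
    (if a = 0 then 0 else fourier f a * average (residues Q) (\<lambda>y. e (a * poly P y))) * e (a * x))"
proof -
  let ?m = "\<lambda>a. average (residues Q) (\<lambda>y. e (a * poly P y))"
  have "average (residues Q) (\<lambda>y. f ((x + poly P y) mod Q)) =
      average (residues Q) (\<lambda>y. \<Sum>a\<in>residues Q. fourier f a * e (a * x) * e (a * poly P y))"
  proof (rule average_cong)
    fix y
    have "f ((x + poly P y) mod Q) = (\<Sum>a\<in>residues Q. fourier f a * e (a * ((x + poly P y) mod Q)))"
      by (rule fourier_inversion[symmetric]) simp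
    also have "\<dots> = (\<Sum>a\<in>residues Q. fourier f a * e (a * (x + poly P y)))"
      by (simp add: periodic_mod_mod[OF periodic_e_scale(1)])
    finally show "f ((x + poly P y) mod Q) = (\<Sum>a\<in>residues Q. fourier f a * e (a * x) * e (a * poly P y))"
      by (simp add: distrib_left add_char_add[OF add_char_e] mult.assoc)
  qed
  also have "\<dots> = (\<Sum>a\<in>residues Q. fourier f a * e (a * x) * ?m a)"
    by (simp add: average_sum average_mult_right)
  also have "\<dots> = fourier f 0 + (\<Sum>a\<in>residues Q - {0}. fourier f a * e (a * x) * ?m a)"
    by (subst sum.remove[of _ 0]) (simp_all add: add_char_0[OF add_char_e] average_const)
  also have "fourier f 0 = average (residues Q) f" by (simp add: fourier_def add_char_0[OF add_char_e])
  finally have "avg_dev P f x = (\<Sum>a\<in>residues Q - {0}. fourier f a * e (a * x) * ?m a)"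
    by (simp add: avg_dev_def)
  also have "\<dots> = (\<Sum>a\<in>residues Q. (if a = 0 then 0 else fourier f a * ?m a) * e (a * x))"
    by (rule sum.mono_neutral_cong_left) (auto simp: mult_ac)
  finally show ?thesis .
qed

lemma l2_norm_avg_dev_le:
  assumes "0 \<le> \<eta>" and \<eta>: "\<And>a. \<not> Q dvd a \<Longrightarrow> cmod (average (residues Q) (\<lambda>y. e (a * poly P y))) \<le> \<eta>"
  shows "l2_norm (residues Q) (avg_dev P f) \<le> \<eta> * l2_norm (residues Q) f"
proof -
  let ?c = "\<lambda>a. if a = 0 then 0 else fourier f a * average (residues Q) (\<lambda>y. e (a * poly P y))"
  have "average (residues Q) (\<lambda>x. (cmod (avg_dev P f x))\<^sup>2) = (\<Sum>a\<in>residues Q. (cmod (?c a))\<^sup>2)"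
    unfolding parseval[symmetric] by (intro average_cong) (simp add: avg_dev_fourier)
  also have "\<dots> \<le> (\<Sum>a\<in>residues Q. \<eta>\<^sup>2 * (cmod (fourier f a))\<^sup>2)"
  proof (rule sum_mono)
    fix a assume a: "a \<in> residues Q"
    have "cmod (?c a) \<le> \<eta> * cmod (fourier f a)"
    proof (cases "a = 0")
      case False
      then have "\<not> Q dvd a" using residues_eq_iff_dvd[OF a zero_in_residues] by simp
      then have "cmod (fourier f a) * cmod (average (residues Q) (\<lambda>y. e (a * poly P y))) \<le> cmod (fourier f a) * \<eta>"
        by (intro mult_left_mono \<eta>) auto
      with False show ?thesis by (simp add: norm_mult mult.commute)
    qed (use assms(1) in simp)
    then show "(cmod (?c a))\<^sup>2 \<le> \<eta>\<^sup>2 * (cmod (fourier f a))\<^sup>2"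
      unfolding power_mult_distrib[symmetric] by (intro power_mono) auto
  qed
  also have "\<dots> = \<eta>\<^sup>2 * average (residues Q) (\<lambda>x. (cmod (f x))\<^sup>2)"
    by (simp only: sum_distrib_left[symmetric] plancherel)
  finally have "l2_norm (residues Q) (avg_dev P f) \<le> sqrt (\<eta>\<^sup>2 * average (residues Q) (\<lambda>x. (cmod (f x))\<^sup>2))"
    unfolding l2_norm_def by (rule real_sqrt_le_mono)
  then show ?thesis using assms(1) by (simp add: l2_norm_def real_sqrt_mult)
qed

text \<open>This trivial contraction bound makes the set inside the supremum bounded above.\<close>

lemma l2_norm_avg_dev_le_1: "l2_norm (residues Q) (avg_dev P f) \<le> l2_norm (residues Q) f"
  using l2_norm_avg_dev_le[of 1 P f] norm_average_le_bound[of "residues Q" _ 1]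
  by (simp add: add_char_norm[OF add_char_e])

lemma deviation_altdef:
  "deviation P Q = (SUP f\<in>{f. l2_norm (residues Q) f = 1}. l2_norm (residues Q) (avg_dev P f))"
  unfolding deviation_def avg_dev_def by (rule arg_cong[of _ _ Sup]) auto

lemma deviation_le:
  assumes "\<And>f. l2_norm (residues Q) (avg_dev P f) \<le> \<eta> * l2_norm (residues Q) f"
  shows "deviation P Q \<le> \<eta>"
proof -
  \<comment> \<open>A function of norm 1, so the supremum is over a nonempty set.\<close>
  have "l2_norm (residues Q) (\<lambda>_. 1) = 1" by (simp add: l2_norm_def average_const)
  then have "{f. l2_norm (residues Q) f = 1} \<noteq> {}" by blast
  then show ?thesis unfolding deviation_altdef
    by (rule cSUP_least) (use assms in \<open>metis mem_Collect_eq mult.right_neutral\<close>)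
qed

lemma avg_dev_scale: "avg_dev P (\<lambda>x. c * f x) = (\<lambda>x. c * avg_dev P f x)"
  by (rule ext) (simp add: avg_dev_def average_mult_right right_diff_distrib)

text \<open>The supremum runs over functions of norm 1; homogeneity extends it to the others, and
  norm 0 is settled by the contraction bound.\<close>

lemma l2_norm_avg_dev_le_deviation:
  "l2_norm (residues Q) (avg_dev P f) \<le> deviation P Q * l2_norm (residues Q) f"
proof (cases "l2_norm (residues Q) f = 0")
  case True
  then show ?thesis using l2_norm_avg_dev_le_1[of P f] by simp
next
  case False
  define N where "N = l2_norm (residues Q) f"
  have N: "0 < N" using False l2_norm_nonneg[of "residues Q" f] by (simp add: N_def)
  define g where "g x = complex_of_real (1 / N) * f x" for x
  have "cmod (complex_of_real (1 / N)) = 1 / N" using N by (simp only: norm_of_real) simp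
  then have g: "l2_norm (residues Q) g = 1" "l2_norm (residues Q) (avg_dev P g) = l2_norm (residues Q) (avg_dev P f) / N"
    unfolding g_def[abs_def] avg_dev_scale l2_norm_scale using N by (simp_all add: N_def)
  have "l2_norm (residues Q) (avg_dev P g) \<le> deviation P Q"
    unfolding deviation_altdef
  proof (rule cSUP_upper)
    show "bdd_above ((\<lambda>f. l2_norm (residues Q) (avg_dev P f)) ` {f. l2_norm (residues Q) f = 1})"
      by (rule bdd_aboveI2[of _ _ 1]) (use l2_norm_avg_dev_le_1[of P] in \<open>metis mem_Collect_eq\<close>)
  qed (use g in simp)
  then show ?thesis using N by (simp add: g(2) field_simps N_def)
qed

text \<open>The count minus its expected value is \<open>poly_norm Q\<close> times the sum over
  \<open>A\<close> of the deviation of the indicator of \<open>B\<close>. Cauchy-Schwarz on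
  \<open>A\<close> and the operator bound finish; the two normalisations of the norms cancel each
  other.\<close>

lemma pair_count_bound:
  assumes A: "A \<subseteq> residues Q" and B: "B \<subseteq> residues Q" and "0 \<le> \<eta>"
    and \<eta>: "\<And>f. l2_norm (residues Q) (avg_dev P f) \<le> \<eta> * l2_norm (residues Q) f"
  shows "\<bar>real (card {(x, y). x \<in> residues Q \<and> y \<in> residues Q \<and> x \<in> A \<and> (x + poly P y) mod Q \<in> B})
      - real (card A) * real (card B)\<bar>
    \<le> \<eta> * sqrt (real (card A)) * sqrt (real (card B)) * real (poly_norm Q)" (is "\<bar>real (card ?C) - _\<bar> \<le> _")
proof -
  define K where "K = real (poly_norm Q)"
  have K: "0 < K" by (simp add: K_def)
  define f :: "'a poly \<Rightarrow> complex" where "f x = (if x \<in> B then 1 else 0)" for x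
  define F where "F x = cmod (avg_dev P f x)" for x
  have finA: "finite A" and finB: "finite B" using A B finite_subset[OF _ finite_res] by auto
  have sumB: "(\<Sum>x\<in>residues Q. if x \<in> B then 1 else 0 :: 'c::comm_semiring_1) = of_nat (card B)"
    using B by (simp add: sum.inter_restrict[symmetric] Int_absorb1)
  have "?C = (SIGMA x:A. {y \<in> residues Q. (x + poly P y) mod Q \<in> B})" using A by auto
  then have "real (card ?C) = (\<Sum>x\<in>A. real (card {y \<in> residues Q. (x + poly P y) mod Q \<in> B}))"
    using finA by (simp add: card_SigmaI)
  moreover have "complex_of_real (real (card {y \<in> residues Q. (x + poly P y) mod Q \<in> B})) =
      of_real K * avg_dev P f x + of_nat (card B)" for x
  proof -
    have "avg_dev P f x = of_nat (card {y \<in> residues Q. (x + poly P y) mod Q \<in> B}) / of_real K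
        - of_nat (card B) / of_real K"
      by (simp add: avg_dev_def average_def f_def sumB sum.inter_filter[symmetric] card_residues K_def)
    then show ?thesis using K by (simp add: field_simps)
  qed
  ultimately have "complex_of_real (real (card ?C)) = (\<Sum>x\<in>A. of_real K * avg_dev P f x + of_nat (card B))"
    by simp
  then have eq: "complex_of_real (real (card ?C) - real (card A) * real (card B)) = of_real K * (\<Sum>x\<in>A. avg_dev P f x)"
    by (simp add: sum.distrib sum_distrib_left)
  have "\<bar>real (card ?C) - real (card A) * real (card B)\<bar> = cmod (of_real K * (\<Sum>x\<in>A. avg_dev P f x))"
    unfolding eq[symmetric] by (simp only: norm_of_real)
  also have "\<dots> \<le> K * (\<Sum>x\<in>A. F x)"
    using K norm_sum[of "avg_dev P f" A] by (simp add: norm_mult F_def)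
  also have "(\<Sum>x\<in>A. F x) \<le> sqrt (real (card A)) * (\<eta> * sqrt (real (card B)))"
  proof -
    have "(\<Sum>x\<in>A. 1 * F x)\<^sup>2 \<le> (\<Sum>x\<in>A. 1\<^sup>2) * (\<Sum>x\<in>A. (F x)\<^sup>2)"
      by (rule Cauchy_Schwarz_ineq_sum)
    also have "(\<Sum>x\<in>A. (F x)\<^sup>2) \<le> (\<Sum>x\<in>residues Q. (F x)\<^sup>2)"
      using A by (intro sum_mono2) auto
    also have "\<dots> = K * (l2_norm (residues Q) (avg_dev P f))\<^sup>2"
      using K by (simp add: l2_norm_def average_def F_def sum_nonneg card_residues K_def)
    also have "\<dots> \<le> K * (\<eta> * l2_norm (residues Q) f)\<^sup>2"
      using K \<eta>[of f] l2_norm_nonneg by (intro mult_left_mono power_mono) auto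
    also have "(l2_norm (residues Q) f)\<^sup>2 = real (card B) / K"
    proof -
      have "(\<lambda>x. (cmod (f x))\<^sup>2) = (\<lambda>x. if x \<in> B then 1 else 0)" by (auto simp: f_def)
      then show ?thesis by (simp add: l2_norm_def average_def sumB card_residues K_def)
    qed
    then have "K * (\<eta> * l2_norm (residues Q) f)\<^sup>2 = \<eta>\<^sup>2 * real (card B)"
      using K by (simp add: power_mult_distrib)
    finally have "(\<Sum>x\<in>A. F x)\<^sup>2 \<le> real (card A) * (\<eta>\<^sup>2 * real (card B))"
      by (simp add: mult_left_mono)
    also have "\<dots> = (sqrt (real (card A)) * (\<eta> * sqrt (real (card B))))\<^sup>2"
      by (simp add: power_mult_distrib)
    finally show ?thesis by (rule power2_le_imp_le) (use assms(3) in simp)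
  qed
  finally show ?thesis using K by (simp add: K_def mult_ac)
qed

end

section \<open>Equivalence of the conditions\<close>

lemma primitive_char_mod_exists:
  fixes Q :: "'a::{field,finite} poly"
  assumes "0 < degree Q"
  obtains e where "primitive_char_mod Q e"
proof -
  obtain e where "primitive_char Q e" using primitive_char_exists[OF assms] .
  moreover have "Q \<noteq> 0" using assms by auto
  ultimately have "primitive_char_mod Q e" by unfold_locales
  then show thesis by (rule that)
qed

lemma le_powr_of_power_mult_le:
  fixes m l C :: real
  assumes "m ^ k * l \<le> C" "0 < k" "0 < l" "0 \<le> m" "0 < C"
  shows "m \<le> C powr (1 / k) * l powr (- (1 / k))"
proof -
  have "m ^ k \<le> C / l" using assms by (simp add: field_simps)
  then have "(m ^ k) powr (1 / k) \<le> (C / l) powr (1 / k)"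
    using assms by (intro powr_mono2) auto
  moreover have "(m ^ k) powr (1 / k) = m"
  proof (cases "m = 0")
    case False
    then have "0 < m" using assms(4) by simp
    then have "(m ^ k) powr (1 / k) = (m powr k) powr (1 / k)" by (simp add: powr_realpow)
    also have "\<dots> = m" using \<open>0 < m\<close> assms(2) by (simp add: powr_powr)
    finally show ?thesis .
  qed (use assms(2) in simp)
  moreover have "(C / l) powr (1 / k) = C powr (1 / k) * l powr (- (1 / k))"
    using assms by (simp add: powr_divide powr_minus_divide)
  ultimately show ?thesis by simp
qed

text \<open>The \<open>2 * d\<close>-th root of the right-hand side of
  \<open>average_poly_phase_bound\<close> for degree \<open>d\<close>.\<close>

definition power_saving_const :: "nat \<Rightarrow> real" where
  "power_saving_const d = (2 * real d ^ (d + 1)) powr (1 / (2 * d))"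

lemma avg_dev_power_saving:
  fixes Q :: "'a::{field,finite} poly"
  assumes "0 < degree P" "primitive_char_mod Q e" "0 < degree Q"
    and "{h + Q * r |h r. h \<in> value_subgroup P} = UNIV"
  shows "l2_norm (residues Q) (primitive_char_mod.avg_dev Q P f) \<le>
    power_saving_const (degree P) * real (lpf Q) powr (- (1 / (2 * degree P))) * l2_norm (residues Q) f"
proof -
  interpret primitive_char_mod Q e by fact
  show ?thesis
  proof (rule l2_norm_avg_dev_le)
    fix a assume a: "\<not> Q dvd a"
    have "cmod (average (residues Q) (\<lambda>y. e (a * poly P y))) \<le>
      (2 * real (degree P) ^ (degree P + 1)) powr (1 / real (2 * degree P)) * real (lpf Q) powr (- (1 / real (2 * degree P)))"
      using assms(1) lpf_pos[OF assms(3)]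
      by (intro le_powr_of_power_mult_le average_poly_phase_bound[OF assms(3,4) a]) auto
    then show "cmod (average (residues Q) (\<lambda>y. e (a * poly P y))) \<le>
      power_saving_const (degree P) * real (lpf Q) powr (- (1 / (2 * degree P)))"
      by (simp add: power_saving_const_def)
  qed (simp add: power_saving_const_def)
qed

lemma power_saving_const_pos: "0 < d \<Longrightarrow> 0 < power_saving_const d"
  by (simp add: power_saving_const_def)

lemma covers_imp_deviation_power_saving:
  fixes P :: "'a::{field,finite} poly poly"
  assumes P: "0 < degree P" and "value_subgroup_covers P"
  shows "deviation_power_saving P"
proof -
  obtain C where C: "0 < C" "\<And>Q :: 'a poly. lead_coeff Q = 1 \<Longrightarrow> 0 < degree Q \<Longrightarrow> C \<le> real (lpf Q) \<Longrightarrow>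
      {h + Q * r |h r. h \<in> value_subgroup P} = UNIV"
    using assms(2) unfolding value_subgroup_covers_def by blast
  have "deviation P Q \<le> power_saving_const (degree P) * real (lpf Q) powr (- (1 / (2 * degree P)))"
    if Q: "lead_coeff Q = 1" "0 < degree Q" "C \<le> real (lpf Q)" for Q
  proof -
    obtain e where e: "primitive_char_mod Q e" using primitive_char_mod_exists[OF Q(2)] .
    show ?thesis
      by (rule primitive_char_mod.deviation_le[OF e avg_dev_power_saving[OF P e Q(2) C(2)[OF Q]]])
  qed
  moreover have "0 < 1 / real (2 * degree P)" using P by simp
  ultimately show ?thesis
    unfolding deviation_power_saving_def using C(1) power_saving_const_pos[OF P] by blast
qed

lemma covers_imp_pair_count_power_saving:
  fixes P :: "'a::{field,finite} poly poly"
  assumes P: "0 < degree P" and "value_subgroup_covers P"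
  shows "pair_count_power_saving P"
proof -
  obtain C where C: "0 < C" "\<And>Q :: 'a poly. lead_coeff Q = 1 \<Longrightarrow> 0 < degree Q \<Longrightarrow> C \<le> real (lpf Q) \<Longrightarrow>
      {h + Q * r |h r. h \<in> value_subgroup P} = UNIV"
    using assms(2) unfolding value_subgroup_covers_def by blast
  have "\<bar>real (card {(x, y). x \<in> residues Q \<and> y \<in> residues Q \<and> x \<in> A \<and> (x + poly P y) mod Q \<in> B})
      - real (card A) * real (card B)\<bar>
    \<le> power_saving_const (degree P) * sqrt (real (card A)) * sqrt (real (card B)) * real (poly_norm Q)
      * real (lpf Q) powr (- (1 / (2 * degree P)))"
    if Q: "lead_coeff Q = 1" "0 < degree Q" "C \<le> real (lpf Q)" and AB: "A \<subseteq> residues Q" "B \<subseteq> residues Q"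
    for Q A B
  proof -
    obtain e where e: "primitive_char_mod Q e" using primitive_char_mod_exists[OF Q(2)] .
    have "0 \<le> power_saving_const (degree P) * real (lpf Q) powr (- (1 / (2 * degree P)))"
      using power_saving_const_pos[OF P] by simp
    from primitive_char_mod.pair_count_bound[OF e AB this avg_dev_power_saving[OF P e Q(2) C(2)[OF Q]]]
    show ?thesis by (simp only: mult_ac)
  qed
  moreover have "0 < 1 / real (2 * degree P)" using P by simp
  ultimately show ?thesis
    unfolding pair_count_power_saving_def using C(1) power_saving_const_pos[OF P] by blast
qed

lemma powr_neg_le_of_large:
  fixes C \<gamma> \<epsilon> :: real
  assumes "0 < C" "0 < \<gamma>" "0 < \<epsilon>"
  obtains N where "0 < N" "\<And>l. N \<le> l \<Longrightarrow> C * l powr (- \<gamma>) \<le> \<epsilon>"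
proof -
  define N where "N = (C / \<epsilon>) powr (1 / \<gamma>)"
  have "0 < N" using assms by (simp add: N_def)
  moreover have "C * l powr (- \<gamma>) \<le> \<epsilon>" if "N \<le> l" for l
  proof -
    have "l powr (- \<gamma>) \<le> N powr (- \<gamma>)"
      using assms \<open>0 < N\<close> that by (intro powr_mono2') auto
    also have "\<dots> = \<epsilon> / C"
      using assms by (simp add: N_def powr_powr powr_minus)
    finally show ?thesis using assms by (simp add: field_simps)
  qed
  ultimately show thesis by (rule that)
qed

lemma deviation_power_saving_imp_vanishes:
  fixes P :: "'a::{field,finite} poly poly"
  assumes "deviation_power_saving P"
  shows "deviation_vanishes P"
  unfolding deviation_vanishes_def
proof (intro allI impI)
  fix \<epsilon> :: real assume "0 < \<epsilon>"
  obtain C1 C2 \<gamma> where C: "0 < C1" "0 < C2" "0 < \<gamma>"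
    "\<And>Q :: 'a poly. lead_coeff Q = 1 \<Longrightarrow> 0 < degree Q \<Longrightarrow> C1 \<le> real (lpf Q) \<Longrightarrow>
       deviation P Q \<le> C2 * real (lpf Q) powr (- \<gamma>)"
    using assms unfolding deviation_power_saving_def by blast
  obtain N where N: "\<And>l. N \<le> l \<Longrightarrow> C2 * l powr (- \<gamma>) \<le> \<epsilon>"
    using powr_neg_le_of_large[OF C(2,3) \<open>0 < \<epsilon>\<close>] by blast
  show "\<exists>N::real. \<forall>Q :: 'a poly. lead_coeff Q = 1 \<and> 0 < degree Q \<and> N \<le> real (lpf Q) \<longrightarrow> deviation P Q \<le> \<epsilon>"
  proof (intro exI[of _ "max C1 N"] allI impI)
    fix Q :: "'a poly" assume Q: "lead_coeff Q = 1 \<and> 0 < degree Q \<and> max C1 N \<le> real (lpf Q)"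
    then have "deviation P Q \<le> C2 * real (lpf Q) powr (- \<gamma>)" by (intro C(4)) auto
    also have "\<dots> \<le> \<epsilon>" using Q by (intro N) auto
    finally show "deviation P Q \<le> \<epsilon>" .
  qed
qed

lemma dense_pairs_connected_of_bound:
  fixes P :: "'a::{field,finite} poly poly"
  assumes "\<And>\<epsilon>. 0 < \<epsilon> \<Longrightarrow> \<exists>N>0. \<forall>(Q :: 'a poly) A B. lead_coeff Q = 1 \<and> 0 < degree Q \<and> N \<le> real (lpf Q) \<and>
      A \<subseteq> residues Q \<and> B \<subseteq> residues Q \<longrightarrow>
      \<bar>real (card {(x, y). x \<in> residues Q \<and> y \<in> residues Q \<and> x \<in> A \<and> (x + poly P y) mod Q \<in> B})
        - real (card A) * real (card B)\<bar>
      \<le> \<epsilon> * sqrt (real (card A)) * sqrt (real (card B)) * real (poly_norm Q)"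
  shows "dense_pairs_connected P"
  unfolding dense_pairs_connected_def
proof (intro allI impI)
  fix \<delta> :: real assume \<delta>: "0 < \<delta>"
  \<comment> \<open>If no pair were connected, the assumed bound would give
    \<open>s * s \<le> \<epsilon> * s * K\<close> with \<open>s\<close> the square root of the
    product of the sizes; half of \<open>sqrt \<delta>\<close> makes the right side at most
    \<open>s * s / 2\<close>.\<close>
  define \<epsilon> where "\<epsilon> = sqrt \<delta> / 2"
  have "0 < \<epsilon>" using \<delta> by (simp add: \<epsilon>_def)
  then obtain N where N: "0 < N" "\<And>(Q :: 'a poly) A B. lead_coeff Q = 1 \<Longrightarrow> 0 < degree Q \<Longrightarrow> N \<le> real (lpf Q) \<Longrightarrow>
      A \<subseteq> residues Q \<Longrightarrow> B \<subseteq> residues Q \<Longrightarrow>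
      \<bar>real (card {(x, y). x \<in> residues Q \<and> y \<in> residues Q \<and> x \<in> A \<and> (x + poly P y) mod Q \<in> B})
        - real (card A) * real (card B)\<bar>
      \<le> \<epsilon> * sqrt (real (card A)) * sqrt (real (card B)) * real (poly_norm Q)"
    using assms[of \<epsilon>] by blast
  show "\<exists>N::real. 0 < N \<and> (\<forall>(Q :: 'a poly) A B. lead_coeff Q = 1 \<and> 0 < degree Q \<and> N \<le> real (lpf Q) \<and>
      A \<subseteq> residues Q \<and> B \<subseteq> residues Q \<and> real (card A) * real (card B) \<ge> \<delta> * (real (poly_norm Q))\<^sup>2 \<longrightarrow>
      (\<exists>x\<in>residues Q. \<exists>y\<in>residues Q. x \<in> A \<and> (x + poly P y) mod Q \<in> B))"
  proof (intro exI[of _ N] conjI allI impI N(1))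
    fix Q :: "'a poly" and A B
    assume H: "lead_coeff Q = 1 \<and> 0 < degree Q \<and> N \<le> real (lpf Q) \<and>
      A \<subseteq> residues Q \<and> B \<subseteq> residues Q \<and> real (card A) * real (card B) \<ge> \<delta> * (real (poly_norm Q))\<^sup>2"
    define K where "K = real (poly_norm Q)"
    define s where "s = sqrt (real (card A) * real (card B))"
    have K: "0 < K" by (simp add: K_def)
    have "sqrt (\<delta> * K\<^sup>2) \<le> s" unfolding s_def using H by (intro real_sqrt_le_mono) (auto simp: K_def)
    then have s: "sqrt \<delta> * K \<le> s" using K by (simp add: real_sqrt_mult)
    have s0: "0 < s" using s K \<delta> by (smt (verit) mult_pos_pos real_sqrt_gt_zero)
    show "\<exists>x\<in>residues Q. \<exists>y\<in>residues Q. x \<in> A \<and> (x + poly P y) mod Q \<in> B"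
    proof (rule ccontr)
      assume "\<not> ?thesis"
      then have empty: "{(x, y). x \<in> residues Q \<and> y \<in> residues Q \<and> x \<in> A \<and> (x + poly P y) mod Q \<in> B} = {}" by auto
      have "\<bar>real (card ({} :: ('a poly \<times> 'a poly) set)) - real (card A) * real (card B)\<bar>
          \<le> \<epsilon> * sqrt (real (card A)) * sqrt (real (card B)) * K"
        using H N(2)[of Q A B] unfolding empty K_def by blast
      then have "real (card A) * real (card B) \<le> \<epsilon> * sqrt (real (card A)) * sqrt (real (card B)) * K"
        by simp
      also have "\<dots> = (sqrt \<delta> * K / 2) * s" by (simp add: \<epsilon>_def s_def real_sqrt_mult)
      also have "\<dots> \<le> (s / 2) * s" using s s0 by (intro mult_right_mono) auto
      also have "\<dots> < s * s" using s0 by simp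
      also have "\<dots> = real (card A) * real (card B)" by (simp add: s_def)
      finally show False by simp
    qed
  qed
qed

lemma deviation_vanishes_imp_dense_pairs_connected:
  fixes P :: "'a::{field,finite} poly poly"
  assumes "deviation_vanishes P"
  shows "dense_pairs_connected P"
proof (rule dense_pairs_connected_of_bound, goal_cases)
  case (1 \<epsilon>)
  obtain N :: real where N: "\<And>Q :: 'a poly. lead_coeff Q = 1 \<Longrightarrow> 0 < degree Q \<Longrightarrow> N \<le> real (lpf Q) \<Longrightarrow> deviation P Q \<le> \<epsilon>"
    using assms 1 unfolding deviation_vanishes_def by blast
  show ?case
  \<comment> \<open>A positive threshold is required here, while the one obtained from the vanishing
    deviation may be any real.\<close>
  proof (intro exI[of _ "max N 1"] conjI allI impI)
    fix Q :: "'a poly" and A B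
    assume Q: "lead_coeff Q = 1 \<and> 0 < degree Q \<and> max N 1 \<le> real (lpf Q) \<and> A \<subseteq> residues Q \<and> B \<subseteq> residues Q"
    obtain e where "primitive_char_mod Q e" using primitive_char_mod_exists Q by blast
    then interpret primitive_char_mod Q e .
    have "deviation P Q \<le> \<epsilon>" using Q by (intro N) auto
    then have "l2_norm (residues Q) (avg_dev P f) \<le> \<epsilon> * l2_norm (residues Q) f" for f
      using l2_norm_avg_dev_le_deviation[of P f] l2_norm_nonneg[of "residues Q" f]
      by (meson mult_right_mono order_trans)
    then show "\<bar>real (card {(x, y). x \<in> residues Q \<and> y \<in> residues Q \<and> x \<in> A \<and> (x + poly P y) mod Q \<in> B})
        - real (card A) * real (card B)\<bar>
      \<le> \<epsilon> * sqrt (real (card A)) * sqrt (real (card B)) * real (poly_norm Q)"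
      using 1 Q by (intro pair_count_bound) auto
  qed simp
qed

lemma pair_count_power_saving_imp_dense_pairs_connected:
  fixes P :: "'a::{field,finite} poly poly"
  assumes "pair_count_power_saving P"
  shows "dense_pairs_connected P"
proof (rule dense_pairs_connected_of_bound, goal_cases)
  case (1 \<epsilon>)
  obtain C1 C2 \<gamma> where C: "0 < C1" "0 < C2" "0 < \<gamma>"
    "\<And>(Q :: 'a poly) A B. lead_coeff Q = 1 \<and> 0 < degree Q \<and> C1 \<le> real (lpf Q) \<and> A \<subseteq> residues Q \<and> B \<subseteq> residues Q \<Longrightarrow>
       \<bar>real (card {(x, y). x \<in> residues Q \<and> y \<in> residues Q \<and> x \<in> A \<and> (x + poly P y) mod Q \<in> B})
         - real (card A) * real (card B)\<bar>
       \<le> C2 * sqrt (real (card A)) * sqrt (real (card B)) * real (poly_norm Q) * real (lpf Q) powr (- \<gamma>)"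
    using assms unfolding pair_count_power_saving_def by blast
  obtain N where N: "\<And>l. N \<le> l \<Longrightarrow> C2 * l powr (- \<gamma>) \<le> \<epsilon>"
    using powr_neg_le_of_large[OF C(2,3) 1] by blast
  show ?case
  proof (intro exI[of _ "max C1 N"] conjI allI impI)
    fix Q :: "'a poly" and A B
    assume Q: "lead_coeff Q = 1 \<and> 0 < degree Q \<and> max C1 N \<le> real (lpf Q) \<and> A \<subseteq> residues Q \<and> B \<subseteq> residues Q"
    let ?s = "sqrt (real (card A)) * sqrt (real (card B)) * real (poly_norm Q)"
    have "\<bar>real (card {(x, y). x \<in> residues Q \<and> y \<in> residues Q \<and> x \<in> A \<and> (x + poly P y) mod Q \<in> B})
        - real (card A) * real (card B)\<bar>
      \<le> C2 * sqrt (real (card A)) * sqrt (real (card B)) * real (poly_norm Q) * real (lpf Q) powr (- \<gamma>)"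
      using Q by (intro C(4)) auto
    also have "\<dots> = C2 * real (lpf Q) powr (- \<gamma>) * ?s" by (simp only: mult_ac)
    also have "\<dots> \<le> \<epsilon> * ?s" using Q by (intro mult_right_mono N) auto
    finally show "\<bar>real (card {(x, y). x \<in> residues Q \<and> y \<in> residues Q \<and> x \<in> A \<and> (x + poly P y) mod Q \<in> B})
        - real (card A) * real (card B)\<bar>
      \<le> \<epsilon> * sqrt (real (card A)) * sqrt (real (card B)) * real (poly_norm Q)"
      by (simp only: mult_ac)
  qed (use C(1) in simp)
qed

text \<open>Duality applied to the value subgroup enlarged by the multiples of \<open>Q\<close>.
  Constancy along \<open>P\<close> serves the construction of unconnected sets, triviality on the
  subgroup serves the diagonal argument.\<close>

lemma (in primitive_char_mod) character_obstruction:
  assumes "{h + Q * r |h r. h \<in> value_subgroup P} \<noteq> UNIV"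
  shows "\<exists>a. \<not> Q dvd a \<and> (\<forall>y. e (a * poly P y) = e (a * poly P 0)) \<and> (\<forall>h\<in>value_subgroup P. e (a * h) = 1)"
proof -
  let ?G = "{h + Q * r |h r. h \<in> value_subgroup P}"
  have sub: "s - t \<in> value_subgroup P" if "s \<in> value_subgroup P" "t \<in> value_subgroup P" for s t
    using that unfolding value_subgroup_def by (rule group_closure.diff)
  have 0: "0 \<in> value_subgroup P" by (simp add: value_subgroup_def)
  have G_I: "h + Q * r \<in> ?G" if "h \<in> value_subgroup P" for h r using that by blast
  obtain a where a: "\<not> Q dvd a" "\<And>x. x \<in> ?G \<Longrightarrow> e (a * x) = 1"
  proof (rule proper_subgroup_annihilated[of ?G])
    show "0 \<in> ?G" using G_I[OF 0, of 0] by simp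
    show "x - y \<in> ?G" if xy: "x \<in> ?G" "y \<in> ?G" for x y
    proof -
      obtain h r h' r' where "h \<in> value_subgroup P" "h' \<in> value_subgroup P" "x = h + Q * r" "y = h' + Q * r'"
        using xy by blast
      then have xy: "x - y = (h - h') + Q * (r - r')" and "h - h' \<in> value_subgroup P"
        using sub by (simp_all add: algebra_simps)
      show ?thesis unfolding xy by (rule G_I) fact
    qed
    show "Q * z \<in> ?G" for z using G_I[OF 0, of z] by simp
  qed (use assms in auto)
  have triv: "e (a * h) = 1" if "h \<in> value_subgroup P" for h using a(2)[OF G_I[OF that, of 0]] by simp
  have "e (a * poly P y) = e (a * poly P 0)" for y
  proof -
    have "poly P y - poly P 0 \<in> value_subgroup P"
      unfolding value_subgroup_def by (rule group_closure.base) blast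
    from triv[OF this] show ?thesis
      by (simp add: right_diff_distrib add_char_eq_iff[OF add_char_e, of "a * poly P y" "a * poly P 0"])
  qed
  then show ?thesis using a(1) triv by metis
qed

text \<open>An obstructing character takes at most p values and its level sets have equal size, so
  each has density at least 1/p. A step by \<open>P\<close> multiplies the character by the constant
  \<open>e (a * poly P 0)\<close>; starting in \<open>L 0\<close> it therefore never enters
  \<open>L (poly P 0 + z)\<close> when \<open>e (a * z) \<noteq> 1\<close>.\<close>

lemma dense_pairs_connected_imp_covers:
  fixes P :: "'a::{field,finite} poly poly"
  assumes "dense_pairs_connected P"
  shows "value_subgroup_covers P"
proof -
  define p where "p = CHAR('a)"
  have p: "0 < p" unfolding p_def using prime_CHAR_finite_field prime_gt_0_nat by blast
  \<comment> \<open>The joint density of two level sets.\<close>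
  have "0 < 1 / (real p)\<^sup>2" using p by simp
  then obtain N :: real where N: "0 < N" "\<And>(Q :: 'a poly) A B. lead_coeff Q = 1 \<and> 0 < degree Q \<and> N \<le> real (lpf Q) \<and>
      A \<subseteq> residues Q \<and> B \<subseteq> residues Q \<and> real (card A) * real (card B) \<ge> 1 / (real p)\<^sup>2 * (real (poly_norm Q))\<^sup>2 \<Longrightarrow>
      \<exists>x\<in>residues Q. \<exists>y\<in>residues Q. x \<in> A \<and> (x + poly P y) mod Q \<in> B"
    using assms unfolding dense_pairs_connected_def by blast
  have "{h + Q * r |h r. h \<in> value_subgroup P} = UNIV"
    if Q: "lead_coeff Q = 1 \<and> 0 < degree Q \<and> N \<le> real (lpf Q)" for Q :: "'a poly"
  proof (rule ccontr)
    assume not_cover: "\<not> ?thesis"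
    obtain e where "primitive_char_mod Q e" using primitive_char_mod_exists Q by blast
    then interpret primitive_char_mod Q e .
    obtain a where a: "\<not> Q dvd a" "\<And>y. e (a * poly P y) = e (a * poly P 0)"
      using character_obstruction[OF not_cover] by metis
    obtain z where z: "e (a * z) \<noteq> 1" using primitive_char_nontrivial[OF primitive a(1)] by blast
    define L where "L w = {x \<in> residues Q. e (a * x) = e (a * w)}" for w
    have card_L: "card (L w) = card (L 0)" for w
    proof -
      define f where "f x = (if e (a * x) = 1 then 1 else 0 :: nat)" for x
      have f: "periodic_mod Q f" unfolding f_def
        by (rule periodic_modI) (simp add: periodic_modD[OF periodic_e_scale(1)])
      have "card (L w) = (\<Sum>x\<in>residues Q. f (x + - w))" for w
        using add_char_eq_iff[OF add_char_e, of "a * _" "a * w"]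
        by (simp add: L_def f_def sum.inter_filter[symmetric] right_diff_distrib)
      then show ?thesis by (simp only: sum_residues_translate[OF Q_nonzero f])
    qed
    have "card (residues Q) \<le> card {c :: complex. c ^ p = 1} * card (L 0)"
    proof (rule card_le_fibers[where f = "\<lambda>x. e (a * x)"])
      show "finite {c :: complex. c ^ p = 1}" by (rule finite_roots_unity) (use p in simp)
      show "(\<lambda>x. e (a * x)) ` residues Q \<subseteq> {c. c ^ p = 1}"
        using add_char_power_CHAR[OF add_char_e] by (auto simp: p_def)
      fix c show "card {x \<in> residues Q. e (a * x) = c} \<le> card (L 0)"
      proof (cases "{x \<in> residues Q. e (a * x) = c} = {}")
        case False
        then obtain w where "e (a * w) = c" by blast
        then show ?thesis using card_L[of w] by (simp add: L_def)
      qed (simp only: card.empty)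
    qed simp
    also have "card {c :: complex. c ^ p = 1} = p" using p by (rule card_roots_unity_eq)
    finally have "real (poly_norm Q) \<le> real p * real (card (L 0))"
      by (simp add: card_residues flip: of_nat_mult)
    then have "(real (poly_norm Q))\<^sup>2 \<le> (real p * real (card (L 0)))\<^sup>2" by (intro power_mono) auto
    then have "1 / (real p)\<^sup>2 * (real (poly_norm Q))\<^sup>2 \<le> real (card (L 0)) * real (card (L (poly P 0 + z)))"
      using p card_L[of "poly P 0 + z"] by (simp add: power2_eq_square field_simps)
    then obtain x y where "x \<in> L 0" "(x + poly P y) mod Q \<in> L (poly P 0 + z)"
      using N(2)[of Q "L 0" "L (poly P 0 + z)"] Q by (auto simp: L_def)
    then have "e (a * x) = 1" "e (a * (x + poly P y)) = e (a * (poly P 0 + z))"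
      by (simp_all add: L_def add_char_0[OF add_char_e] periodic_mod_mod[OF periodic_e_scale(1)])
    then have "e (a * poly P 0) = e (a * poly P 0) * e (a * z)"
      by (simp add: distrib_left add_char_add[OF add_char_e] a(2)[of y])
    then show False using z add_char_nonzero[OF add_char_e] by simp
  qed
  then show ?thesis unfolding value_subgroup_covers_def using N(1) by blast
qed

section \<open>Characters of the polynomial ring and of the torus\<close>

text \<open>Duality modulo the polynomial t, whose residue ring is the field itself.\<close>

lemma self_dual_char_exists:
  obtains \<psi> :: "'a::{field,finite} \<Rightarrow> complex" and c where "add_char \<psi>" "\<psi> c \<noteq> 1"
    "\<And>\<phi>. add_char \<phi> \<Longrightarrow> \<exists>b. \<forall>x. \<phi> x = \<psi> (b * x)"
proof -
  obtain e where "primitive_char_mod [:0, 1::'a:] e"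
    using primitive_char_mod_exists[of "[:0, 1::'a:]"] by auto
  then interpret primitive_char_mod "[:0, 1::'a:]" e .
  define \<psi> where "\<psi> x = e [:x:]" for x
  have res: "residues [:0, 1::'a:] = {x. degree x = 0}" by (auto simp: residues_altdef)
  have "\<psi> (x + y) = \<psi> x * \<psi> y" for x y
    using add_char_add[OF add_char_e, of "[:x:]" "[:y:]"] by (simp add: \<psi>_def)
  then have "add_char \<psi>" using add_char_norm[OF add_char_e] by (simp add: add_char_def \<psi>_def)
  moreover obtain z where "e (1 * z) \<noteq> 1"
    using primitive_char_nontrivial[OF primitive, of 1] by (auto simp: is_unit_iff_degree)
  then have "\<psi> (coeff z 0) \<noteq> 1"
  proof -
    obtain c z' where z: "z = pCons c z'" by (cases z)
    have "z - [:c:] = [:0, 1:] * z'" by (simp add: z)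
    then have "e z = e [:c:]" by (intro primitive_char_eq[OF primitive]) (simp only: dvd_triv_left)
    then show ?thesis using \<open>e (1 * z) \<noteq> 1\<close> by (simp add: \<psi>_def z)
  qed
  moreover have "\<exists>b. \<forall>x. \<phi> x = \<psi> (b * x)" if \<phi>: "add_char \<phi>" for \<phi>
  proof -
    define \<phi>' where "\<phi>' x = \<phi> (coeff x 0)" for x
    have "add_char \<phi>'" using \<phi> by (simp add: add_char_def \<phi>'_def)
    moreover have "periodic_mod [:0, 1::'a:] \<phi>'" by (simp add: periodic_mod_def \<phi>'_def)
    ultimately obtain b where b: "b \<in> residues [:0, 1::'a:]" "\<And>x. \<phi>' x = e (b * x)"
      by (rule add_char_eq_scale) blast
    then obtain b' where "b = [:b':]" using res by (auto elim: degree_eq_zeroE)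
    then have "\<phi> x = \<psi> (b' * x)" for x using b(2)[of "[:x:]"] by (simp add: \<phi>'_def \<psi>_def mult.commute)
    then show ?thesis by blast
  qed
  ultimately show thesis by (rule that)
qed

section \<open>Laurent series coefficients and the torus\<close>

lemma fls_of_poly_inv_pCons: "fls_of_poly_inv (pCons a p) = fls_const a + fls_X_inv * fls_of_poly_inv p"
  by (simp add: fls_of_poly_inv_def map_poly_pCons)

lemma fls_nth_poly_times:
  "fls_nth (fls_of_poly_inv p * f) k = (\<Sum>i\<le>degree p. coeff p i * fls_nth f (k + int i))"
proof (induction p arbitrary: k)
  case 0
  then show ?case by (simp add: fls_of_poly_inv_0)
next
  case (pCons a p)
  have "fls_nth (fls_of_poly_inv (pCons a p) * f) k = a * fls_nth f k + fls_nth (fls_of_poly_inv p * f) (k + 1)"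
  proof -
    have "fls_of_poly_inv (pCons a p) * f = fls_const a * f + fls_shift 1 (fls_of_poly_inv p * f)"
      unfolding fls_of_poly_inv_pCons distrib_right mult.assoc by (simp only: fls_X_inv_times_conv_shift(1))
    then show ?thesis by simp
  qed
  also have "\<dots> = a * fls_nth f k + (\<Sum>i\<le>degree p. coeff p i * fls_nth f (k + 1 + int i))"
    by (simp only: pCons.IH)
  also have "\<dots> = (\<Sum>i\<le>Suc (degree p). coeff (pCons a p) i * fls_nth f (k + int i))"
    by (simp add: sum.atMost_Suc_shift algebra_simps del: sum.atMost_Suc)
  also have "\<dots> = (\<Sum>i\<le>degree (pCons a p). coeff (pCons a p) i * fls_nth f (k + int i))"
    by (rule sum.mono_neutral_right) (auto simp: coeff_eq_0 not_le)
  finally show ?case .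
qed

lemma fls_nth_poly_pos: "0 < k \<Longrightarrow> fls_nth (fls_of_poly_inv p) k = 0"
  using fls_nth_poly_times[of p 1 k] by simp

text \<open>On the monomials of each degree \<open>\<Psi>\<close> is a character of the field, hence
  given by one field element; these elements are the coefficients of \<alpha>.\<close>

lemma poly_char_representation:
  fixes \<psi> :: "'a::{field,finite} \<Rightarrow> complex"
  assumes dual: "\<And>\<phi>. add_char \<phi> \<Longrightarrow> \<exists>b. \<forall>x. \<phi> x = \<psi> (b * x)" and \<psi>: "add_char \<psi>" and \<Psi>: "add_char \<Psi>"
  shows "\<exists>\<alpha>. \<forall>p. \<Psi> p = \<psi> (fls_nth (fls_of_poly_inv p * \<alpha>) 1)"
proof -
  have "\<exists>b. \<forall>x. \<Psi> (monom x n) = \<psi> (b * x)" for n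
    by (rule dual) (use \<Psi> in \<open>simp add: add_char_def flip: add_monom\<close>)
  then obtain b where b: "\<And>n x. \<Psi> (monom x n) = \<psi> (b n * x)" by metis
  \<comment> \<open>The shift puts \<open>b n\<close> at index \<open>n + 1\<close>, which
    multiplication by t^n brings to index 1.\<close>
  define \<alpha> where "\<alpha> = fls_shift (-1) (fps_to_fls (Abs_fps b))"
  have "\<Psi> p = \<psi> (fls_nth (fls_of_poly_inv p * \<alpha>) 1)" for p
  proof -
    have "\<Psi> p = \<Psi> (\<Sum>i\<le>degree p. monom (coeff p i) i)" by (simp add: poly_as_sum_of_monoms)
    also have "\<dots> = (\<Prod>i\<le>degree p. \<psi> (b i * coeff p i))" by (simp add: add_char_sum[OF \<Psi>] b)
    also have "\<dots> = \<psi> (\<Sum>i\<le>degree p. b i * coeff p i)" by (simp add: add_char_sum[OF \<psi>])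
    also have "(\<Sum>i\<le>degree p. b i * coeff p i) = fls_nth (fls_of_poly_inv p * \<alpha>) 1"
      by (simp add: fls_nth_poly_times \<alpha>_def mult.commute)
    finally show ?thesis .
  qed
  then show ?thesis by blast
qed

text \<open>As \<open>fls_X\<close> stands for \<open>1/t\<close>, index 1 is the coefficient of \<open>1/t\<close>, on which polynomials vanish.\<close>
lift_definition torus_coeff :: "'a::field fls_torus \<Rightarrow> 'a" is "\<lambda>x. fls_nth x 1"
  using fls_nth_poly_pos[of 1] by (metis cong_mod_poly_def diff_add_cancel fls_plus_nth add_0 zero_less_one)

lemma torus_coeff_proj: "torus_coeff (torus_proj x) = fls_nth x 1"
  by (simp add: torus_proj_def torus_coeff.abs_eq)

lemma torus_coeff_add: "torus_coeff (x + y) = torus_coeff x + torus_coeff y"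
  by transfer simp

lemma torus_proj_add: "torus_proj (x + y) = torus_proj x + torus_proj y"
  by (simp add: torus_proj_def plus_fls_torus.abs_eq)

lemma torus_proj_surj: "\<exists>x. t = torus_proj x"
  unfolding torus_proj_def by (metis Quotient_abs_rep[OF Quotient_fls_torus])

text \<open>Series first differing at index 1 have distance exactly 1/2, and those differing earlier
  are further apart.\<close>

lemma fls_nth_1_eq_of_dist_less:
  fixes x y :: "'a::field fls"
  assumes "dist x y < 1 / 2"
  shows "fls_nth x 1 = fls_nth y 1"
proof (rule ccontr)
  assume ne: "fls_nth x 1 \<noteq> fls_nth y 1"
  then have "fls_nth (x - y) 1 \<noteq> 0" by simp
  then have s: "fls_subdegree (x - y) \<le> 1" by (rule fls_subdegree_leI)
  have "x \<noteq> y" using ne by auto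
  have "1 / 2 \<le> dist x y"
  proof (cases "0 \<le> fls_subdegree (x - y)")
    case True
    then have "fls_subdegree (x - y) = 0 \<or> fls_subdegree (x - y) = 1" using s by linarith
    then show ?thesis using \<open>x \<noteq> y\<close> by (auto simp: dist_fls_def)
  next
    case False
    have "(1::real) \<le> 2 ^ nat (- fls_subdegree (x - y))" by (rule one_le_power) simp
    moreover have "dist x y = 2 ^ nat (- fls_subdegree (x - y))"
      using False \<open>x \<noteq> y\<close> by (simp add: dist_fls_def)
    ultimately show ?thesis by linarith
  qed
  then show False using assms by simp
qed

lemma dist_fls_translate: "dist (c + x) (c + y) = dist x (y :: 'a::field fls)"
  by (simp add: dist_fls_def)

text \<open>\<open>torus_coeff\<close> is locally constant, so \<open>S\<close> can be arbitrary,
  and any function of this coefficient is continuous.\<close>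

lemma open_torus_coeff_vimage: "open (torus_coeff -` S)"
  unfolding open_fls_torus_def open_fls_def
proof
  fix x assume x: "x \<in> torus_proj -` (torus_coeff -` S)"
  have "{y. dist y x < 1 / 2} \<subseteq> torus_proj -` (torus_coeff -` S)"
  proof
    fix y assume "y \<in> {y. dist y x < 1 / 2}"
    then have "fls_nth y 1 = fls_nth x 1" by (intro fls_nth_1_eq_of_dist_less) simp
    then show "y \<in> torus_proj -` (torus_coeff -` S)" using x by (simp add: torus_coeff_proj)
  qed
  then show "\<exists>r>0. {y. dist y x < r} \<subseteq> torus_proj -` (torus_coeff -` S)"
    by (intro exI[of _ "1 / 2"]) simp
qed

lemma continuous_on_torus_coeff: "continuous_on UNIV (\<lambda>x. \<psi> (torus_coeff x))"
  unfolding continuous_on_open_vimage[OF open_UNIV]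
proof (intro allI impI)
  fix B :: "'b set" assume "open B"
  have "(\<lambda>x. \<psi> (torus_coeff x)) -` B = torus_coeff -` (\<psi> -` B)" by auto
  then show "open ((\<lambda>x. \<psi> (torus_coeff x)) -` B \<inter> UNIV)" by (simp add: open_torus_coeff_vimage)
qed

text \<open>Provides the Borel measurability needed to transport an integral along a
  translation.\<close>

lemma continuous_on_torus_translate: "continuous_on UNIV (\<lambda>x :: 'a::field fls_torus. h + x)"
  unfolding continuous_on_open_vimage[OF open_UNIV]
proof (intro allI impI)
  fix U :: "'a fls_torus set" assume U: "open U"
  obtain h0 where h: "h = torus_proj h0" using torus_proj_surj by blast
  have "open (torus_proj -` ((\<lambda>x. h + x) -` U))"
    unfolding open_fls_def
  proof
    fix x assume "x \<in> torus_proj -` ((\<lambda>x. h + x) -` U)"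
    then have "h0 + x \<in> torus_proj -` U" by (simp add: h torus_proj_add)
    then obtain r where r: "0 < r" "{y. dist y (h0 + x) < r} \<subseteq> torus_proj -` U"
      using U unfolding open_fls_torus_def open_fls_def by blast
    have "{y. dist y x < r} \<subseteq> torus_proj -` ((\<lambda>x. h + x) -` U)"
    proof
      fix y assume "y \<in> {y. dist y x < r}"
      then have "h0 + y \<in> {y. dist y (h0 + x) < r}" by (simp add: dist_fls_translate)
      then show "y \<in> torus_proj -` ((\<lambda>x. h + x) -` U)" using r(2) by (auto simp: h torus_proj_add)
    qed
    then show "\<exists>r>0. {y. dist y x < r} \<subseteq> torus_proj -` ((\<lambda>x. h + x) -` U)" using r(1) by blast
  qed
  then show "open ((\<lambda>x. h + x) -` U \<inter> UNIV)" by (simp add: open_fls_torus_def)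
qed

text \<open>Translation by the class of c/t multiplies the integral by \<open>\<psi> c\<close>,
  which is not 1, while Haar measure is invariant.\<close>

lemma haar_integral_torus_char:
  fixes \<psi> :: "'a::{field,finite} \<Rightarrow> complex"
  assumes m: "haar_probability m" and \<psi>: "add_char \<psi>" "\<psi> c \<noteq> 1"
  shows "integral\<^sup>L m (\<lambda>x. \<psi> (torus_coeff x)) = 0"
proof -
  let ?g = "\<lambda>x. \<psi> (torus_coeff x)"
  define h where "h = torus_proj (fls_const c * fls_X)"
  have h: "torus_coeff h = c" by (simp add: h_def torus_coeff_proj)
  have sets: "sets m = sets borel" and inv: "distr m borel (\<lambda>x. h + x) = m"
    using m by (auto simp: haar_probability_def)
  have meas: "(\<lambda>x. h + x) \<in> measurable m borel"
    using borel_measurable_continuous_onI[OF continuous_on_torus_translate[of h]]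
      measurable_cong_sets[OF sets refl] by blast
  have "integral\<^sup>L m ?g = integral\<^sup>L (distr m borel (\<lambda>x. h + x)) ?g" by (simp only: inv)
  also have "\<dots> = integral\<^sup>L m (\<lambda>x. ?g (h + x))"
    by (rule integral_distr[OF meas]) (rule borel_measurable_continuous_onI[OF continuous_on_torus_coeff])
  also have "\<dots> = \<psi> c * integral\<^sup>L m ?g"
    by (simp add: torus_coeff_add h add_char_add[OF \<psi>(1)])
  finally show ?thesis using \<psi>(2) by simp
qed

section \<open>Irrational obstructions\<close>

lemma finite_polys_degree_less: "finite {x :: 'a::{field,finite} poly. degree x < n}"
proof -
  have "{x :: 'a poly. degree x < n} \<subseteq> {x. x = 0 \<or> degree x < n}" by auto
  then show ?thesis using card_polys_degree_less[THEN conjunct1] by (rule finite_subset)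
qed

lemma countable_rational_fls: "countable (rational_fls :: 'a::{field,finite} fls set)"
proof -
  have "(UNIV :: 'a poly set) = (\<Union>n. {x. degree x < n})" by auto
  also have "countable \<dots>" by (intro countable_UN) (auto intro: countable_finite finite_polys_degree_less)
  finally have "countable ((UNIV :: 'a poly set) \<times> (UNIV :: 'a poly set))" by (intro countable_SIGMA) auto
  then have "countable ((\<lambda>(p, q). fls_of_poly_inv p / fls_of_poly_inv q) ` ((UNIV :: 'a poly set) \<times> UNIV))"
    by (rule countable_image)
  then show ?thesis by (rule countable_subset[rotated]) (auto simp: rational_fls_def)
qed

text \<open>A limit of finite products of characters, each new factor being trivial on the polynomials of
  small degree used so far, diagonalises against the sequence \<open>\<phi>\<close>.\<close>
lemma diagonal_char_exists:
  fixes \<phi> :: "nat \<Rightarrow> 'a::{field,finite} poly \<Rightarrow> complex"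
  assumes ex: "\<And>n. \<exists>\<delta>. add_char \<delta> \<and> (\<forall>h\<in>H. \<delta> h = 1) \<and> (\<forall>x. degree x < n \<longrightarrow> \<delta> x = 1) \<and> (\<exists>x. \<delta> x \<noteq> 1)"
  obtains \<Psi> where "add_char \<Psi>" "\<forall>h\<in>H. \<Psi> h = 1" "\<forall>k. \<Psi> \<noteq> \<phi> k"
proof -
  \<comment> \<open>A state is a character with a bound: values at degrees below the bound are
    final. At stage \<open>k\<close> the bound is at least \<open>k\<close>.\<close>
  let ?P = "\<lambda>(k :: nat) (s :: ('a poly \<Rightarrow> complex) \<times> nat). add_char (fst s) \<and> (\<forall>h\<in>H. fst s h = 1) \<and> k \<le> snd s"
  let ?Q = "\<lambda>k s s'. (\<forall>x. degree x < snd s \<longrightarrow> fst s' x = fst s x) \<and> snd s \<le> snd s' \<and>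
    (\<exists>x. degree x < snd s' \<and> fst s' x \<noteq> \<phi> k x)"
  have "\<exists>f. \<forall>k. ?P k (f k) \<and> ?Q k (f k) (f (Suc k))"
  proof (rule dependent_nat_choice)
    show "\<exists>s. ?P 0 s" by (intro exI[of _ "(\<lambda>_. 1, 0)"]) (simp add: add_char_def)
  next
    fix s :: "('a poly \<Rightarrow> complex) \<times> nat" and k
    assume s: "?P k s"
    obtain \<delta> where \<delta>: "add_char \<delta>" "\<forall>h\<in>H. \<delta> h = 1" "\<forall>x. degree x < snd s \<longrightarrow> \<delta> x = 1" "\<exists>x. \<delta> x \<noteq> 1"
      using ex by blast
    \<comment> \<open>The character is kept if it already differs from \<open>\<phi> k\<close>;
      otherwise it is multiplied by \<open>\<delta>\<close>, which leaves the final values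
      alone.\<close>
    obtain \<psi> where \<psi>: "add_char \<psi>" "\<forall>h\<in>H. \<psi> h = 1" "\<forall>x. degree x < snd s \<longrightarrow> \<psi> x = fst s x" "\<psi> \<noteq> \<phi> k"
    proof (cases "fst s = \<phi> k")
      case False
      then show thesis using that[of "fst s"] s by simp
    next
      case True
      define \<psi> where "\<psi> = (\<lambda>x. fst s x * \<delta> x)"
      obtain x where "\<delta> x \<noteq> 1" using \<delta>(4) by blast
      then have "\<psi> x \<noteq> fst s x" using add_char_nonzero[of "fst s" x] s by (simp add: \<psi>_def)
      then have "\<psi> \<noteq> \<phi> k" using True by auto
      moreover have "add_char \<psi>" unfolding \<psi>_def using s \<delta>(1) by (intro add_char_mult) auto
      ultimately show thesis using that[of \<psi>] s \<delta> by (simp add: \<psi>_def)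
    qed
    then obtain x where x: "\<psi> x \<noteq> \<phi> k x" by blast
    \<comment> \<open>The new bound exceeds the degree of the witness \<open>x\<close>, so the
      difference from \<open>\<phi> k\<close> is never undone.\<close>
    show "\<exists>s'. ?P (Suc k) s' \<and> ?Q k s s'"
      using \<psi> x s by (intro exI[of _ "(\<psi>, max (Suc (snd s)) (Suc (degree x)))"]) auto
  qed
  then obtain f where f: "\<And>k. ?P k (f k)" "\<And>k. ?Q k (f k) (f (Suc k))" by blast
  have mono: "snd (f k) \<le> snd (f l)" if "k \<le> l" for k l
    by (rule lift_Suc_mono_le[of "\<lambda>k. snd (f k)"]) (use that f(2) in blast)+
  have stable: "fst (f l) x = fst (f k) x" if "k \<le> l" "degree x < snd (f k)" for k l x
    using that(1)
  proof (induction l rule: dec_induct)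
    case (step l)
    have "degree x < snd (f l)" using that(2) mono[OF step(1)] by simp
    then show ?case using f(2)[of l] step by simp
  qed simp
  \<comment> \<open>At stage \<open>Suc (degree x)\<close> the bound exceeds
    \<open>degree x\<close>, so the value is final.\<close>
  define \<Psi> where "\<Psi> x = fst (f (Suc (degree x))) x" for x
  have \<Psi>: "\<Psi> x = fst (f k) x" if "degree x < snd (f k)" for x k
  proof -
    have "degree x < snd (f (Suc (degree x)))" using f(1)[of "Suc (degree x)"] by simp
    then have "fst (f (max k (Suc (degree x)))) x = \<Psi> x"
      unfolding \<Psi>_def by (intro stable) auto
    moreover have "fst (f (max k (Suc (degree x)))) x = fst (f k) x"
      using that by (intro stable) auto
    ultimately show ?thesis by simp
  qed
  have \<Psi>': "\<Psi> x = fst (f k) x" if "degree x < k" for x k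
    using \<Psi>[of x k] f(1)[of k] that by simp
  have "add_char \<Psi>"
  proof -
    have "\<Psi> (x + y) = \<Psi> x * \<Psi> y" for x y
    proof -
      define k where "k = Suc (max (degree x) (degree y))"
      have "degree (x + y) < k" using degree_add_le_max[of x y] by (simp add: k_def)
      moreover have "degree x < k" "degree y < k" by (simp_all add: k_def)
      ultimately show ?thesis using f(1)[of k] \<Psi>' by (simp add: add_char_add)
    qed
    moreover have "cmod (\<Psi> x) = 1" for x
      unfolding \<Psi>_def using f(1)[of "Suc (degree x)"] by (simp add: add_char_norm)
    ultimately show ?thesis by (simp add: add_char_def)
  qed
  moreover have "\<forall>h\<in>H. \<Psi> h = 1" unfolding \<Psi>_def using f(1) by blast
  moreover have "\<Psi> \<noteq> \<phi> k" for k
  proof -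
    obtain x where "degree x < snd (f (Suc k))" "fst (f (Suc k)) x \<noteq> \<phi> k x" using f(2)[of k] by blast
    then show ?thesis using \<Psi> by metis
  qed
  ultimately show thesis using that by blast
qed

text \<open>The generator of the period ideal divides both moduli; an irreducible factor of it would
  have norm at least \<open>lpf Q\<close> and at most \<open>poly_norm Q'\<close>.\<close>

lemma periodic_char_trivial:
  fixes Q Q' :: "'a::{field,finite} poly"
  assumes \<psi>: "add_char \<psi>" "periodic_mod Q \<psi>" "periodic_mod Q' \<psi>"
    and Q: "Q \<noteq> 0" "Q' \<noteq> 0" "poly_norm Q' < lpf Q"
  shows "\<psi> x = 1"
proof -
  define J where "J = {g. \<forall>z. \<psi> (g * z) = 1}"
  have J: "Q \<in> J" "Q' \<in> J" using \<psi> by (auto simp: J_def add_char_periodic)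
  obtain g where g: "lead_coeff g = 1" "\<And>x. x \<in> J \<longleftrightarrow> g dvd x"
  proof (rule poly_ideal_principal[of J Q])
    show "x + y \<in> J" if "x \<in> J" "y \<in> J" for x y
      using that by (auto simp: J_def distrib_right add_char_add[OF \<psi>(1)])
    show "z * x \<in> J" if "x \<in> J" for x z
      using that by (auto simp: J_def mult.left_commute[of _ x] mult.assoc)
  qed (use J Q in auto)
  have g0: "g \<noteq> 0" using g(1) by auto
  have "degree g = 0"
  proof (rule ccontr)
    assume "degree g \<noteq> 0"
    then have "0 < degree g" by simp
    then obtain R where R: "lead_coeff R = 1" "irreducible R" "R dvd g"
      by (rule poly_irreducible_divisor_exists)
    have "R dvd Q" "R dvd Q'" using J g(2) R(3) dvd_trans by blast+
    have "lpf Q \<le> poly_norm R" by (rule lpf_le) fact+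
    moreover have "degree R \<le> degree Q'" using \<open>R dvd Q'\<close> Q(2) by (rule dvd_imp_degree_le)
    then have "poly_norm R \<le> poly_norm Q'" unfolding poly_norm_def by (intro power_increasing) auto
    ultimately show False using Q(3) by simp
  qed
  then have "is_unit g" using g0 by (simp add: is_unit_iff_degree)
  then have "1 \<in> J" using g(2) by simp
  then show ?thesis by (simp add: J_def)
qed

text \<open>A modulus whose \<open>lpf\<close> exceeds the norms of all earlier moduli yields a new
  obstructing character, so there are infinitely many. They have only finitely many restrictions to
  degrees below \<open>n\<close>; two distinct ones agree there, and their quotient is the desired
  character.\<close>

lemma not_covers_imp_char_trivial_low_degree:
  fixes P :: "'a::{field,finite} poly poly"
  assumes "\<not> value_subgroup_covers P"
  shows "\<exists>\<delta>. add_char \<delta> \<and> (\<forall>h\<in>value_subgroup P. \<delta> h = 1) \<and> (\<forall>x. degree x < n \<longrightarrow> \<delta> x = 1) \<and> (\<exists>x. \<delta> x \<noteq> 1)"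
proof -
  define X where "X = {\<psi>. add_char \<psi> \<and> (\<forall>h\<in>value_subgroup P. \<psi> h = 1) \<and> (\<exists>x. \<psi> x \<noteq> 1) \<and>
    (\<exists>Q. Q \<noteq> 0 \<and> periodic_mod Q \<psi>)}"
  have "infinite X"
  proof
    assume fin: "finite X"
    have "\<forall>\<psi>\<in>X. \<exists>Q. Q \<noteq> 0 \<and> periodic_mod Q \<psi>" by (auto simp: X_def)
    then obtain q where q: "\<And>\<psi>. \<psi> \<in> X \<Longrightarrow> q \<psi> \<noteq> 0 \<and> periodic_mod (q \<psi>) \<psi>" by metis
    \<comment> \<open>Larger than the norm of every chosen modulus, so a character found for some
      \<open>Q\<close> with \<open>M \<le> lpf Q\<close> cannot belong to \<open>X\<close>, by
      \<open>periodic_char_trivial\<close>.\<close>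
    define M where "M = Suc (\<Sum>\<psi>\<in>X. poly_norm (q \<psi>))"
    have "0 < real M" by (simp only: M_def of_nat_0_less_iff zero_less_Suc)
    then obtain Q :: "'a poly" where Q: "lead_coeff Q = 1" "0 < degree Q" "real M \<le> real (lpf Q)"
      "{h + Q * r |h r. h \<in> value_subgroup P} \<noteq> UNIV"
      using assms unfolding value_subgroup_covers_def by blast
    obtain e where "primitive_char_mod Q e" using primitive_char_mod_exists Q(2) by blast
    then interpret primitive_char_mod Q e .
    obtain a where a: "\<not> Q dvd a" "\<forall>h\<in>value_subgroup P. e (a * h) = 1"
      using character_obstruction[OF Q(4)] by blast
    define \<psi> where "\<psi> x = e (a * x)" for x
    have \<psi>: "add_char \<psi>" "periodic_mod Q \<psi>"
      unfolding \<psi>_def by (rule add_char_e_scale periodic_e_scale)+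
    obtain z where z: "\<psi> z \<noteq> 1" using primitive_char_nontrivial[OF primitive a(1)] by (auto simp: \<psi>_def)
    have "\<psi> \<in> X" using \<psi> z a(2) Q_nonzero unfolding X_def \<psi>_def by blast
    have "poly_norm (q \<psi>) \<le> (\<Sum>\<psi>\<in>X. poly_norm (q \<psi>))" by (rule member_le_sum[OF \<open>\<psi> \<in> X\<close> _ fin]) simp
    also have "\<dots> < M" by (simp only: M_def lessI)
    also have "M \<le> lpf Q" using Q(3) by (simp only: of_nat_le_iff)
    finally have "poly_norm (q \<psi>) < lpf Q" .
    then show False using periodic_char_trivial[OF \<psi>(1,2)] q[OF \<open>\<psi> \<in> X\<close>] z Q_nonzero by blast
  qed
  let ?D = "{x :: 'a poly. degree x < n}" and ?U = "{c :: complex. c ^ CHAR('a) = 1}"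
  have "finite ?U" using prime_CHAR_finite_field[where 'a = 'a, THEN prime_gt_0_nat] by (intro finite_roots_unity) simp
  then have fin: "finite (?D \<rightarrow>\<^sub>E ?U)" by (intro finite_PiE finite_polys_degree_less)
  have "(\<lambda>\<psi>. restrict \<psi> ?D) ` X \<subseteq> ?D \<rightarrow>\<^sub>E ?U"
  proof
    fix \<psi>' assume "\<psi>' \<in> (\<lambda>\<psi>. restrict \<psi> ?D) ` X"
    then obtain \<psi> where \<psi>: "\<psi>' = restrict \<psi> ?D" "add_char \<psi>" by (auto simp: X_def)
    have "\<psi> x ^ CHAR('a) = 1" for x using add_char_power_CHAR[OF \<psi>(2), of x] by simp
    then show "\<psi>' \<in> ?D \<rightarrow>\<^sub>E ?U" unfolding \<psi>(1) by simp
  qed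
  then have "finite ((\<lambda>\<psi>. restrict \<psi> ?D) ` X)" using fin finite_subset by blast
  then have "\<not> inj_on (\<lambda>\<psi>. restrict \<psi> ?D) X" using \<open>infinite X\<close> finite_imageD by blast
  then obtain \<psi> \<psi>' where X: "\<psi> \<in> X" "\<psi>' \<in> X" "\<psi> \<noteq> \<psi>'" "restrict \<psi> ?D = restrict \<psi>' ?D"
    unfolding inj_on_def by blast
  have c: "add_char \<psi>" "add_char \<psi>'" using X by (auto simp: X_def)
  have eq_1: "\<psi> x * cnj (\<psi>' x) = 1 \<longleftrightarrow> \<psi> x = \<psi>' x" for x
  proof -
    have "\<psi>' x * cnj (\<psi>' x) = 1" using complex_norm_square[of "\<psi>' x"] by (simp add: add_char_norm[OF c(2)])
    moreover have "cnj (\<psi>' x) \<noteq> 0" using add_char_nonzero[OF c(2)] by simp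
    ultimately show ?thesis by (metis mult_right_cancel)
  qed
  have "add_char (\<lambda>x. \<psi> x * cnj (\<psi>' x))" by (intro add_char_mult add_char_cnj c)
  moreover have "\<psi> x * cnj (\<psi>' x) = 1" if "degree x < n" for x
    unfolding eq_1 using fun_cong[OF X(4), of x] that by simp
  moreover have "\<forall>h\<in>value_subgroup P. \<psi> h * cnj (\<psi>' h) = 1" using X(1,2) by (simp add: X_def)
  moreover have "\<exists>x. \<psi> x * cnj (\<psi>' x) \<noteq> 1" unfolding eq_1 using X(3) by blast
  ultimately show ?thesis by blast
qed

text \<open>Each set is a group, so a shift by \<open>n\<close> fixes it once \<open>N\<close>
  reaches \<open>degree n\<close>. \<open>Suc N\<close> avoids the empty set at
  \<open>N = 0\<close>.\<close>

lemma folner_degree_less: "folner (\<lambda>N. {x :: 'a::{field,finite} poly. degree x < Suc N})"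
  unfolding folner_def
proof (intro conjI allI)
  fix N
  show "finite {x :: 'a poly. degree x < Suc N}" by (rule finite_polys_degree_less)
  have "0 \<in> {x :: 'a poly. degree x < Suc N}" by simp
  then show "{x :: 'a poly. degree x < Suc N} \<noteq> {}" by blast
next
  fix n :: "'a poly"
  let ?B = "\<lambda>N. {x :: 'a poly. degree x < Suc N}"
  have "(\<lambda>x. x + n) ` ?B N = ?B N" if "degree n \<le> N" for N
  proof (intro equalityI subsetI)
    fix x assume x: "x \<in> ?B N"
    have "degree (x - n) < Suc N" using x that degree_diff_le[of x N n] by auto
    then show "x \<in> (\<lambda>x. x + n) ` ?B N" by (intro image_eqI[of _ _ "x - n"]) auto
  qed (use that degree_add_le[of _ N n] in \<open>auto simp: less_Suc_eq_le\<close>)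
  then have "real (card (sym_diff ((\<lambda>x. x + n) ` ?B N) (?B N))) / real (card (?B N)) = 0" if "degree n \<le> N" for N
    using that by simp
  then have "eventually (\<lambda>N. real (card (sym_diff ((\<lambda>x. x + n) ` ?B N) (?B N))) / real (card (?B N)) = 0) sequentially"
    unfolding eventually_sequentially by blast
  then show "(\<lambda>N. real (card (sym_diff ((\<lambda>x. x + n) ` ?B N) (?B N))) / real (card (?B N))) \<longlonglongrightarrow> 0"
    by (rule tendsto_eventually)
qed

text \<open>The diagonal character differs from all characters that come from rational series, so
  its \<alpha> is irrational. Along \<open>P\<close> it is a constant of modulus 1, whereas
  well-distribution would make its averages tend to the Haar integral 0.\<close>

lemma good_imp_covers:
  fixes P :: "'a::{field,finite} poly poly"
  assumes "good_for_irrational_equidistribution P"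
  shows "value_subgroup_covers P"
proof (rule ccontr)
  assume not_covers: "\<not> value_subgroup_covers P"
  obtain \<psi> :: "'a \<Rightarrow> complex" and c where \<psi>: "add_char \<psi>" "\<psi> c \<noteq> 1"
    "\<And>\<phi>. add_char \<phi> \<Longrightarrow> \<exists>b. \<forall>x. \<phi> x = \<psi> (b * x)"
    using self_dual_char_exists by metis
  define E where "E \<alpha> p = \<psi> (fls_nth (fls_of_poly_inv p * \<alpha>) 1)" for \<alpha> p
  \<comment> \<open>Nonemptiness is what lets \<open>from_nat_into\<close> enumerate exactly this
    countable set.\<close>
  have "(0 :: 'a fls) \<in> rational_fls" unfolding rational_fls_def using fls_of_poly_inv_0
    by (metis (mono_tags, lifting) div_0 mem_Collect_eq one_neq_zero)
  then have rat: "range (from_nat_into (rational_fls :: 'a fls set)) = rational_fls"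
    using countable_rational_fls by (intro range_from_nat_into) auto
  obtain \<Psi> where \<Psi>: "add_char \<Psi>" "\<forall>h\<in>value_subgroup P. \<Psi> h = 1"
    "\<forall>k. \<Psi> \<noteq> E (from_nat_into rational_fls k)"
    by (rule diagonal_char_exists[OF not_covers_imp_char_trivial_low_degree[OF not_covers]])
  obtain \<alpha> where \<alpha>: "\<And>p. \<Psi> p = E \<alpha> p"
    using poly_char_representation[OF \<psi>(3,1) \<Psi>(1)] unfolding E_def by blast
  have "\<alpha> \<notin> rational_fls"
  proof
    assume "\<alpha> \<in> rational_fls"
    then obtain k where "\<alpha> = from_nat_into rational_fls k" using rat by blast
    then show False using \<alpha> \<Psi>(3) by blast
  qed
  then have "well_distributed (\<lambda>n. fls_of_poly_inv (poly P n) * \<alpha>)"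
    using assms unfolding good_for_irrational_equidistribution_def by blast
  then obtain m where m: "haar_probability m"
    "\<And>(g :: 'a fls_torus \<Rightarrow> complex) \<Phi>. continuous_on UNIV g \<Longrightarrow> folner \<Phi> \<Longrightarrow>
      (\<lambda>N. average (\<Phi> N) (\<lambda>n. g (torus_proj (fls_of_poly_inv (poly P n) * \<alpha>)))) \<longlonglongrightarrow> integral\<^sup>L m g"
    unfolding well_distributed_def by blast
  have const: "\<Psi> (poly P n) = \<Psi> (poly P 0)" for n
  proof -
    have "poly P n - poly P 0 \<in> value_subgroup P"
      unfolding value_subgroup_def by (rule group_closure.base) blast
    then show ?thesis using \<Psi>(2) by (simp add: add_char_eq_iff[OF \<Psi>(1), of "poly P n"])
  qed
  have "\<psi> (torus_coeff (torus_proj (fls_of_poly_inv (poly P n) * \<alpha>))) = \<Psi> (poly P 0)" for n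
    using const[of n] \<alpha>[of "poly P n"] by (simp add: torus_coeff_proj E_def)
  then have "(\<lambda>N. average {x :: 'a poly. degree x < Suc N} (\<lambda>n. \<Psi> (poly P 0))) \<longlonglongrightarrow> 0"
    using m(2)[OF continuous_on_torus_coeff[of \<psi>] folner_degree_less] haar_integral_torus_char[OF m(1) \<psi>(1,2)]
    by simp
  moreover have "average {x :: 'a poly. degree x < Suc N} (\<lambda>n. \<Psi> (poly P 0)) = \<Psi> (poly P 0)" for N
  proof (rule average_const)
    have "0 \<in> {x :: 'a poly. degree x < Suc N}" by simp
    then show "{x :: 'a poly. degree x < Suc N} \<noteq> {}" by blast
  qed (rule finite_polys_degree_less)
  ultimately have "(\<lambda>N::nat. \<Psi> (poly P 0)) \<longlonglongrightarrow> 0" by simp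
  then have "\<Psi> (poly P 0) = 0" by (simp add: LIMSEQ_const_iff)
  then show False using add_char_nonzero[OF \<Psi>(1)] by blast
qed

theorem theorem1p17:
  fixes P :: "'a::{field,finite} poly poly"
  assumes "0 < degree P"
  shows "(deviation_vanishes P \<longleftrightarrow> deviation_power_saving P) \<and>
         (deviation_vanishes P \<longleftrightarrow> value_subgroup_covers P) \<and>
         (deviation_vanishes P \<longleftrightarrow> dense_pairs_connected P) \<and>
         (deviation_vanishes P \<longleftrightarrow> pair_count_power_saving P) \<and>
         (good_for_irrational_equidistribution P \<longrightarrow>
            deviation_vanishes P \<and> deviation_power_saving P \<and> value_subgroup_covers P \<and>
            dense_pairs_connected P \<and> pair_count_power_saving P)"
  \<comment> \<open>One cycle runs from covering through power saving, vanishing and connectedness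
    back to covering; the pair count lies between covering and connectedness, and goodness enters at
    covering.\<close>
  using covers_imp_deviation_power_saving[OF assms] covers_imp_pair_count_power_saving[OF assms]
    deviation_power_saving_imp_vanishes[of P] deviation_vanishes_imp_dense_pairs_connected[of P]
    pair_count_power_saving_imp_dense_pairs_connected[of P] dense_pairs_connected_imp_covers[of P]
    good_imp_covers[of P]
  by blast

end
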